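(* Let $n\ge 1$ and let $M$ be a complete, smooth, connected, convex hypersurface in the Euclidean space $\mathbb{E}^{n+1}$. For $p\in M$ and $t>0$ small, let $\Psi$ be the tangent hyperplane of $M$ at $p$ and let $\Phi$ be the hyperplane parallel to $\Psi$, at distance $t$ from $\Psi$, on the side of $\Psi$ where $M$ lies (so that $\Phi$ intersects $M$). Define $A_p(t)$ = the $n$-dimensional area of the region in $\Phi$ enclosed by $\Phi\cap M$; $V_p(t)$ = the $(n+1)$-dimensional volume of the region bounded by $M$ and $\Phi$ (the cap cut off from the convex body by $\Phi$); $S_p(t)$ = the $n$-dimensional surface area of the part of $M$ lying between the hyperplanes $\Phi$ and $\Psi$. Suppose that $M$ satisfies one of the following conditions, for all sufficiently small $t>0$: (A) $A_p(t)$ is independent of the point $p\in M$ (i.e. $A_p(t)$ depends only on $t$); (V) $V_p(t)$ is independent of the point $p\in M$; (S) $S_p(t)$ is independent of the point $p\in M$. Then $M$ is a round hypersphere $S^n(a)$ of some radius $a>0$.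
   Context: All objects are smooth and connected. A round hypersphere $S^n(a)$ is a sphere of radius $a$ in $\mathbb{E}^{n+1}$. *)

theory Defs
  imports "HOL-Analysis.Analysis"
begin

fun Ck_on :: "nat \<Rightarrow> 'a::euclidean_space set \<Rightarrow> ('a \<Rightarrow> real) \<Rightarrow> bool" where
  "Ck_on 0 U f = continuous_on U f"
| "Ck_on (Suc k) U f =
     ((\<forall>x\<in>U. f differentiable (at x)) \<and>
      (\<forall>i\<in>Basis. Ck_on k U (\<lambda>x. frechet_derivative f (at x) i)))"

definition smooth_fun_on :: "'a::euclidean_space set \<Rightarrow> ('a \<Rightarrow> real) \<Rightarrow> bool" where
  "smooth_fun_on U f \<longleftrightarrow> (\<forall>k. Ck_on k U f)"

definition smooth_hypersurface :: "'a::euclidean_space set \<Rightarrow> bool" where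
  "smooth_hypersurface M \<longleftrightarrow>
     (\<forall>p\<in>M. \<exists>U F. open U \<and> p \<in> U \<and> smooth_fun_on U F \<and>
        (\<forall>x\<in>U. frechet_derivative F (at x) \<noteq> (\<lambda>v. 0)) \<and>
        M \<inter> U = {x\<in>U. F x = 0})"

definition tangent_space :: "'a::euclidean_space set \<Rightarrow> 'a \<Rightarrow> 'a set" where
  "tangent_space M p = {v. \<exists>\<gamma> e. e > 0 \<and> (\<forall>s\<in>{-e<..<e}. \<gamma> s \<in> M) \<and> \<gamma> 0 = p \<and>
                              (\<gamma> has_vector_derivative v) (at 0)}"

definition unit_normal_to_side :: "'a::euclidean_space set \<Rightarrow> 'a \<Rightarrow> 'a \<Rightarrow> bool" where
  "unit_normal_to_side M p u \<longleftrightarrow>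
     norm u = 1 \<and> (\<forall>v\<in>tangent_space M p. v \<bullet> u = 0) \<and> (\<forall>x\<in>M. (x - p) \<bullet> u \<ge> 0)"

(* d-dimensional Hausdorff measure, normalized so that it agrees with Lebesgue
   measure on d-dimensional affine subspaces *)
definition hausdorff_measure :: "nat \<Rightarrow> 'a::euclidean_space set \<Rightarrow> ennreal" where
  "hausdorff_measure d A =
     ennreal (unit_ball_vol (real d) / 2 ^ d) *
     (SUP \<delta>\<in>{0<..}. INF E\<in>{E :: nat \<Rightarrow> 'a set. A \<subseteq> (\<Union>i. E i) \<and>
                                   (\<forall>i. bounded (E i) \<and> diameter (E i) \<le> \<delta>)}.
                        (\<Sum>i. ennreal (diameter (E i) ^ d)))"

(* the three quantities, for the cap at p with normal u and height t; C is the convex body *)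
definition area_A :: "'a::euclidean_space set \<Rightarrow> 'a \<Rightarrow> 'a \<Rightarrow> real \<Rightarrow> ennreal" where
  "area_A C p u t = hausdorff_measure (DIM('a) - 1) {x\<in>C. (x - p) \<bullet> u = t}"

definition volume_V :: "'a::euclidean_space set \<Rightarrow> 'a \<Rightarrow> 'a \<Rightarrow> real \<Rightarrow> ennreal" where
  "volume_V C p u t = emeasure lborel {x\<in>C. (x - p) \<bullet> u \<le> t}"

definition surface_S :: "'a::euclidean_space set \<Rightarrow> 'a \<Rightarrow> 'a \<Rightarrow> real \<Rightarrow> ennreal" where
  "surface_S M p u t = hausdorff_measure (DIM('a) - 1) {x\<in>M. 0 \<le> (x - p) \<bullet> u \<and> (x - p) \<bullet> u \<le> t}"

definition independent_of_point ::
    "'a::euclidean_space set \<Rightarrow> ('a \<Rightarrow> 'a \<Rightarrow> real \<Rightarrow> ennreal) \<Rightarrow> bool" where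
  "independent_of_point M Q \<longleftrightarrow>
     (\<exists>\<epsilon>>0. \<exists>f::real \<Rightarrow> real. \<forall>t\<in>{0<..<\<epsilon>}. \<forall>p\<in>M. \<forall>u.
         unit_normal_to_side M p u \<longrightarrow> Q p u t = ennreal (f t))"

end

theory Submission
  imports Defs
begin

text \<open>Only caps of one sufficiently small depth are needed, and no asymptotic expansion in \<open>t\<close>.
  Let \<open>\<mu>\<close> be Lebesgue measure on \<open>C\<close> in case (V), and surface measure on \<open>M\<close> in case (S); case (A)
  reduces to (V) by Fubini, since Hausdorff measure on hyperplanes is a multiple of Lebesgue measure.
  If \<open>C\<close> were unbounded, it would have caps of fixed depth and arbitrarily large size, so \<open>C\<close> is compact.

  Differentiating the potential \<open>\<integral> (t - depth)\<^sup>+ d\<mu>\<close> of a cap in the direction of its normal \<open>u\<close> shows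
  that the first moment of the cap about its contact point is \<open>- c(t) u\<close>, with \<open>c(t)\<close> independent of the point.
  Now move a hyperplane with normal \<open>w\<close> until the reflection of the part of \<open>C\<close> behind it is about to
  leave \<open>C\<close>. At the contact point the caps of \<open>C\<close> and of its mirror image have the same moments, but are
  nested on either side of the hyperplane with the weight \<open>x \<bullet> w - l\<close> changing sign there; hence they
  coincide. This replaces the strong maximum principle and the Hopf lemma of the classical
  argument, and a connectedness argument gives that \<open>C\<close> is symmetric in every direction \<open>w\<close>.\<close>

section \<open>Hausdorff measure as a Borel measure\<close>

text \<open>Hausdorff measure enters through three facts: 1-Lipschitz maps do not increase it, it is
  countably additive on Borel sets, and it is positive on discs. Its ratio to Lebesgue measure on
  slices stays an unevaluated constant \<open>\<kappa>\<close>. Smoothness enters through uniqueness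
  of the outer normal: it makes mirrored normals agree at degenerate chords, and it gives a depth
  below which all normals in a cap make an angle of at most 90 degrees with the axis of the cap.
  Comparing a half cap with its mirror image is pointwise for volume, because reflection preserves
  Lebesgue measure. For surface area the two boundaries are different sets, and one has to be mapped
  onto the other without increasing area. The moving plane argument sees only the resulting
  inequality and its equality case, hence the assumptions \<open>half_cap_le\<close> and
  \<open>half_cap_eq\<close>. The moment identity is a derivative and requires the slice bounding
  the cap to be null. One depth serves all points, because the mass of that slice is the jump of
  \<open>f\<close>; the same depth at every contact point is what makes the connectedness argument
  work.\<close>

definition hausdorff_pre :: "nat \<Rightarrow> real \<Rightarrow> 'a::euclidean_space set \<Rightarrow> ennreal" where
  "hausdorff_pre d \<delta> A = (INF E\<in>{E :: nat \<Rightarrow> 'a set. A \<subseteq> (\<Union>i. E i) \<and>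
     (\<forall>i. bounded (E i) \<and> diameter (E i) \<le> \<delta>)}. (\<Sum>i. ennreal (diameter (E i) ^ d)))"

lemma hausdorff_measure_eq:
  "hausdorff_measure d A =
    ennreal (unit_ball_vol (real d) / 2 ^ d) * (SUP \<delta>\<in>{0<..}. hausdorff_pre d \<delta> A)"
  by (simp add: hausdorff_measure_def hausdorff_pre_def)

lemma hausdorff_pre_le:
  assumes "A \<subseteq> (\<Union>i. E i)" "\<And>i. bounded (E i)" "\<And>i. diameter (E i) \<le> \<delta>"
  shows "hausdorff_pre d \<delta> A \<le> (\<Sum>i. ennreal (diameter (E i) ^ d))"
  unfolding hausdorff_pre_def by (rule INF_lower) (use assms in auto)

lemma hausdorff_pre_less:
  assumes "hausdorff_pre d \<delta> A < c"
  obtains E where "A \<subseteq> (\<Union>i. E i)" "\<And>i. bounded (E i)" "\<And>i. diameter (E i) \<le> \<delta>"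
    "(\<Sum>i. ennreal (diameter (E i) ^ d)) < c"
  using assms unfolding hausdorff_pre_def INF_less_iff by auto

lemma hausdorff_pre_mono: "A \<subseteq> B \<Longrightarrow> hausdorff_pre d \<delta> A \<le> hausdorff_pre d \<delta> B"
  unfolding hausdorff_pre_def by (rule INF_superset_mono) auto

lemma hausdorff_pre_antimono: "\<delta> \<le> \<delta>' \<Longrightarrow> hausdorff_pre d \<delta>' A \<le> hausdorff_pre d \<delta> A"
  unfolding hausdorff_pre_def by (rule INF_superset_mono) (auto intro: order_trans)

lemma hausdorff_pre_subadditive:
  "hausdorff_pre d \<delta> (\<Union>i. A i) \<le> (\<Sum>i::nat. hausdorff_pre d \<delta> (A i))"
proof (rule ennreal_le_epsilon)
  fix e :: real assume "0 < e" "(\<Sum>n. hausdorff_pre d \<delta> (A n)) < top"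
  then have fin: "hausdorff_pre d \<delta> (A n) < top" for n
    by (rule_tac ennreal_suminf_lessD)
  have *: "hausdorff_pre d \<delta> (A n) < hausdorff_pre d \<delta> (A n) + e * (1/2)^Suc n" for n
  proof -
    have "0 < e * (1/2)^Suc n" using \<open>0 < e\<close> by simp
    with fin[of n] show ?thesis
      by (cases "hausdorff_pre d \<delta> (A n)" rule: ennreal_cases)
         (auto simp: ennreal_plus[symmetric] ennreal_less_iff simp del: ennreal_plus power_Suc)
  qed
  have "\<forall>n. \<exists>E. A n \<subseteq> (\<Union>i. E i) \<and> (\<forall>i. bounded (E i)) \<and> (\<forall>i. diameter (E i) \<le> \<delta>) \<and>
      (\<Sum>i. ennreal (diameter (E i) ^ d)) \<le> hausdorff_pre d \<delta> (A n) + e * (1/2)^Suc n"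
  proof
    fix n show "\<exists>E. A n \<subseteq> (\<Union>i. E i) \<and> (\<forall>i. bounded (E i)) \<and> (\<forall>i. diameter (E i) \<le> \<delta>) \<and>
      (\<Sum>i. ennreal (diameter (E i) ^ d)) \<le> hausdorff_pre d \<delta> (A n) + e * (1/2)^Suc n"
      by (rule hausdorff_pre_less[OF *[of n]]) (intro exI conjI allI, assumption+, rule less_imp_le)
  qed
  from choice[OF this] obtain B where B0: "\<forall>n. A n \<subseteq> (\<Union>i. B n i) \<and> (\<forall>i. bounded (B n i)) \<and>
      (\<forall>i. diameter (B n i) \<le> \<delta>) \<and>
      (\<Sum>i. ennreal (diameter (B n i) ^ d)) \<le> hausdorff_pre d \<delta> (A n) + e * (1/2)^Suc n" ..
  have B: "A n \<subseteq> (\<Union>i. B n i)" "bounded (B n i)" "diameter (B n i) \<le> \<delta>"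
      "(\<Sum>i. ennreal (diameter (B n i) ^ d)) \<le> hausdorff_pre d \<delta> (A n) + e * (1/2)^Suc n" for n i
    using B0 by blast+
  define C where "C = case_prod B o prod_decode"
  have "(\<Union>i. A i) \<subseteq> (\<Union>i. C i)"
    using B(1) by (auto simp add: C_def subset_eq) (metis prod.case prod_encode_inverse)
  then have "hausdorff_pre d \<delta> (\<Union>i. A i) \<le> (\<Sum>i. ennreal (diameter (C i) ^ d))"
    by (rule hausdorff_pre_le) (auto simp: C_def split_def B)
  also have "\<dots> = (\<Sum>n. \<Sum>i. ennreal (diameter (B n i) ^ d))"
    unfolding C_def comp_def
    by (rule suminf_ennreal_2dimen) auto
  also have "\<dots> \<le> (\<Sum>n. hausdorff_pre d \<delta> (A n) + e * (1/2) ^ Suc n)"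
    by (intro suminf_le allI B(4)) auto
  also have "... = (\<Sum>n. hausdorff_pre d \<delta> (A n)) + (\<Sum>n. ennreal e * ennreal ((1/2) ^ Suc n))"
    using \<open>0 < e\<close> by (subst suminf_add[symmetric])
                     (auto simp del: ennreal_suminf_cmult simp add: ennreal_mult[symmetric])
  also have "\<dots> = (\<Sum>n. hausdorff_pre d \<delta> (A n)) + e"
    unfolding ennreal_suminf_cmult
    by (subst suminf_ennreal_eq[OF zero_le_power power_half_series]) auto
  finally show "hausdorff_pre d \<delta> (\<Union>i. A i) \<le> (\<Sum>n. hausdorff_pre d \<delta> (A n)) + e" .
qed

text \<open>A set of diameter at most \<open>\<delta>\<close> meets at most one of \<open>A\<close>
  and \<open>B\<close>, so cutting a cover of the union by \<open>A\<close> and by \<open>B\<close>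
  splits its sum. The piece that is empty contributes \<open>0 ^ d\<close>, which vanishes for
  positive \<open>d\<close>.\<close>

lemma hausdorff_pre_separated:
  assumes d: "0 < d" and "\<delta> < \<eta>" and sep: "\<And>x y. x \<in> A \<Longrightarrow> y \<in> B \<Longrightarrow> \<eta> \<le> dist x y"
  shows "hausdorff_pre d \<delta> A + hausdorff_pre d \<delta> B \<le> hausdorff_pre d \<delta> (A \<union> B)"
  unfolding hausdorff_pre_def[of d \<delta> "A \<union> B"]
proof (rule INF_greatest, safe)
  fix E :: "nat \<Rightarrow> 'a set"
  assume E: "A \<union> B \<subseteq> \<Union> (range E)" "\<forall>i. bounded (E i) \<and> diameter (E i) \<le> \<delta>"
  have sub: "bounded (E i \<inter> X)" "diameter (E i \<inter> X) \<le> \<delta>" for i X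
    using E(2) order_trans[OF diameter_subset[of "E i \<inter> X" "E i"]] by (auto intro: bounded_Int)
  have "hausdorff_pre d \<delta> A \<le> (\<Sum>i. ennreal (diameter (E i \<inter> A) ^ d))"
    by (rule hausdorff_pre_le) (use E(1) sub in auto)
  moreover have "hausdorff_pre d \<delta> B \<le> (\<Sum>i. ennreal (diameter (E i \<inter> B) ^ d))"
    by (rule hausdorff_pre_le) (use E(1) sub in auto)
  ultimately have "hausdorff_pre d \<delta> A + hausdorff_pre d \<delta> B
      \<le> (\<Sum>i. ennreal (diameter (E i \<inter> A) ^ d) + ennreal (diameter (E i \<inter> B) ^ d))"
    by (subst suminf_add[symmetric]) (auto intro: add_mono)
  also have "\<dots> \<le> (\<Sum>i. ennreal (diameter (E i) ^ d))"
  proof (intro suminf_le allI)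
    fix i
    have bd: "bounded (E i)" "diameter (E i) \<le> \<delta>" using E by auto
    have "E i \<inter> A = {} \<or> E i \<inter> B = {}"
    proof (rule ccontr)
      assume "\<not> ?thesis"
      then obtain x y where "x \<in> E i" "x \<in> A" "y \<in> E i" "y \<in> B" by auto
      with sep[of x y] diameter_bounded_bound[OF bd(1), of x y] bd(2) \<open>\<delta> < \<eta>\<close> show False by simp
    qed
    moreover have "diameter (E i \<inter> X) ^ d \<le> diameter (E i) ^ d" for X
      by (intro power_mono diameter_subset diameter_ge_0 bounded_Int) (use bd in auto)
    ultimately show "ennreal (diameter (E i \<inter> A) ^ d) + ennreal (diameter (E i \<inter> B) ^ d)
        \<le> ennreal (diameter (E i) ^ d)"
      using d ennreal_leI by (auto simp: power_0_left)
  qed auto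
  finally show "hausdorff_pre d \<delta> A + hausdorff_pre d \<delta> B \<le> (\<Sum>i. ennreal (diameter (E i) ^ d))" .
qed

lemma hausdorff_measure_mono: "A \<subseteq> B \<Longrightarrow> hausdorff_measure d A \<le> hausdorff_measure d B"
  unfolding hausdorff_measure_eq by (intro mult_left_mono SUP_mono' hausdorff_pre_mono) auto

text \<open>Covers are infinite sequences and \<open>0 ^ 0 = 1\<close>, so padding with empty sets
  is free only in positive dimension; this is the origin of the hypothesis \<open>0 < d\<close> here
  and below.\<close>

lemma hausdorff_measure_empty:
  assumes "0 < d" shows "hausdorff_measure d {} = 0"
proof -
  have "hausdorff_pre d \<delta> ({}::'a set) \<le> 0" if "\<delta> > 0" for \<delta>
    using hausdorff_pre_le[of "{}" "\<lambda>_. {}::'a set" \<delta> d] assms that by (simp add: power_0_left)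
  then have "(SUP \<delta>\<in>{0<..}. hausdorff_pre d \<delta> ({}::'a set)) \<le> 0" by (intro SUP_least) auto
  then show ?thesis by (simp add: hausdorff_measure_eq)
qed

lemma hausdorff_measure_subadditive:
  "hausdorff_measure d (\<Union>i. A i) \<le> (\<Sum>i::nat. hausdorff_measure d (A i))"
  unfolding hausdorff_measure_eq ennreal_suminf_cmult
proof (intro mult_left_mono SUP_least)
  fix \<delta> :: real assume "\<delta> \<in> {0<..}"
  then show "hausdorff_pre d \<delta> (\<Union>i. A i) \<le> (\<Sum>i. SUP \<delta>\<in>{0<..}. hausdorff_pre d \<delta> (A i))"
    by (intro order_trans[OF hausdorff_pre_subadditive] suminf_le) (auto intro: SUP_upper)
qed auto

lemma hausdorff_measure_Un:
  assumes "0 < d" shows "hausdorff_measure d (A \<union> B) \<le> hausdorff_measure d A + hausdorff_measure d B"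
proof -
  let ?F = "\<lambda>i. if i = 0 then A else if i = 1 then B else {}"
  have "A \<union> B = (\<Union>i::nat. ?F i)" by (auto split: if_splits)
  then have "hausdorff_measure d (A \<union> B) \<le> (\<Sum>i::nat. hausdorff_measure d (?F i))"
    using hausdorff_measure_subadditive[of d ?F] by simp
  also have "\<dots> = (\<Sum>i\<in>{0,1::nat}. hausdorff_measure d (?F i))"
    by (rule suminf_finite) (auto simp: hausdorff_measure_empty assms)
  finally show ?thesis by simp
qed

text \<open>The separation takes effect once the scale is below \<open>\<eta>\<close>. Since
  \<open>hausdorff_pre\<close> grows as the scale shrinks, two scales can be lowered to a common one
  of that size.\<close>

lemma hausdorff_measure_separated:
  assumes d: "0 < d" and "0 < \<eta>" and sep: "\<And>x y. x \<in> A \<Longrightarrow> y \<in> B \<Longrightarrow> \<eta> \<le> dist x y"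
  shows "hausdorff_measure d A + hausdorff_measure d B \<le> hausdorff_measure d (A \<union> B)"
  unfolding hausdorff_measure_eq distrib_left[symmetric]
proof (rule mult_left_mono)
  let ?S = "\<lambda>X. SUP \<delta>\<in>{0<..}. hausdorff_pre d \<delta> X"
  have *: "hausdorff_pre d a A + hausdorff_pre d b B \<le> ?S (A \<union> B)" if "a > 0" "b > 0" for a b
  proof -
    define c where "c = min (min a b) (\<eta>/2)"
    have c: "c > 0" "c \<le> a" "c \<le> b" "c < \<eta>" using that \<open>0 < \<eta>\<close> by (auto simp: c_def min_def)
    have "hausdorff_pre d a A + hausdorff_pre d b B \<le> hausdorff_pre d c A + hausdorff_pre d c B"
      by (intro add_mono hausdorff_pre_antimono c)
    also have "\<dots> \<le> hausdorff_pre d c (A \<union> B)"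
      using hausdorff_pre_separated[OF d c(4) sep] .
    also have "\<dots> \<le> ?S (A \<union> B)" using c by (intro SUP_upper) auto
    finally show ?thesis .
  qed
  have "?S A + ?S B = (SUP a\<in>{0<..}. SUP b\<in>{0<..}. hausdorff_pre d a A + hausdorff_pre d b B)"
    by (simp add: ennreal_SUP_add_left[symmetric] ennreal_SUP_add_right[symmetric])
  also have "\<dots> \<le> ?S (A \<union> B)"
    by (intro SUP_least *) auto
  finally show "?S A + ?S B \<le> ?S (A \<union> B)" .
qed auto

lemma hausdorff_measure_lipschitz_image:
  fixes f :: "'a::euclidean_space \<Rightarrow> 'a"
  assumes f: "\<And>x y. x \<in> A \<Longrightarrow> y \<in> A \<Longrightarrow> dist (f x) (f y) \<le> dist x y" and B: "B \<subseteq> f ` A"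
  shows "hausdorff_measure d B \<le> hausdorff_measure d A"
  unfolding hausdorff_measure_eq
proof (intro mult_left_mono SUP_mono')
  fix \<delta> :: real
  show "hausdorff_pre d \<delta> B \<le> hausdorff_pre d \<delta> A"
    unfolding hausdorff_pre_def[of d \<delta> A]
  proof (rule INF_greatest, safe)
    fix E :: "nat \<Rightarrow> 'a set"
    assume E: "A \<subseteq> \<Union> (range E)" "\<forall>i. bounded (E i) \<and> diameter (E i) \<le> \<delta>"
    have bE: "bounded (E i \<inter> A)" and bE': "bounded (E i)" for i using E(2) by (auto intro: bounded_Int)
    have dist: "dist x y \<le> diameter (E i)" if "x \<in> f ` (E i \<inter> A)" "y \<in> f ` (E i \<inter> A)" for i x y
    proof -
      from that obtain a b where "a \<in> E i" "a \<in> A" "b \<in> E i" "b \<in> A" "x = f a" "y = f b" by auto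
      then show ?thesis using f[of a b] diameter_bounded_bound[OF bE', of a i b] by simp
    qed
    have dia: "diameter (f ` (E i \<inter> A)) \<le> diameter (E i)" for i
    proof (rule diameter_le)
      show "f ` (E i \<inter> A) \<noteq> {} \<or> 0 \<le> diameter (E i)" using diameter_ge_0[OF bE'] by auto
      show "\<And>x y. x \<in> f ` (E i \<inter> A) \<Longrightarrow> y \<in> f ` (E i \<inter> A) \<Longrightarrow> norm (x - y) \<le> diameter (E i)"
        using dist by (simp add: dist_norm)
    qed
    have bd: "bounded (f ` (E i \<inter> A))" for i
      unfolding bounded_two_points by (intro exI[of _ "diameter (E i)"] ballI dist)
    have "hausdorff_pre d \<delta> B \<le> (\<Sum>i. ennreal (diameter (f ` (E i \<inter> A)) ^ d))"
    proof (rule hausdorff_pre_le)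
      have "(\<Union>i. f ` (E i \<inter> A)) = f ` (\<Union>i. E i \<inter> A)" by (rule image_UN[symmetric])
      moreover have "(\<Union>i. E i \<inter> A) = A" using E(1) by auto
      ultimately show "B \<subseteq> (\<Union>i. f ` (E i \<inter> A))" using B by simp
      show "diameter (f ` (E i \<inter> A)) \<le> \<delta>" for i using order_trans[OF dia] E(2) by simp
    qed (rule bd)
    also have "\<dots> \<le> (\<Sum>i. ennreal (diameter (E i) ^ d))"
      by (intro suminf_le allI ennreal_leI power_mono dia diameter_ge_0 bd) auto
    finally show "hausdorff_pre d \<delta> B \<le> (\<Sum>i. ennreal (diameter (E i) ^ d))" .
  qed
qed auto

text \<open>Caratheodory's criterion for metric outer measures. \<open>A k\<close> is the part of
  \<open>S\<close> at distance at least \<open>1 / (k + 1)\<close> from \<open>F\<close>, and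
  \<open>B k\<close> is the shell between two consecutive such sets. The shells have summable
  measure, so \<open>S - F\<close> exceeds \<open>A k\<close> by a small tail, while
  \<open>A k\<close> is separated from \<open>F\<close>.\<close>

lemma hausdorff_measure_closed_split:
  assumes d: "0 < d" and F: "closed F"
  shows "hausdorff_measure d (S \<inter> F) + hausdorff_measure d (S - F) \<le> hausdorff_measure d S"
proof (cases "F = {} \<or> hausdorff_measure d S = top")
  case True
  then show ?thesis by (auto simp: hausdorff_measure_empty[OF d])
next
  case False
  then have ne: "F \<noteq> {}" and fin: "hausdorff_measure d S \<noteq> top" by auto
  define A where "A k = {x\<in>S. 1 / real (Suc k) \<le> infdist x F}" for k
  define B where "B k = A (Suc k) - A k" for k
  let ?H = "hausdorff_measure d :: 'a set \<Rightarrow> ennreal"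
  have infd: "infdist x F \<le> dist x y + infdist y F" for x y
    by (metis infdist_triangle add.commute)
  have subS: "A k \<subseteq> S" "B k \<subseteq> S" for k by (auto simp: A_def B_def)
  have gap: "1 / real (Suc k) - 1 / real (Suc l) > 0" if "k < l" for k l
    using that by (simp add: divide_simps)
  have Bsep: "1 / real (Suc (Suc i)) - 1 / real (Suc j) \<le> dist x y"
    if "x \<in> A (Suc i)" "y \<in> B j" for i j x y
  proof -
    have "1 / real (Suc (Suc i)) \<le> infdist x F" using that(1) unfolding A_def by blast
    moreover have "\<not> 1 / real (Suc j) \<le> infdist y F" using that(2) unfolding A_def B_def by blast
    ultimately show ?thesis using infd[of x y] by linarith
  qed
  have Amono: "A i \<subseteq> A j" if "i \<le> j" for i j
  proof -
    have "1 / real (Suc j) \<le> 1 / real (Suc i)" using that by (simp add: divide_simps)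
    then show ?thesis by (auto simp: A_def)
  qed
  \<comment> \<open>The offset \<open>c\<close> selects a parity. Shells of equal parity are
    separated, whereas neighbouring ones may touch; treating the parities apart is what costs the
    factor two in the bound on all shells.\<close>
  have sums: "(\<Sum>j<N. ?H (B (2*j+c))) \<le> ?H S" for N c
  proof -
    have "(\<Sum>j<N. ?H (B (2*j+c))) \<le> ?H (\<Union>j<N. B (2*j+c))"
    proof (induction N)
      case 0 then show ?case by simp
    next
      case (Suc N)
      \<comment> \<open>For positive \<open>N\<close> the last shell in the union has index
        \<open>2*N+c-2\<close>, so the separation from the next one is the gap between
        \<open>2*N+c-1\<close> and \<open>2*N+c\<close>; \<open>N = 0\<close> is excluded because of
        truncated subtraction.\<close>
      have U: "(\<Union>j<N. B (2*j+c)) \<subseteq> A (Suc (2*N+c-2))" if "N > 0"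
      proof safe
        fix j x assume "j < N" "x \<in> B (2*j+c)"
        moreover from this have "Suc (2*j+c) \<le> Suc (2*N+c-2)" by linarith
        ultimately show "x \<in> A (Suc (2*N+c-2))"
          using Amono[of "Suc (2*j+c)" "Suc (2*N+c-2)"] by (auto simp: B_def)
      qed
      have "(\<Sum>j<Suc N. ?H (B (2*j+c))) \<le> ?H (\<Union>j<N. B (2*j+c)) + ?H (B (2*N+c))"
        using Suc by (simp add: add_mono)
      also have "\<dots> \<le> ?H ((\<Union>j<N. B (2*j+c)) \<union> B (2*N+c))"
      proof (cases "N = 0")
        case False
        have lt: "Suc (2*N+c-2) < 2*N+c" using False by auto
        show ?thesis
          by (rule hausdorff_measure_separated[OF d gap[OF lt]])
             (use U Bsep[of _ "2*N+c-2" _ "2*N+c"] False in auto)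
      qed (simp add: hausdorff_measure_empty[OF d])
      finally show ?case by (simp add: lessThan_Suc Un_commute)
    qed
    also have "\<dots> \<le> ?H S" by (rule hausdorff_measure_mono) (use subS in auto)
    finally show ?thesis .
  qed
  have "(\<Sum>j<2*N. ?H (B j)) = (\<Sum>j<N. ?H (B (2*j+0))) + (\<Sum>j<N. ?H (B (2*j+1)))" for N
    by (induction N) (auto simp: add_ac)
  then have "(\<Sum>j<2*N. ?H (B j)) \<le> ?H S + ?H S" for N
    using sums[of 0 N] sums[of 1 N] by (simp add: add_mono)
  then have bd: "(\<Sum>j<N. ?H (B j)) \<le> ?H S + ?H S" for N
    using sum_mono2[of "{..<2*N}" "{..<N}" "\<lambda>j. ?H (B j)"] by (force intro: order_trans)
  have "(\<Sum>j. ?H (B j)) \<le> ?H S + ?H S"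
    by (rule suminf_le_const[OF summableI bd])
  then have finB: "(\<Sum>j. ?H (B j)) < top"
    using fin by (simp add: less_top le_less_trans ennreal_add_eq_top)
  define g where "g j = enn2real (?H (B j))" for j
  have Hg: "?H (B j) = ennreal (g j)" for j
    using ennreal_suminf_lessD[OF finB, of j] by (simp add: g_def)
  have g0: "0 \<le> g j" for j by (simp add: g_def)
  have sg: "summable g"
    by (rule summable_suminf_not_top) (use finB Hg g0 in auto)
  have cover: "S - F \<subseteq> A k \<union> (\<Union>j. B (j+k))" for k
  proof
    fix x assume x: "x \<in> S - F"
    then have "infdist x F > 0" using in_closed_iff_infdist_zero[OF F ne] infdist_nonneg[of x F] by fastforce
    then obtain m where "1 / real (Suc m) < infdist x F" using reals_Archimedean by (auto simp: inverse_eq_divide)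
    then have ex: "x \<in> A m" using x by (auto simp: A_def)
    show "x \<in> A k \<union> (\<Union>j. B (j+k))"
    proof (cases "x \<in> A k")
      case False
      define l where "l = (LEAST m. x \<in> A m)"
      have l: "x \<in> A l" unfolding l_def using ex by (rule LeastI)
      have kl: "k < l" using Amono[of l k] l False by (cases "k < l") auto
      have "x \<notin> A (l - 1)"
        using kl not_less_Least[of "l-1" "\<lambda>m. x \<in> A m"] by (auto simp: l_def)
      then have "x \<in> B (l - 1)" using l kl by (simp add: B_def)
      then show ?thesis using kl by (auto intro!: exI[of _ "l-1-k"])
    qed auto
  qed
  have le: "?H (S \<inter> F) + ?H (S - F) \<le> ?H S + ennreal e" if "e > 0" for e
  proof -
    have "\<exists>N. \<forall>n\<ge>N. norm (\<Sum>i. g (i+n)) < e" by (rule suminf_exist_split) (use that sg in auto)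
    then obtain k where k: "\<And>n. k \<le> n \<Longrightarrow> norm (\<Sum>i. g (i+n)) < e" by auto
    have "?H (S - F) \<le> ?H (A k \<union> (\<Union>j. B (j+k)))" by (rule hausdorff_measure_mono[OF cover])
    also have "\<dots> \<le> ?H (A k) + ?H (\<Union>j. B (j+k))" by (rule hausdorff_measure_Un[OF d])
    also have "\<dots> \<le> ?H (A k) + (\<Sum>j. ?H (B (j+k)))"
      by (intro add_mono order_refl hausdorff_measure_subadditive)
    also have "(\<Sum>j. ?H (B (j+k))) = ennreal (\<Sum>j. g (j+k))"
      unfolding Hg by (intro suminf_ennreal2 g0 summable_ignore_initial_segment sg)
    also have "\<dots> \<le> ennreal e" using k[of k] by (intro ennreal_leI) auto
    finally have "?H (S \<inter> F) + ?H (S - F) \<le> ?H (S \<inter> F) + (?H (A k) + ennreal e)"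
      by (simp add: add_mono)
    also have "\<dots> = (?H (S \<inter> F) + ?H (A k)) + ennreal e" by (simp add: add_ac)
    also have "?H (S \<inter> F) + ?H (A k) \<le> ?H ((S \<inter> F) \<union> A k)"
    proof (rule hausdorff_measure_separated[OF d])
      show "1 / real (Suc k) \<le> dist x y" if "x \<in> S \<inter> F" "y \<in> A k" for x y
        using that infd[of y x] by (auto simp: A_def dist_commute)
    qed simp
    also have "?H ((S \<inter> F) \<union> A k) \<le> ?H S" by (rule hausdorff_measure_mono) (use subS in auto)
    finally show ?thesis by (simp add: add_mono)
  qed
  show ?thesis by (rule ennreal_le_epsilon) (use le in auto)
qed

definition hausdorff_borel :: "nat \<Rightarrow> 'a::euclidean_space measure" where
  "hausdorff_borel d = measure_of UNIV (sets borel) (hausdorff_measure d)"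

lemma
  shows space_hausdorff_borel [simp]: "space (hausdorff_borel d) = UNIV"
  and sets_hausdorff_borel [measurable_cong, simp]: "sets (hausdorff_borel d) = sets borel"
  unfolding hausdorff_borel_def
  by (simp_all add: sets.sigma_sets_eq[of borel, simplified])

lemma outer_measure_space_hausdorff:
  assumes "0 < d"
  shows "outer_measure_space (Pow UNIV) (hausdorff_measure d :: 'a::euclidean_space set \<Rightarrow> ennreal)"
  unfolding outer_measure_space_def positive_def increasing_def countably_subadditive_def
  using assms by (auto simp: hausdorff_measure_empty hausdorff_measure_mono hausdorff_measure_subadditive)

text \<open>The sets that split every set additively form a sigma-algebra on which the outer measure
  is countably additive. It contains the closed sets, hence all Borel sets.\<close>

lemma emeasure_hausdorff_borel:
  fixes A :: "'a::euclidean_space set"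
  assumes d: "0 < d" and A: "A \<in> sets borel"
  shows "emeasure (hausdorff_borel d) A = hausdorff_measure d A"
proof -
  let ?L = "lambda_system UNIV (Pow UNIV) (hausdorff_measure d :: 'a set \<Rightarrow> ennreal)"
  interpret P: sigma_algebra "UNIV::'a set" "Pow UNIV" by (rule sigma_algebra_Pow)
  have ms: "measure_space (UNIV::'a set) ?L (hausdorff_measure d)"
    by (rule P.caratheodory_lemma[OF outer_measure_space_hausdorff[OF d]])
  then interpret L: sigma_algebra "UNIV::'a set" ?L by (simp add: measure_space_def)
  have "Collect closed \<subseteq> ?L"
  proof safe
    fix F :: "'a set" assume F: "closed F"
    have "hausdorff_measure d (S \<inter> F) + hausdorff_measure d (S - F) = hausdorff_measure d S" for S
      using hausdorff_measure_closed_split[OF d F, of S]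
        hausdorff_measure_Un[OF d, of "S \<inter> F" "S - F"] by (simp add: Int_Diff_Un antisym)
    then show "F \<in> ?L" unfolding P.lambda_system_eq by simp
  qed
  then have "sigma_sets UNIV (Collect closed) \<subseteq> ?L" by (rule L.sigma_sets_subset)
  then have sub: "sets borel \<subseteq> ?L" by (simp add: borel_eq_closed)
  have "countably_additive (sets borel) (hausdorff_measure d :: 'a set \<Rightarrow> ennreal)"
    unfolding countably_additive_def
  proof safe
    fix A :: "nat \<Rightarrow> 'a set" assume A: "range A \<subseteq> sets borel" "disjoint_family A"
    then have "range A \<subseteq> ?L" using sub by blast
    then show "(\<Sum>i. hausdorff_measure d (A i)) = hausdorff_measure d (\<Union> (range A))"
      using ms A(2) L.countable_UN[of A UNIV] unfolding measure_space_def countably_additive_def by simp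
  qed
  then show ?thesis unfolding hausdorff_borel_def
    by (intro emeasure_measure_of_sigma A sets.sigma_algebra_axioms[of borel, simplified])
       (auto simp: positive_def hausdorff_measure_empty d)
qed

lemma hausdorff_measure_isometry:
  fixes f :: "'a::euclidean_space \<Rightarrow> 'a"
  assumes "\<And>x y. dist (f x) (f y) = dist x y"
  shows "hausdorff_measure d (f ` A) = hausdorff_measure d A"
proof (rule antisym)
  show "hausdorff_measure d (f ` A) \<le> hausdorff_measure d A"
    by (rule hausdorff_measure_lipschitz_image[where f=f]) (use assms in auto)
  have inj: "inj f" using assms by (metis dist_eq_0_iff injI)
  show "hausdorff_measure d A \<le> hausdorff_measure d (f ` A)"
  proof (rule hausdorff_measure_lipschitz_image[where f="inv f"])
    show "A \<subseteq> inv f ` f ` A" using inj by (simp add: image_inv_f_f)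
    show "dist (inv f x) (inv f y) \<le> dist x y" if "x \<in> f ` A" "y \<in> f ` A" for x y
      using that assms inj by auto
  qed
qed

section \<open>Reflections in hyperplanes, and discs\<close>

definition refl_hyp :: "'a::euclidean_space \<Rightarrow> real \<Rightarrow> 'a \<Rightarrow> 'a" where
  "refl_hyp w l x = x - (2 * (x \<bullet> w - l)) *\<^sub>R w"

lemma refl_hyp_refl_hyp: "norm w = 1 \<Longrightarrow> refl_hyp w l (refl_hyp w l x) = x"
  by (simp add: refl_hyp_def algebra_simps dot_square_norm)

lemma refl_hyp_inner: "norm w = 1 \<Longrightarrow> refl_hyp w l x \<bullet> w = 2 * l - x \<bullet> w"
  by (simp add: refl_hyp_def algebra_simps dot_square_norm)

text \<open>\<open>refl_hyp w 0\<close> is the linear part: points are mirrored with the level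
  \<open>l\<close>, differences and normals with level \<open>0\<close>.\<close>

lemma refl_hyp_diff: "refl_hyp w l x - refl_hyp w l y = refl_hyp w 0 (x - y)"
  by (simp add: refl_hyp_def algebra_simps)

lemma refl_hyp_inner_refl_hyp: "norm w = 1 \<Longrightarrow> refl_hyp w 0 x \<bullet> refl_hyp w 0 y = x \<bullet> y"
  by (simp add: refl_hyp_def algebra_simps dot_square_norm inner_commute)

lemma norm_refl_hyp: "norm w = 1 \<Longrightarrow> norm (refl_hyp w 0 x) = norm x"
  by (simp add: norm_eq_sqrt_inner refl_hyp_inner_refl_hyp)

lemma dist_refl_hyp: "norm w = 1 \<Longrightarrow> dist (refl_hyp w l x) (refl_hyp w l y) = dist x y"
  by (simp add: dist_norm refl_hyp_diff norm_refl_hyp)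

lemma continuous_on_refl_hyp [continuous_intros]: "continuous_on S (refl_hyp w l)"
  unfolding refl_hyp_def by (intro continuous_intros)

lemma refl_hyp_borel [measurable]: "refl_hyp w l \<in> borel_measurable borel"
  by (intro borel_measurable_continuous_onI continuous_on_refl_hyp)

text \<open>As the norms agree, the perpendicular bisector of \<open>x\<close> and \<open>y\<close>
  passes through the origin. Reflections are therefore transitive on spheres, which makes rotations
  unnecessary for changing directions.\<close>

lemma refl_hyp_swap:
  assumes "norm x = norm y" "x \<noteq> y"
  obtains w where "norm w = 1" "refl_hyp w 0 x = y"
proof
  let ?w = "(x - y) /\<^sub>R norm (x - y)"
  show "norm ?w = 1" using assms by simp
  have "x \<bullet> x = y \<bullet> y" using assms(1) by (simp add: dot_square_norm)
  then have "2 * (x \<bullet> (x - y)) = (x - y) \<bullet> (x - y)" by (simp add: algebra_simps inner_commute)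
  also have "\<dots> = norm (x - y) * norm (x - y)" by (simp add: dot_square_norm power2_eq_square)
  finally have "2 * (x \<bullet> (x - y)) = norm (x - y) * norm (x - y)" .
  moreover have "x \<bullet> ?w = (x \<bullet> (x - y)) / norm (x - y)" by (simp only: inner_scaleR_right divide_inverse mult.commute)
  ultimately have "2 * (x \<bullet> ?w) = norm (x - y)" using assms(2) by simp
  then show "refl_hyp ?w 0 x = y" using assms(2) by (simp add: refl_hyp_def)
qed

definition disc :: "'a::euclidean_space \<Rightarrow> real \<Rightarrow> 'a set" where
  "disc u r = {x. x \<bullet> u = 0 \<and> norm x < r}"

lemma disc_borel [measurable]: "disc u r \<in> sets borel"
  unfolding disc_def by measurable

lemma refl_hyp_disc:
  assumes "norm w = 1" shows "refl_hyp w 0 ` disc u r = disc (refl_hyp w 0 u) r"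
proof
  have *: "refl_hyp w 0 ` disc u r \<subseteq> disc (refl_hyp w 0 u) r" for u
    using assms by (auto simp: disc_def refl_hyp_inner_refl_hyp norm_refl_hyp)
  show "refl_hyp w 0 ` disc u r \<subseteq> disc (refl_hyp w 0 u) r" by (rule *)
  show "disc (refl_hyp w 0 u) r \<subseteq> refl_hyp w 0 ` disc u r"
  proof
    fix x assume "x \<in> disc (refl_hyp w 0 u) r"
    then have "refl_hyp w 0 x \<in> disc u r"
      using *[of "refl_hyp w 0 u"] by (auto simp: refl_hyp_refl_hyp assms)
    then show "x \<in> refl_hyp w 0 ` disc u r"
      by (rule rev_image_eqI) (simp add: refl_hyp_refl_hyp assms)
  qed
qed

lemma hausdorff_measure_disc_eq:
  fixes u v :: "'a::euclidean_space"
  assumes "norm u = norm v" shows "hausdorff_measure d (disc u r) = hausdorff_measure d (disc v r)"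
proof (cases "u = v")
  case False
  then obtain w where "norm w = 1" "refl_hyp w 0 u = v" using refl_hyp_swap assms by blast
  then show ?thesis
    using hausdorff_measure_isometry[of "refl_hyp w 0" d "disc u r"] by (simp add: dist_refl_hyp refl_hyp_disc)
qed simp

text \<open>Each covering set is thickened to a box of height 1 along \<open>b\<close> and side
  \<open>2 * diameter\<close> otherwise, of volume \<open>2 ^ n * diameter ^ n\<close>. The boxes
  cover a ball centred at height 1/2 whose radius is at most 1/2, so that it stays between heights 0
  and 1, and at most \<open>r\<close>, so that it lies above the disc. Its volume \<open>m\<close>
  bounds every covering sum from below.\<close>

lemma hausdorff_measure_disc_pos:
  fixes u :: "'a::euclidean_space"
  assumes n: "DIM('a) = Suc n" "0 < n" and u: "norm u = 1" and r: "0 < r"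
  shows "0 < hausdorff_measure n (disc u r)"
proof -
  obtain b :: 'a where b: "b \<in> Basis" using nonempty_Basis by blast
  let ?B = "ball ((1/2) *\<^sub>R b) (min r (1/2))"
  define m where "m = unit_ball_vol (real DIM('a)) * min r (1/2) ^ DIM('a)"
  have m: "0 < m" unfolding m_def using r by simp
  have em: "emeasure lborel ?B = ennreal m" unfolding m_def using r by (simp add: emeasure_ball)
  have "ennreal (m / 2 ^ n) \<le> hausdorff_pre n 1 (disc b r)"
    unfolding hausdorff_pre_def
  proof (rule INF_greatest, safe)
    fix E :: "nat \<Rightarrow> 'a set"
    assume E: "disc b r \<subseteq> \<Union> (range E)" "\<forall>i. bounded (E i) \<and> diameter (E i) \<le> 1"
    define x where "x i = (SOME x. x \<in> E i)" for i
    define lo where "lo i = (\<Sum>c\<in>Basis. (if c = b then 0 else x i \<bullet> c - diameter (E i)) *\<^sub>R c)" for i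
    define hi where "hi i = (\<Sum>c\<in>Basis. (if c = b then 1 else x i \<bullet> c + diameter (E i)) *\<^sub>R c)" for i
    have d0: "0 \<le> diameter (E i)" for i using E(2) diameter_ge_0 by auto
    have vol: "emeasure lborel (cbox (lo i) (hi i)) = ennreal (2 ^ n * diameter (E i) ^ n)" for i
    proof -
      have "emeasure lborel (cbox (lo i) (hi i)) = ennreal (\<Prod>c\<in>Basis. (hi i - lo i) \<bullet> c)"
        by (rule emeasure_lborel_cbox) (use d0 in \<open>auto simp: lo_def hi_def intro: order_trans\<close>)
      also have "(\<Prod>c\<in>Basis. (hi i - lo i) \<bullet> c) = (\<Prod>c\<in>Basis - {b}. 2 * diameter (E i))"
        by (subst prod.remove[OF finite_Basis b])
           (use b in \<open>auto simp: lo_def hi_def inner_diff_left intro!: prod.cong\<close>)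
      finally show ?thesis using n b by (simp add: power_mult_distrib)
    qed
    have "?B \<subseteq> (\<Union>i. cbox (lo i) (hi i))"
    proof
      fix z assume z: "z \<in> ?B"
      define y where "y = z - (z \<bullet> b) *\<^sub>R b"
      have zc: "norm (z - (1/2) *\<^sub>R b) < min r (1/2)" using z by (simp add: dist_norm norm_minus_commute)
      have "\<bar>(z - (1/2) *\<^sub>R b) \<bullet> b\<bar> \<le> norm (z - (1/2) *\<^sub>R b)" by (rule Basis_le_norm[OF b])
      then have zb: "0 \<le> z \<bullet> b" "z \<bullet> b \<le> 1" using zc b by (auto simp: inner_diff_left)
      have "norm y ^ 2 + ((z \<bullet> b) - 1/2)^2 = norm (z - (1/2) *\<^sub>R b) ^ 2"
        using b unfolding y_def power2_norm_eq_inner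
        by (simp add: algebra_simps inner_commute power2_eq_square)
      then have "norm y ^ 2 \<le> norm (z - (1/2) *\<^sub>R b) ^ 2"
        by (smt (verit) zero_le_power2)
      then have "norm y < r" using zc by (smt (verit) norm_ge_zero power2_le_imp_le)
      then have "y \<in> disc b r" using b by (simp add: disc_def y_def inner_diff_left)
      then obtain i where i: "y \<in> E i" using E(1) by auto
      then have "x i \<in> E i" unfolding x_def by (rule someI)
      then have yx: "norm (y - x i) \<le> diameter (E i)"
        using i E(2) diameter_bounded_bound[of "E i" y "x i"] by (auto simp: dist_norm)
      have "lo i \<bullet> c \<le> z \<bullet> c \<and> z \<bullet> c \<le> hi i \<bullet> c" if c: "c \<in> Basis" for c
      proof (cases "c = b")
        case True then show ?thesis using zb b by (simp add: lo_def hi_def)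
      next
        case False
        have "\<bar>(y - x i) \<bullet> c\<bar> \<le> diameter (E i)" using Basis_le_norm[OF c] yx order_trans by blast
        moreover have "y \<bullet> c = z \<bullet> c" using False b c by (simp add: y_def inner_diff_left inner_not_same_Basis)
        ultimately show ?thesis using False c by (auto simp: lo_def hi_def inner_diff_left)
      qed
      then show "z \<in> (\<Union>i. cbox (lo i) (hi i))" by (auto simp: mem_box)
    qed
    then have "ennreal m \<le> emeasure lborel (\<Union>i. cbox (lo i) (hi i))"
      unfolding em[symmetric] by (rule emeasure_mono) auto
    also have "\<dots> \<le> (\<Sum>i. emeasure lborel (cbox (lo i) (hi i)))"
      by (rule emeasure_subadditive_countably) auto
    also have "\<dots> = ennreal (2 ^ n) * (\<Sum>i. ennreal (diameter (E i) ^ n))"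
      unfolding vol ennreal_suminf_cmult[symmetric] using d0 by (simp add: ennreal_mult')
    finally have "ennreal (2 ^ n) * ennreal (m / 2 ^ n) \<le> ennreal (2 ^ n) * (\<Sum>i. ennreal (diameter (E i) ^ n))"
      using m by (simp add: ennreal_mult'[symmetric])
    then show "ennreal (m / 2 ^ n) \<le> (\<Sum>i. ennreal (diameter (E i) ^ n))"
      by (subst (asm) ennreal_mult_le_mult_iff) auto
  qed
  also have "\<dots> \<le> (SUP \<delta>\<in>{0<..}. hausdorff_pre n \<delta> (disc b r))" by (rule SUP_upper) simp
  finally have "0 < (SUP \<delta>\<in>{0<..}. hausdorff_pre n \<delta> (disc b r))"
    using m by (simp add: less_le_trans[of 0 "ennreal (m / 2 ^ n)"])
  then have "0 < hausdorff_measure n (disc b r)"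
    unfolding hausdorff_measure_eq by (simp add: ennreal_zero_less_mult_iff)
  then show ?thesis using hausdorff_measure_disc_eq[of u b n r] u b by simp
qed

section \<open>Translation-invariant measures and Fubini for hyperplane slices\<close>

lemma sigma_finite_measure_balls:
  fixes M :: "'a::euclidean_space measure"
  assumes M: "sets M = sets borel" and r: "0 < r" and fin: "\<And>q. emeasure M (ball q r) < \<infinity>"
  shows "sigma_finite_measure M"
proof
  obtain D :: "'a set" where D: "countable D" "\<And>X. open X \<Longrightarrow> X \<noteq> {} \<Longrightarrow> \<exists>d\<in>D. d \<in> X"
    using countable_dense_exists by blast
  have "\<exists>d\<in>D. x \<in> ball d r" for x
    using D(2)[of "ball x r"] r by (auto simp: dist_commute)
  then have "(\<Union>d\<in>D. ball d r) = UNIV" by auto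
  then show "\<exists>A. countable A \<and> A \<subseteq> sets M \<and> \<Union>A = space M \<and> (\<forall>a\<in>A. emeasure M a \<noteq> \<infinity>)"
    using D(1) M sets_eq_imp_space_eq[OF M] fin
    by (intro exI[of _ "(\<lambda>d. ball d r) ` D"]) (auto simp: less_top)
qed

text \<open>Both sides equal the double integral of \<open>1\<^sub>B(x) 1\<^sub>E(y - x)\<close>, once integrated in \<open>y\<close> first,
  once after the translation of \<open>x\<close> by \<open>y\<close>.\<close>

lemma translation_invariant_measure_unique:
  fixes M :: "'a::euclidean_space measure"
  assumes M: "sets M = sets borel" and "sigma_finite_measure M"
    and inv: "\<And>a B. B \<in> sets borel \<Longrightarrow> emeasure M ((\<lambda>x. x + a) -` B) = emeasure M B"
    and B: "B \<in> sets borel"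
  shows "emeasure M B * emeasure lborel (ball (0::'a) r) = emeasure lborel B * emeasure M (ball 0 r)"
proof -
  interpret M: sigma_finite_measure M by fact
  interpret P: pair_sigma_finite M lborel ..
  note [measurable_cong] = M
  note [measurable] = B
  define E where "E = ball (0::'a) r"
  have E[measurable]: "E \<in> sets borel" by (simp add: E_def)
  have sp: "space M = UNIV" using sets_eq_imp_space_eq[OF M] by simp
  have distr: "distr M borel (\<lambda>x. x + a) = M" for a
    by (rule measure_eqI) (auto simp: M emeasure_distr inv sp)
  have shift: "(\<integral>\<^sup>+x. f x \<partial>M) = (\<integral>\<^sup>+x. f (x + a) \<partial>M)" if [measurable]: "f \<in> borel_measurable borel" for f a
    by (subst distr[of a, symmetric], subst nn_integral_distr) auto
  have shiftl: "(\<integral>\<^sup>+x. f (x + a) \<partial>lborel) = (\<integral>\<^sup>+x. f x \<partial>lborel)"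
    if [measurable]: "f \<in> borel_measurable borel" for f and a :: 'a
    by (subst lborel_distr_plus[of a, symmetric], subst nn_integral_distr) (auto simp: add.commute)
  have "emeasure M B * emeasure lborel E = (\<integral>\<^sup>+x. indicator B x * emeasure lborel E \<partial>M)"
    by (subst nn_integral_multc) auto
  also have "\<dots> = (\<integral>\<^sup>+x. \<integral>\<^sup>+y. indicator B x * indicator E (y + - x) \<partial>lborel \<partial>M)"
  proof (rule nn_integral_cong)
    fix x :: 'a
    show "indicator B x * emeasure lborel E = (\<integral>\<^sup>+y. indicator B x * indicator E (y + - x) \<partial>lborel)"
    proof -
      have "(\<integral>\<^sup>+y. indicator B x * indicator E (y + - x) \<partial>lborel)
          = indicator B x * (\<integral>\<^sup>+y. indicator E (y + - x) \<partial>lborel)"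
        by (rule nn_integral_cmult) measurable
      then show ?thesis unfolding shiftl[OF borel_measurable_indicator[OF E]] by simp
    qed
  qed
  also have "\<dots> = (\<integral>\<^sup>+y. \<integral>\<^sup>+x. indicator B x * indicator E (y + - x) \<partial>M \<partial>lborel)"
    using P.Fubini'[of "\<lambda>x y. indicator B x * indicator E (y + - x)"] by simp
  also have "\<dots> = (\<integral>\<^sup>+y. \<integral>\<^sup>+x. indicator B (x + y) * indicator E x \<partial>M \<partial>lborel)"
  proof (rule nn_integral_cong)
    fix y :: 'a
    show "(\<integral>\<^sup>+x. indicator B x * indicator E (y + - x) \<partial>M) = (\<integral>\<^sup>+x. indicator B (x + y) * indicator E x \<partial>M)"
      by (subst shift[of _ y]) (auto simp: indicator_def E_def)
  qed
  also have "\<dots> = (\<integral>\<^sup>+x. \<integral>\<^sup>+y. indicator B (x + y) * indicator E x \<partial>lborel \<partial>M)"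
    using P.Fubini'[of "\<lambda>x y. indicator B (x + y) * indicator E x"] by simp
  also have "\<dots> = (\<integral>\<^sup>+x. emeasure lborel B * indicator E x \<partial>M)"
  proof (rule nn_integral_cong)
    fix x :: 'a
    show "(\<integral>\<^sup>+y. indicator B (x + y) * indicator E x \<partial>lborel) = emeasure lborel B * indicator E x"
    proof -
      have "(\<integral>\<^sup>+y. indicator B (x + y) * indicator E x \<partial>lborel)
          = (\<integral>\<^sup>+y. indicator B (x + y) \<partial>lborel) * indicator E x"
        by (rule nn_integral_multc) measurable
      also have "(\<integral>\<^sup>+y. indicator B (x + y) \<partial>lborel) = (\<integral>\<^sup>+y. indicator B (y + x) \<partial>lborel)"
        by (simp only: add.commute)
      also have "\<dots> = emeasure lborel B"
        unfolding shiftl[OF borel_measurable_indicator[OF B]] by simp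
      finally show ?thesis .
    qed
  qed
  also have "\<dots> = emeasure lborel B * emeasure M E"
    by (subst nn_integral_cmult) auto
  finally show ?thesis by (simp add: E_def)
qed

lemma hausdorff_measure_translation:
  "hausdorff_measure d ((\<lambda>x::'a::euclidean_space. x + a) ` A) = hausdorff_measure d A"
  by (rule hausdorff_measure_isometry) simp

lemma hausdorff_measure_slice_translate:
  "hausdorff_measure d {x::'a::euclidean_space. x + a \<in> B \<and> x \<bullet> u = s} =
   hausdorff_measure d {x\<in>B. x \<bullet> u = s + a \<bullet> u}"
proof -
  have "{x. x + a \<in> B \<and> x \<bullet> u = s} = (\<lambda>x. x + - a) ` {x\<in>B. x \<bullet> u = s + a \<bullet> u}"
    by (auto simp: image_iff algebra_simps intro!: bexI[of _ "_ + a"])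
  then show ?thesis by (simp only: hausdorff_measure_translation)
qed

text \<open>The slice is centred at one of its own points, from which all others have distance less
  than \<open>2 * r\<close>.\<close>

lemma slices_ball_subset:
  fixes u :: "'a::euclidean_space"
  shows "\<exists>a. {x\<in>ball q r. x \<bullet> u = s} \<subseteq> (\<lambda>x. x + a) ` disc u (2 * r)"
proof (cases "{x\<in>ball q r. x \<bullet> u = s} = {}")
  case False
  then obtain z where z: "z \<in> ball q r" "z \<bullet> u = s" by auto
  have "x - z \<in> disc u (2 * r)" if "x \<in> ball q r" "x \<bullet> u = s" for x
    using that z norm_triangle_ineq4[of "x - q" "z - q"]
    by (auto simp: disc_def inner_diff_left dist_norm norm_minus_commute)
  then show ?thesis by (intro exI[of _ z]) (auto intro!: image_eqI[of _ _ "_ - z"])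
qed auto

text \<open>Integrating the slice measures over the levels defines a translation-invariant measure,
  finite on small balls, hence a multiple of Lebesgue measure. The multiple does not depend on
  \<open>u\<close>, because a reflection exchanging two directions preserves the ball
  \<open>E\<close>. Finiteness of one disc is a hypothesis; in the application it comes from the
  assumption on slice areas.\<close>

lemma hausdorff_fubini:
  fixes u0 :: "'a::euclidean_space"
  assumes n: "0 < n" "DIM('a) = Suc n" and r: "0 < r"
    and u0: "norm u0 = 1" and fin: "hausdorff_measure n (disc u0 r) < \<infinity>"
  obtains \<kappa> where "0 < \<kappa>"
    "\<And>u::'a. norm u = 1 \<Longrightarrow> \<forall>B\<in>sets borel. (\<lambda>s. hausdorff_measure n {x\<in>B. x \<bullet> u = s}) \<in> borel_measurable borel"
    "\<And>(u::'a) B. norm u = 1 \<Longrightarrow> B \<in> sets borel \<Longrightarrow>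
       (\<integral>\<^sup>+s. hausdorff_measure n {x\<in>B. x \<bullet> u = s} \<partial>lborel) = ennreal \<kappa> * emeasure lborel B"
proof -
  let ?H = "hausdorff_measure n :: 'a set \<Rightarrow> ennreal"
  define h where "h = ?H (disc u0 r)"
  define E where "E = ball (0::'a) (r/2)"
  define I where "I u B = (\<integral>\<^sup>+s. ?H {x\<in>B. x \<bullet> u = s} \<partial>lborel)" for u and B :: "'a set"
  \<comment> \<open>The measure is restricted to the hyperplane through the origin because
    n-dimensional Hausdorff measure on the whole space is not sigma-finite, as Fubini
    requires.\<close>
  define N where "N u = density (hausdorff_borel n) (indicator {x::'a. x \<bullet> u = 0})" for u
  have hd: "?H (disc u r) = h" if "norm u = 1" for u
    unfolding h_def by (rule hausdorff_measure_disc_eq) (simp add: that u0)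
  have sl: "?H {x\<in>ball q (r/2). x \<bullet> u = s} \<le> h" if u: "norm u = 1" for q s u
  proof -
    obtain a where "{x\<in>ball q (r/2). x \<bullet> u = s} \<subseteq> (\<lambda>x. x + a) ` disc u (2 * (r/2))"
      using slices_ball_subset[of q "r/2" u s] by blast
    from hausdorff_measure_mono[OF this, of n] show ?thesis
      by (simp add: hausdorff_measure_translation hd[OF u])
  qed
  have setsN [measurable_cong, simp]: "sets (N u) = sets borel" for u by (simp add: N_def)
  have spN [simp]: "space (N u) = UNIV" for u by (simp add: N_def)
  have emN: "emeasure (N u) B = ?H {x\<in>B. x \<bullet> u = 0}" if "B \<in> sets borel" for B u
  proof -
    have [measurable]: "B \<in> sets borel" by fact
    have "emeasure (N u) B = emeasure (hausdorff_borel n) ({x. x \<bullet> u = 0} \<inter> B)"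
      unfolding N_def by (subst emeasure_density) (auto simp: indicator_inter_arith[symmetric] intro!: nn_integral_indicator[THEN trans])
    also have "\<dots> = ?H ({x. x \<bullet> u = 0} \<inter> B)"
      by (rule emeasure_hausdorff_borel[OF n(1)]) measurable
    finally show ?thesis by (simp add: Int_def conj_commute)
  qed
  have hfin: "h < \<infinity>" using fin by (simp add: h_def)
  have sfN: "sigma_finite_measure (N u)" if u: "norm u = 1" for u
    by (rule sigma_finite_measure_balls[of _ "r/2"]) (use sl[OF u, of _ 0] hfin r in \<open>auto simp: emN intro: le_less_trans\<close>)
  have slice_eq: "?H {x\<in>B. x \<bullet> u = s} = emeasure (N u) ((\<lambda>z. z + s *\<^sub>R u) -` B)"
    if u: "norm u = 1" and B: "B \<in> sets borel" for u B s
  proof -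
    have uu: "u \<bullet> u = 1" using u by (simp add: dot_square_norm)
    have "(\<lambda>z. z + s *\<^sub>R u) -` B \<in> sets borel"
      using measurable_sets[OF _ B, of "\<lambda>z. z + s *\<^sub>R u" borel] by simp
    then have "emeasure (N u) ((\<lambda>z. z + s *\<^sub>R u) -` B) = ?H {x. x + s *\<^sub>R u \<in> B \<and> x \<bullet> u = 0}"
      by (simp add: emN vimage_def)
    then show ?thesis unfolding hausdorff_measure_slice_translate using uu by simp
  qed
  define \<mu> where "\<mu> u = distr (N u \<Otimes>\<^sub>M lborel) borel (\<lambda>(z, s). z + s *\<^sub>R u)" for u
  have meas: "(\<lambda>s. ?H {x\<in>B. x \<bullet> u = s}) \<in> borel_measurable borel" and em\<mu>: "emeasure (\<mu> u) B = I u B"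
    if u: "norm u = 1" and B[measurable]: "B \<in> sets borel" for u B
  proof -
    interpret N: sigma_finite_measure "N u" by (rule sfN[OF u])
    interpret P: pair_sigma_finite "N u" lborel ..
    let ?S = "(\<lambda>(z, s). z + s *\<^sub>R u) -` B"
    have S: "?S \<in> sets (N u \<Otimes>\<^sub>M lborel)"
      using measurable_sets[of "\<lambda>(z, s). z + s *\<^sub>R u" "N u \<Otimes>\<^sub>M lborel" borel B]
      by (simp add: space_pair_measure)
    have v: "(\<lambda>x. (x, s)) -` ?S = (\<lambda>z. z + s *\<^sub>R u) -` B" for s by auto
    show "(\<lambda>s. ?H {x\<in>B. x \<bullet> u = s}) \<in> borel_measurable borel"
      using P.measurable_emeasure_Pair2[OF S] by (simp add: slice_eq[OF u B] v)
    have "emeasure (\<mu> u) B = emeasure (N u \<Otimes>\<^sub>M lborel) ?S"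
      unfolding \<mu>_def by (subst emeasure_distr) (auto simp: space_pair_measure)
    then show "emeasure (\<mu> u) B = I u B"
      using P.emeasure_pair_measure_alt2[OF S] by (simp add: slice_eq[OF u B] v I_def)
  qed
  have sets\<mu> [simp]: "sets (\<mu> u) = sets borel" for u by (simp add: \<mu>_def)
  have fin_ball: "I u (ball q (r/2)) < \<infinity>" if u: "norm u = 1" for u q
  proof -
    have "I u (ball q (r/2)) \<le> (\<integral>\<^sup>+s. h * indicator {q \<bullet> u - r/2..q \<bullet> u + r/2} s \<partial>lborel)"
      unfolding I_def
    proof (rule nn_integral_mono)
      fix s :: real
      show "?H {x\<in>ball q (r/2). x \<bullet> u = s} \<le> h * indicator {q \<bullet> u - r/2..q \<bullet> u + r/2} s"
      proof (cases "s \<in> {q \<bullet> u - r/2..q \<bullet> u + r/2}")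
        case False
        have "x \<bullet> u \<in> {q \<bullet> u - r/2..q \<bullet> u + r/2}" if "x \<in> ball q (r/2)" for x
        proof -
          have "\<bar>(x - q) \<bullet> u\<bar> \<le> r/2"
            using that Cauchy_Schwarz_ineq2[of "x - q" u] u by (simp add: dist_norm norm_minus_commute)
          then have "\<bar>x \<bullet> u - q \<bullet> u\<bar> \<le> r/2" by (simp only: inner_diff_left)
          then show ?thesis unfolding atLeastAtMost_iff by linarith
        qed
        with False have "{x\<in>ball q (r/2). x \<bullet> u = s} = {}" by blast
        then show ?thesis by (simp only: hausdorff_measure_empty[OF n(1)]) simp
      qed (use sl[OF u] in simp)
    qed
    also have "\<dots> = h * ennreal r"
      using r by (subst nn_integral_cmult) auto
    also have "\<dots> < \<infinity>" using hfin by (simp add: ennreal_mult_less_top)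
    finally show ?thesis .
  qed
  have inv\<mu>: "emeasure (\<mu> u) ((\<lambda>x. x + a) -` B) = emeasure (\<mu> u) B" if u: "norm u = 1" and B[measurable]: "B \<in> sets borel" for u a B
  proof -
    have [measurable]: "(\<lambda>s. ?H {x\<in>B. x \<bullet> u = s}) \<in> borel_measurable borel" by (rule meas[OF u B])
    have "(\<lambda>x. x + a) -` B \<in> sets borel" using measurable_sets[OF _ B, of "\<lambda>x. x + a" borel] by simp
    then have "emeasure (\<mu> u) ((\<lambda>x. x + a) -` B) = (\<integral>\<^sup>+s. ?H {x\<in>B. x \<bullet> u = s + a \<bullet> u} \<partial>lborel)"
      by (simp add: em\<mu>[OF u] I_def hausdorff_measure_slice_translate)
    also have "\<dots> = (\<integral>\<^sup>+s. ?H {x\<in>B. x \<bullet> u = s} \<partial>lborel)"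
      by (subst (2) lborel_distr_plus[of "a \<bullet> u", symmetric], subst nn_integral_distr) (auto simp: add.commute)
    finally show ?thesis by (simp add: em\<mu>[OF u B] I_def)
  qed
  have eq: "I u B * emeasure lborel E = emeasure lborel B * I u E" if u: "norm u = 1" and B: "B \<in> sets borel" for u B
  proof -
    have "sigma_finite_measure (\<mu> u)"
      by (rule sigma_finite_measure_balls[of _ "r/2"]) (use r fin_ball[OF u] in \<open>auto simp: em\<mu>[OF u]\<close>)
    from translation_invariant_measure_unique[OF sets\<mu> this inv\<mu>[OF u] B, of "r/2"]
    show ?thesis using B by (simp add: E_def em\<mu>[OF u])
  qed
  have IE: "I u E = I u0 E" if u: "norm u = 1" for u
  proof (cases "u = u0")
    case False
    obtain w where w: "norm w = 1" "refl_hyp w 0 u = u0" using refl_hyp_swap[of u u0] False u u0 by auto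
    have *: "{x\<in>E. x \<bullet> u0 = s} = refl_hyp w 0 ` {x\<in>E. x \<bullet> u = s}" for s
    proof
      show "refl_hyp w 0 ` {x\<in>E. x \<bullet> u = s} \<subseteq> {x\<in>E. x \<bullet> u0 = s}"
        by (auto simp: E_def w(2)[symmetric] refl_hyp_inner_refl_hyp[OF w(1)] norm_refl_hyp[OF w(1)])
      show "{x\<in>E. x \<bullet> u0 = s} \<subseteq> refl_hyp w 0 ` {x\<in>E. x \<bullet> u = s}"
      proof
        fix x assume x: "x \<in> {x\<in>E. x \<bullet> u0 = s}"
        have "refl_hyp w 0 x \<bullet> u = x \<bullet> u0"
          by (metis refl_hyp_inner_refl_hyp refl_hyp_refl_hyp w)
        then have "refl_hyp w 0 x \<in> {x\<in>E. x \<bullet> u = s}" using x by (simp add: E_def norm_refl_hyp[OF w(1)])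
        then show "x \<in> refl_hyp w 0 ` {x\<in>E. x \<bullet> u = s}"
          by (rule rev_image_eqI) (simp add: refl_hyp_refl_hyp[OF w(1)])
      qed
    qed
    show ?thesis unfolding I_def *
      by (simp add: hausdorff_measure_isometry dist_refl_hyp[OF w(1)])
  qed simp
  have IEpos: "0 < I u0 E"
  proof -
    \<comment> \<open>A cylinder of radius and half height \<open>r/4\<close> fits into the ball
      \<open>E\<close> of radius \<open>r/2\<close>.\<close>
    have pos: "0 < ?H (disc u0 (r/4))" by (rule hausdorff_measure_disc_pos) (use n u0 r in auto)
    have "?H (disc u0 (r/4)) * ennreal (r/2) = (\<integral>\<^sup>+s. ?H (disc u0 (r/4)) * indicator {-r/4..r/4} s \<partial>lborel)"
      using r by (subst nn_integral_cmult) auto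
    also have "\<dots> \<le> I u0 E" unfolding I_def
    proof (rule nn_integral_mono)
      fix s :: real
      have uu: "u0 \<bullet> u0 = 1" using u0 by (simp add: dot_square_norm)
      have "(\<lambda>x. x + s *\<^sub>R u0) ` disc u0 (r/4) \<subseteq> {x\<in>E. x \<bullet> u0 = s}" if "s \<in> {-r/4..r/4}"
      proof
        fix y assume "y \<in> (\<lambda>x. x + s *\<^sub>R u0) ` disc u0 (r/4)"
        then obtain x where x: "y = x + s *\<^sub>R u0" "x \<in> disc u0 (r/4)" by auto
        have "norm y \<le> norm x + \<bar>s\<bar>" using norm_triangle_ineq[of x "s *\<^sub>R u0"] u0 x(1) by simp
        then show "y \<in> {x\<in>E. x \<bullet> u0 = s}" using x that uu by (auto simp: E_def disc_def inner_add_left)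
      qed
      then show "?H (disc u0 (r/4)) * indicator {-r/4..r/4} s \<le> ?H {x\<in>E. x \<bullet> u0 = s}"
        using hausdorff_measure_mono[of "(\<lambda>x. x + s *\<^sub>R u0) ` disc u0 (r/4)" "{x\<in>E. x \<bullet> u0 = s}" n]
        by (cases "s \<in> {-r/4..r/4}") (simp_all add: hausdorff_measure_translation del: atLeastAtMost_iff)
    qed
    finally show ?thesis using pos r
      by (smt (verit) ennreal_zero_less_mult_iff ennreal_less_zero_iff less_le_trans half_gt_zero)
  qed
  obtain e where e: "emeasure lborel E = ennreal e" "0 < e"
    using r by (simp add: E_def emeasure_ball)
  obtain m where m: "I u0 E = ennreal m" "0 \<le> m"
    using fin_ball[OF u0, of 0] by (cases "I u0 E" rule: ennreal_cases) (auto simp: E_def)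
  have m0: "0 < m" using IEpos m by simp
  show ?thesis
  proof
    show "0 < m / e" using e m0 by simp
    show "\<forall>B\<in>sets borel. (\<lambda>s. ?H {x\<in>B. x \<bullet> u = s}) \<in> borel_measurable borel" if "norm u = 1" for u
      using meas[OF that] by blast
    fix u :: 'a and B :: "'a set" assume u: "norm u = 1" and B: "B \<in> sets borel"
    have "ennreal e * I u B = ennreal e * (ennreal (m / e) * emeasure lborel B)"
      using eq[OF u B] e m m0 by (simp add: IE[OF u] mult.assoc[symmetric] ennreal_mult'[symmetric] mult.commute)
    then show "(\<integral>\<^sup>+s. ?H {x\<in>B. x \<bullet> u = s} \<partial>lborel) = ennreal (m / e) * emeasure lborel B"
      using e by (simp add: ennreal_mult_cancel_left I_def)
  qed
qed

section \<open>Normals of convex bodies\<close>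

text \<open>The bare support inequality, without tangent spaces, is a closed condition on the pair
  of point and normal. The sign is opposite to that of \<open>unit_normal_to_side\<close>.\<close>

definition outer_normal :: "'a::euclidean_space set \<Rightarrow> 'a \<Rightarrow> 'a \<Rightarrow> bool" where
  "outer_normal C p u \<longleftrightarrow> p \<in> C \<and> norm u = 1 \<and> (\<forall>x\<in>C. (x - p) \<bullet> u \<le> 0)"

lemma outer_normalD:
  assumes "outer_normal C p u"
  shows "p \<in> C" "norm u = 1" "u \<bullet> u = 1" "x \<in> C \<Longrightarrow> (x - p) \<bullet> u \<le> 0"
  using assms by (auto simp: outer_normal_def dot_square_norm)

lemma outer_normal_interior:
  assumes C: "outer_normal C p u" and x: "x \<in> interior C" shows "(x - p) \<bullet> u < 0"
proof -
  obtain e where e: "e > 0" "cball x e \<subseteq> C" using x mem_interior_cball by blast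
  have "x + e *\<^sub>R u \<in> C" using e outer_normalD[OF C] by (auto simp: dist_norm intro!: subsetD[OF e(2)])
  then have "(x + e *\<^sub>R u - p) \<bullet> u \<le> 0" using outer_normalD[OF C] by blast
  then show ?thesis using e outer_normalD(3)[OF C] by (simp add: algebra_simps)
qed

lemma outer_normal_frontier:
  assumes "outer_normal C p u" shows "p \<in> frontier C"
  using outer_normal_interior[OF assms, of p] outer_normalD(1)[OF assms] closure_subset
  by (auto simp: frontier_def)

text \<open>\<open>P\<close> and \<open>N\<close> are meant as projections from tuples of points and
  normals; closedness of such tuple sets yields the compactness used for extremal chords and for
  caps.\<close>

lemma closed_outer_normal:
  fixes P N :: "'b::topological_space \<Rightarrow> 'a::euclidean_space"
  assumes C: "closed C" and P: "continuous_on UNIV P" and N: "continuous_on UNIV N"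
  shows "closed {z. outer_normal C (P z) (N z)}"
proof -
  have "{z. outer_normal C (P z) (N z)} = P -` C \<inter> {z. norm (N z) = 1} \<inter> (\<Inter>x\<in>C. {z. (x - P z) \<bullet> N z \<le> 0})"
    by (auto simp: outer_normal_def)
  moreover have "closed (P -` C)" using P by (intro closed_vimage C)
  moreover have "closed {z. norm (N z) = 1}" by (intro closed_Collect_eq continuous_intros N)
  moreover have "closed {z. (x - P z) \<bullet> N z \<le> 0}" for x by (intro closed_Collect_le continuous_intros N P)
  ultimately show ?thesis by (simp only:) (intro closed_Int closed_INT ballI)
qed

lemma exists_outer_normal:
  fixes C :: "'a::euclidean_space set"
  assumes "convex C" "closed C" and int: "interior C \<noteq> {}" and p: "p \<in> frontier C"
  shows "\<exists>u. outer_normal C p u"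
proof -
  have pC: "p \<in> C" using p assms(2) frontier_subset_closed by blast
  have nr: "p \<notin> rel_interior C" using p int by (simp add: frontier_def rel_interior_nonempty_interior)
  obtain a where a: "a \<noteq> 0" "\<And>y. y \<in> C \<Longrightarrow> a \<bullet> p \<le> a \<bullet> y"
    by (rule supporting_hyperplane_rel_boundary[OF assms(1) pC nr]) blast
  have "outer_normal C p (- a /\<^sub>R norm a)"
    using a pC by (auto simp: outer_normal_def algebra_simps inner_commute divide_right_mono)
  then show ?thesis by blast
qed

lemma exists_outer_normal_direction:
  fixes C :: "'a::euclidean_space set"
  assumes "compact C" "C \<noteq> {}" "norm u = 1"
  shows "\<exists>p. outer_normal C p u"
proof -
  have "continuous_on C (\<lambda>x. x \<bullet> u)" by (intro continuous_intros)
  then obtain p where "p \<in> C" "\<forall>x\<in>C. x \<bullet> u \<le> p \<bullet> u"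
    using continuous_attains_sup[OF assms(1,2)] by blast
  then show ?thesis using assms(3) by (intro exI[of _ p]) (auto simp: outer_normal_def inner_diff_left)
qed

text \<open>Along a curve in the frontier the height in direction \<open>u\<close> is maximal at
  \<open>p\<close>, so its derivative vanishes. This carries the assumptions on caps over to all
  supporting normals.\<close>

lemma outer_normal_imp_unit_normal_to_side:
  fixes C :: "'a::euclidean_space set"
  assumes C: "closed C" and u: "outer_normal C p u"
  shows "unit_normal_to_side (frontier C) p (- u)"
  unfolding unit_normal_to_side_def
proof (intro conjI ballI)
  show "norm (- u) = 1" using outer_normalD(2)[OF u] by simp
  have le: "(x - p) \<bullet> u \<le> 0" if "x \<in> frontier C" for x
    using that frontier_subset_closed[OF C] outer_normalD(4)[OF u] by blast
  then show "0 \<le> (x - p) \<bullet> - u" if "x \<in> frontier C" for x using that by simp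
  show "v \<bullet> - u = 0" if v: "v \<in> tangent_space (frontier C) p" for v
  proof -
    obtain \<gamma> e where e: "e > 0" "\<forall>s\<in>{-e<..<e}. \<gamma> s \<in> frontier C" "\<gamma> 0 = p"
      and d: "(\<gamma> has_vector_derivative v) (at 0)"
      using v by (auto simp: tangent_space_def)
    have "((\<lambda>s. (\<gamma> s - p) \<bullet> u) has_vector_derivative v \<bullet> u) (at 0)"
      using bounded_linear.has_vector_derivative[OF bounded_linear_inner_left[of u]
        has_vector_derivative_diff[OF d has_vector_derivative_const[of p]]] by simp
    then have D: "DERIV (\<lambda>s. (\<gamma> s - p) \<bullet> u) 0 :> v \<bullet> u"
      by (simp add: has_real_derivative_iff_has_vector_derivative)
    have "v \<bullet> u = 0"
    proof (rule DERIV_local_max[OF D e(1)], intro allI impI)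
      fix s assume "\<bar>0 - s\<bar> < e"
      then have "\<gamma> s \<in> frontier C" using e(2) by (simp add: abs_less_iff)
      then show "(\<gamma> s - p) \<bullet> u \<le> (\<gamma> 0 - p) \<bullet> u" using le e(3) by simp
    qed
    then show ?thesis by simp
  qed
qed

text \<open>Every outer normal is orthogonal to the kernel of the derivative \<open>D\<close> of a
  defining function, so any two are parallel; opposite ones would leave no room for an interior
  point. For a kernel direction \<open>x\<close>, the intermediate value theorem gives frontier
  points in directions arbitrarily close to \<open>x\<close>, and the support inequality passes to
  the limit.\<close>

lemma unique_outer_normal:
  fixes C :: "'a::euclidean_space set"
  assumes C: "closed C" and int: "interior C \<noteq> {}" and M: "smooth_hypersurface (frontier C)"
    and u: "outer_normal C p u" and v: "outer_normal C p v"
  shows "u = v"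
proof -
  have p: "p \<in> frontier C" using outer_normal_frontier[OF u] .
  obtain U F where U: "open U" "p \<in> U" and F: "smooth_fun_on U F"
    and nz: "\<forall>x\<in>U. frechet_derivative F (at x) \<noteq> (\<lambda>v. 0)" and MU: "frontier C \<inter> U = {x\<in>U. F x = 0}"
    using M p unfolding smooth_hypersurface_def by metis
  have diff: "F differentiable (at x)" if "x \<in> U" for x
    using F[unfolded smooth_fun_on_def, rule_format, of 1] that by simp
  define D where "D = frechet_derivative F (at p)"
  have D: "(F has_derivative D) (at p)"
    using diff[OF U(2)] by (simp add: D_def frechet_derivative_works)
  interpret D: bounded_linear D using D by (rule has_derivative_bounded_linear)
  have F0: "F p = 0" using MU p U by blast
  have contF: "continuous_on U F"
    using diff differentiable_imp_continuous_on differentiable_at_imp_differentiable_on by blast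
  obtain e0 where "D e0 \<noteq> 0" using nz U(2) by (auto simp: D_def)
  then obtain e where e: "D e = 1" using D.scaleR[of "1 / D e0" e0] by (metis nonzero_eq_divide_eq real_scaleR_def times_divide_eq_left mult_1)
  have deriv: "DERIV (\<lambda>s. F (p + s *\<^sub>R x)) 0 :> D x" for x
  proof -
    have "((\<lambda>s. p + s *\<^sub>R x) has_derivative (\<lambda>s. s *\<^sub>R x)) (at 0)"
      by (auto intro!: derivative_eq_intros)
    from has_derivative_compose[OF this, of F D] D
    have "((\<lambda>s. F (p + s *\<^sub>R x)) has_derivative (\<lambda>s. D (s *\<^sub>R x))) (at 0)" by simp
    moreover have "(\<lambda>s. D (s *\<^sub>R x)) = (*) (D x)" by (simp add: fun_eq_iff D.scaleR)
    ultimately show ?thesis by (simp add: has_field_derivative_def)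
  qed
  have ker: "x \<bullet> w \<le> 0" if x: "D x = 0" and w: "outer_normal C p w" for x w
  proof (rule field_le_epsilon)
    fix \<epsilon> :: real assume \<epsilon>: "0 < \<epsilon>"
    \<comment> \<open>A direction \<open>x + c *\<^sub>R e\<close> with
      \<open>\<bar>c\<bar> \<le> \<eta>\<close> changes the inner product with \<open>w\<close> by
      at most \<open>\<epsilon>\<close>.\<close>
    define \<eta> where "\<eta> = \<epsilon> / (1 + \<bar>e \<bullet> w\<bar>)"
    have \<eta>: "\<eta> > 0" using \<epsilon> by (simp add: \<eta>_def add_pos_nonneg)
    have \<eta>e: "\<eta> * \<bar>e \<bullet> w\<bar> \<le> \<epsilon>" using \<epsilon> by (simp add: \<eta>_def field_simps)
    have Dp: "D (x + \<eta> *\<^sub>R e) = \<eta>" "D (x - \<eta> *\<^sub>R e) = - \<eta>"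
      using x e by (simp_all add: D.add D.diff D.scaleR)
    obtain d1 where d1: "d1 > 0" "\<And>h. 0 < h \<Longrightarrow> h < d1 \<Longrightarrow> F (p + 0 *\<^sub>R (x + \<eta> *\<^sub>R e)) < F (p + h *\<^sub>R (x + \<eta> *\<^sub>R e))"
      using DERIV_pos_inc_right[OF deriv[of "x + \<eta> *\<^sub>R e"]] Dp \<eta> by auto
    obtain d2 where d2: "d2 > 0" "\<And>h. 0 < h \<Longrightarrow> h < d2 \<Longrightarrow> F (p + 0 *\<^sub>R (x - \<eta> *\<^sub>R e)) > F (p + h *\<^sub>R (x - \<eta> *\<^sub>R e))"
      using DERIV_neg_dec_right[OF deriv[of "x - \<eta> *\<^sub>R e"]] Dp \<eta> by auto
    obtain d3 where d3: "d3 > 0" "ball p d3 \<subseteq> U" using U openE by blast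
    define N where "N = norm x + \<eta> * norm e + 1"
    have N: "N > 0" using \<eta> by (simp add: N_def add_nonneg_pos)
    define h where "h = min (min d1 d2) (d3 / N) / 2"
    have h: "0 < h" "h < d1" "h < d2" "h * N < d3"
    proof -
      show h0: "0 < h" using d1 d2 d3 N by (simp add: h_def)
      have "2 * h \<le> d1" "2 * h \<le> d2" "2 * h \<le> d3 / N" by (simp_all add: h_def)
      with h0 show "h < d1" "h < d2" by linarith+
      have "h < d3 / N" using h0 \<open>2 * h \<le> d3 / N\<close> by linarith
      then show "h * N < d3" using N by (simp add: pos_less_divide_eq)
    qed
    have inU: "p + h *\<^sub>R (x + c *\<^sub>R e) \<in> U" if "c \<in> {-\<eta>..\<eta>}" for c
    proof -
      have "norm (x + c *\<^sub>R e) \<le> norm x + \<bar>c\<bar> * norm e" by (rule order_trans[OF norm_triangle_ineq]) simp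
      also have "\<bar>c\<bar> * norm e \<le> \<eta> * norm e" using that by (intro mult_right_mono) auto
      finally have "norm (x + c *\<^sub>R e) \<le> N" by (simp add: N_def)
      then have "h * norm (x + c *\<^sub>R e) \<le> h * N" using h by simp
      then have "norm (h *\<^sub>R (x + c *\<^sub>R e)) < d3"
        using h(4) unfolding norm_scaleR abs_of_pos[OF h(1)] by (rule le_less_trans)
      then show ?thesis using d3 by (auto simp: dist_norm subset_eq)
    qed
    have "continuous_on {-\<eta>..\<eta>} (\<lambda>c. F (p + h *\<^sub>R (x + c *\<^sub>R e)))"
      by (rule continuous_on_compose2[OF contF]) (auto intro!: continuous_intros inU)
    moreover have "F (p + h *\<^sub>R (x + (-\<eta>) *\<^sub>R e)) \<le> 0" "0 \<le> F (p + h *\<^sub>R (x + \<eta> *\<^sub>R e))"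
      using d1(2)[of h] d2(2)[of h] h F0 by auto
    ultimately obtain c where c: "-\<eta> \<le> c" "c \<le> \<eta>" "F (p + h *\<^sub>R (x + c *\<^sub>R e)) = 0"
      using IVT'[of "\<lambda>c. F (p + h *\<^sub>R (x + c *\<^sub>R e))" "-\<eta>" 0 \<eta>] \<eta> by auto
    then have "p + h *\<^sub>R (x + c *\<^sub>R e) \<in> frontier C" using MU inU[of c] by auto
    then have "p + h *\<^sub>R (x + c *\<^sub>R e) \<in> C" using frontier_subset_closed[OF C] by blast
    then have "h * ((x + c *\<^sub>R e) \<bullet> w) \<le> 0" using outer_normalD(4)[OF w] by fastforce
    then have "(x + c *\<^sub>R e) \<bullet> w \<le> 0" using h by (simp add: mult_le_0_iff)
    then have "x \<bullet> w \<le> - c * (e \<bullet> w)" by (simp add: inner_add_left)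
    also have "\<dots> \<le> \<bar>c\<bar> * \<bar>e \<bullet> w\<bar>" by (metis abs_ge_self abs_mult abs_minus_cancel mult_minus_left)
    also have "\<dots> \<le> \<eta> * \<bar>e \<bullet> w\<bar>" using c by (intro mult_right_mono) auto
    finally show "x \<bullet> w \<le> 0 + \<epsilon>" using \<eta>e by simp
  qed
  have ker0: "x \<bullet> w = 0" if "D x = 0" "outer_normal C p w" for x w
    using ker[OF that] ker[of "- x" w] that D.diff[of 0 x] D.zero by simp
  note un = outer_normalD(3)[OF u] and vn = outer_normalD(3)[OF v]
  define c where "c = u \<bullet> v"
  \<comment> \<open>This combination lies in the kernel; orthogonality to both normals forces the
    square of \<open>u \<bullet> v\<close> to be 1.\<close>
  have "D ((D v) *\<^sub>R u - (D u) *\<^sub>R v) = 0" by (simp add: D.diff D.scaleR)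
  from ker0[OF this u] ker0[OF this v]
  have e1: "D v = D u * c" "D v * c = D u"
    using un vn by (simp_all add: inner_diff_left inner_diff_right c_def inner_commute)
  have Du: "D u \<noteq> 0" using ker0[OF _ u, of u] un by auto
  from e1 have "D u * (c * c) = D u * 1" by (simp add: mult.assoc)
  then have "c = 1 \<or> c = -1" using Du by (simp add: square_eq_1_iff)
  then show "u = v"
  proof
    assume "c = 1"
    then have "(u - v) \<bullet> (u - v) = 0" using un vn by (simp add: c_def algebra_simps inner_commute)
    then show ?thesis by simp
  next
    assume "c = -1"
    then have "(u + v) \<bullet> (u + v) = 0" using un vn by (simp add: c_def algebra_simps inner_commute)
    then have uv: "v = - u" by (simp add: eq_neg_iff_add_eq_0 add.commute)
    obtain x where "x \<in> interior C" using int by blast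
    then show ?thesis using outer_normal_interior[OF u, of x] outer_normal_interior[OF v, of x] uv by simp
  qed
qed

text \<open>For any outer normal \<open>u\<close> at \<open>p\<close>, the ball point farthest along
  \<open>u\<close> lies in \<open>C\<close>, so \<open>(p - q) \<bullet> u\<close> is at least
  \<open>\<rho>\<close>. Equality in the Cauchy-Schwarz inequality identifies
  \<open>u\<close>.\<close>

lemma outer_normal_touching_ball:
  fixes C :: "'a::euclidean_space set"
  assumes C: "convex C" "closed C" "interior C \<noteq> {}" and p: "p \<in> frontier C"
    and b: "cball q \<rho> \<subseteq> C" "dist q p = \<rho>" "\<rho> > 0"
  shows "outer_normal C p ((p - q) /\<^sub>R \<rho>)"
proof -
  obtain u where u: "outer_normal C p u" using exists_outer_normal[OF C p] by blast
  have np: "norm (p - q) = \<rho>" using b by (simp add: dist_norm norm_minus_commute)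
  have "q + \<rho> *\<^sub>R u \<in> C"
    using b outer_normalD[OF u] by (intro subsetD[OF b(1)]) (simp add: dist_norm)
  then have "(q + \<rho> *\<^sub>R u - p) \<bullet> u \<le> 0" using outer_normalD[OF u] by blast
  then have "\<rho> \<le> (p - q) \<bullet> u" using outer_normalD[OF u] by (simp add: algebra_simps)
  moreover have "(p - q) \<bullet> u \<le> \<rho>" using norm_cauchy_schwarz[of "p - q" u] outer_normalD[OF u] np by simp
  ultimately have "(p - q) \<bullet> u = norm (p - q) * norm u" using np outer_normalD[OF u] by simp
  then have "\<rho> *\<^sub>R u = p - q"
    using norm_cauchy_schwarz_eq[of "p - q" u] np outer_normalD[OF u] by simp
  then have "u = (p - q) /\<^sub>R \<rho>" using b by (metis scaleR_scaleR left_inverse less_irrefl scaleR_one)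
  then show ?thesis using u by simp
qed

text \<open>The open ball reaching up to the frontier point nearest to \<open>q\<close> misses the
  frontier and is connected, so it stays in \<open>C\<close>. The contact point then has an explicit
  normal.\<close>

lemma nearest_frontier_ball:
  fixes C :: "'a::euclidean_space set"
  assumes C: "convex C" "closed C" "interior C \<noteq> {}" "frontier C \<noteq> {}" and r: "cball q r \<subseteq> C" "0 < r"
  obtains p \<rho> where "outer_normal C p ((p - q) /\<^sub>R \<rho>)" "r \<le> \<rho>" "cball q \<rho> \<subseteq> C" "dist q p = \<rho>"
proof -
  obtain p where p: "p \<in> frontier C" "\<And>y. y \<in> frontier C \<Longrightarrow> dist q p \<le> dist q y"
    using distance_attains_inf[OF frontier_closed C(4)] by blast
  define \<rho> where "\<rho> = dist q p"
  have "ball q r \<subseteq> interior C" using r(1) by (meson ball_subset_cball interior_maximal open_ball subset_trans)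
  then have "p \<notin> ball q r" using p(1) by (auto simp: frontier_def)
  then have r\<rho>: "r \<le> \<rho>" by (simp add: \<rho>_def)
  have qC: "q \<in> C" using r by auto
  have "ball q \<rho> \<inter> frontier C = {}" using p(2) by (fastforce simp: \<rho>_def)
  then have "ball q \<rho> - C = {}"
  proof -
    have "q \<in> ball q \<rho> \<inter> C" using qC r r\<rho> by simp
    then show ?thesis using connected_Int_frontier[of "ball q \<rho>" C] \<open>ball q \<rho> \<inter> frontier C = {}\<close> by blast
  qed
  then have "closure (ball q \<rho>) \<subseteq> C" by (intro closure_minimal C) auto
  then have cb: "cball q \<rho> \<subseteq> C" using r r\<rho> by (simp add: closure_ball)
  have "outer_normal C p ((p - q) /\<^sub>R \<rho>)"
    by (rule outer_normal_touching_ball[OF C(1-3) p(1) cb]) (use r r\<rho> in \<open>auto simp: \<rho>_def\<close>)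
  with r\<rho> cb show ?thesis using that \<rho>_def by blast
qed

section \<open>Unbounded convex sets have long caps\<close>

text \<open>A recession direction: the limit of unit vectors pointing at ever more distant points of
  \<open>C\<close>. Points on the ray from \<open>y\<close> are limits of points on the segments
  from \<open>y\<close> to these distant points.\<close>

lemma unbounded_convex_direction:
  fixes C :: "'a::euclidean_space set"
  assumes C: "convex C" "closed C" "\<not> bounded C" and oC: "o' \<in> C"
  obtains d where "norm d = 1" "\<And>x s. x \<in> C \<Longrightarrow> 0 \<le> s \<Longrightarrow> x + s *\<^sub>R d \<in> C"
proof -
  have "\<exists>x\<in>C. real (Suc k) < norm (x - o')" for k
    using C(3) unfolding bounded_any_center[of C o'] by (auto simp: dist_norm norm_minus_commute not_le)
  then obtain x where x: "\<And>k. x k \<in> C" "\<And>k. real (Suc k) < norm (x k - o')" by metis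
  define n where "n k = norm (x k - o')" for k
  have n: "n k > real (Suc k)" for k using x(2) by (simp add: n_def)
  then have n0: "n k > 0" for k by (metis of_nat_0_le_iff le_less_trans)
  define d where "d k = (x k - o') /\<^sub>R n k" for k
  have "d k \<in> sphere 0 1" for k using n0[of k] by (simp add: d_def n_def)
  then obtain l \<phi> where l: "l \<in> sphere 0 1" "strict_mono \<phi>" "(d \<circ> \<phi>) \<longlonglongrightarrow> l"
    using compact_sphere[of "0::'a" 1] unfolding compact_def by meson
  have "filterlim n at_top sequentially"
    by (rule filterlim_at_top_mono[OF filterlim_real_sequentially])
       (intro always_eventually allI, use n in \<open>smt (verit) of_nat_Suc\<close>)
  then have ninv: "(\<lambda>k. 1 / n (\<phi> k)) \<longlonglongrightarrow> 0"
    using filterlim_compose[OF _ filterlim_subseq[OF l(2)]] tendsto_divide_0[OF tendsto_const filterlim_at_top_imp_at_infinity] by blast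
  have "y + s *\<^sub>R l \<in> C" if y: "y \<in> C" and s: "0 \<le> s" for y s
  proof (rule closed_sequentially[OF C(2)])
    let ?f = "\<lambda>k. y + s *\<^sub>R d (\<phi> k) + (s * (1 / n (\<phi> k))) *\<^sub>R (o' - y)"
    have "?f \<longlonglongrightarrow> y + s *\<^sub>R l + (s * 0) *\<^sub>R (o' - y)"
      using l(3) by (intro tendsto_intros ninv) (simp add: o_def)
    \<comment> \<open>The shift by \<open>nat \<lceil>s\<rceil>\<close> makes \<open>n m\<close>
      exceed \<open>s\<close>, so that \<open>s / n m\<close> is a convex coefficient.\<close>
    then show "(\<lambda>k. ?f (k + nat \<lceil>s\<rceil>)) \<longlonglongrightarrow> y + s *\<^sub>R l" using LIMSEQ_ignore_initial_segment by simp
    fix k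
    define m where "m = \<phi> (k + nat \<lceil>s\<rceil>)"
    have "s \<le> real (nat \<lceil>s\<rceil>)" by linarith
    also have "\<dots> \<le> real m"
      using seq_suble[OF l(2), of "k + nat \<lceil>s\<rceil>"] unfolding m_def of_nat_le_iff by linarith
    finally have "s \<le> n m" using n[of m] by simp
    then have "0 \<le> s / n m" "s / n m \<le> 1" using s n0[of m] by auto
    then have "(1 - s / n m) *\<^sub>R y + (s / n m) *\<^sub>R x m \<in> C" using C(1) y x(1) by (intro convexD) auto
    moreover have "(1 - s / n m) *\<^sub>R y + (s / n m) *\<^sub>R x m = y + s *\<^sub>R d m + (s * (1 / n m)) *\<^sub>R (o' - y)"
      by (simp add: d_def algebra_simps divide_inverse)
    ultimately show "?f (k + nat \<lceil>s\<rceil>) \<in> C" by (simp add: m_def)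
  qed
  then show ?thesis using that[of l] l(1) by simp
qed

text \<open>A ball is moved far out along a recession direction \<open>d\<close> and enlarged until
  it touches the frontier at \<open>p\<close>. If its radius \<open>\<rho>\<close> is at least
  \<open>K\<close>, its own cap of depth \<open>t\<close> is wide enough. Otherwise
  \<open>o'\<close>, at distance \<open>L\<close> behind, still lies below the tangent hyperplane,
  so \<open>d\<close> is almost parallel to it, and a walk of length \<open>2 * R\<close> along
  \<open>d\<close> stays in the cap.\<close>

lemma unbounded_convex_long_cap:
  fixes C :: "'a::euclidean_space set"
  assumes dim: "2 \<le> DIM('a)" and C: "convex C" "closed C" "frontier C \<noteq> {}" "\<not> bounded C"
    and r: "cball o' r \<subseteq> C" and t: "0 < t" "t \<le> r" and R: "0 < R"
  obtains p u y where "outer_normal C p u" "\<And>v. v \<bullet> u = 0 \<Longrightarrow> norm v ^ 2 \<le> r * t \<Longrightarrow> p - t *\<^sub>R u + v \<in> C"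
    "ball (p - t *\<^sub>R u) t \<subseteq> C" "y \<in> C" "(p - y) \<bullet> u = t" "R \<le> norm (y - (p - t *\<^sub>R u))"
proof -
  have oC: "o' \<in> C" using r t by auto
  have int: "interior C \<noteq> {}"
    using interior_mono[OF r] t by (auto simp: interior_cball)
  obtain d where d: "norm d = 1" "\<And>x s. x \<in> C \<Longrightarrow> 0 \<le> s \<Longrightarrow> x + s *\<^sub>R d \<in> C"
    using unbounded_convex_direction[OF C(1,2,4) oC] by metis
  define K where "K = R^2 / t"
  \<comment> \<open>With \<open>L * \<delta> \<le> K\<close> for the slope \<open>\<delta>\<close>,
    the first summand gives \<open>\<delta> \<le> 1/2\<close> and the second
    \<open>2 * R * \<delta> \<le> t\<close>.\<close>
  define L where "L = 2 * K + 2 * R * K / t + 1"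
  have K: "0 < K" using R t by (simp add: K_def)
  have L: "2 * K \<le> L" "2 * R * K / t \<le> L" "0 < L" using K R t by (auto simp: L_def add_nonneg_pos)
  define q where "q = o' + L *\<^sub>R d"
  have "cball q r \<subseteq> C"
  proof
    fix x assume "x \<in> cball q r"
    then have "x - L *\<^sub>R d \<in> C" by (intro subsetD[OF r]) (simp add: q_def dist_norm algebra_simps)
    then show "x \<in> C" using d(2)[of "x - L *\<^sub>R d" L] L by simp
  qed
  then obtain p \<rho> where on: "outer_normal C p ((p - q) /\<^sub>R \<rho>)" and \<rho>: "r \<le> \<rho>" "cball q \<rho> \<subseteq> C" "dist q p = \<rho>"
    using nearest_frontier_ball[OF C(1,2) int C(3), of q r] t by (metis less_le_trans)
  define u where "u = (p - q) /\<^sub>R \<rho>"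
  note u = on[folded u_def]
  have uu: "u \<bullet> u = 1" and nu: "norm u = 1" using outer_normalD[OF u] by auto
  have \<rho>0: "0 < \<rho>" "t \<le> \<rho>" using \<rho> t by auto
  have pq: "p = q + \<rho> *\<^sub>R u" using \<rho>0 by (simp add: u_def)
  define z where "z = p - t *\<^sub>R u"
  have zq: "z = q + (\<rho> - t) *\<^sub>R u" by (simp add: z_def pq algebra_simps)
  have disc: "z + v \<in> C" if v: "v \<bullet> u = 0" "norm v ^ 2 \<le> \<rho> * t" for v
  proof -
    have "norm (z + v - q) ^ 2 = (\<rho> - t)^2 + norm v ^ 2"
      unfolding zq power2_norm_eq_inner using v(1) uu by (simp add: algebra_simps inner_commute power2_eq_square)
    also have "\<dots> \<le> (\<rho> - t)^2 + \<rho> * t" using v by simp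
    also have "\<dots> = \<rho>^2 - t * (\<rho> - t)" by (simp add: power2_eq_square algebra_simps)
    also have "\<dots> \<le> \<rho>^2" using \<rho>0 t by simp
    finally have "norm (z + v - q) \<le> \<rho>" by (rule power2_le_imp_le) (use \<rho>0 in simp)
    then show ?thesis by (intro subsetD[OF \<rho>(2)]) (simp add: dist_norm norm_minus_commute)
  qed
  have bz: "ball z t \<subseteq> C"
  proof
    fix x assume x: "x \<in> ball z t"
    have "dist q x \<le> dist q z + dist z x" by (rule dist_triangle)
    also have "dist q z = \<rho> - t" using \<rho>0 nu by (simp add: zq dist_norm)
    finally show "x \<in> C" using x by (intro subsetD[OF \<rho>(2)]) simp
  qed
  have "\<exists>y\<in>C. (p - y) \<bullet> u = t \<and> R \<le> norm (y - z)"
  proof (cases "K \<le> \<rho>")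
    case True
    obtain v0 :: 'a where v0: "v0 \<noteq> 0" "orthogonal u v0" using orthogonal_to_vector_exists[OF dim] by metis
    define v where "v = (R / norm v0) *\<^sub>R v0"
    have v: "v \<bullet> u = 0" "norm v = R" using v0 R by (simp_all add: v_def orthogonal_def inner_commute)
    have "R^2 \<le> \<rho> * t" using True t by (simp add: K_def field_simps)
    then have "z + v \<in> C" using disc v by simp
    moreover have "(p - (z + v)) \<bullet> u = t" using uu v by (simp add: z_def algebra_simps)
    ultimately show ?thesis using v by (intro bexI[of _ "z + v"]) auto
  next
    case False
    define \<delta> where "\<delta> = - (d \<bullet> u)"
    have pC: "p \<in> C" using outer_normalD(1)[OF u] .
    have "(p + 1 *\<^sub>R d - p) \<bullet> u \<le> 0" using outer_normalD(4)[OF u d(2)[OF pC, of 1]] by simp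
    then have \<delta>0: "0 \<le> \<delta>" by (simp add: \<delta>_def)
    have "(o' - p) \<bullet> u \<le> 0" using outer_normalD(4)[OF u oC] .
    then have "L * \<delta> \<le> \<rho>" using uu by (simp add: pq q_def \<delta>_def algebra_simps)
    then have \<delta>L: "L * \<delta> \<le> K" using False by simp
    have "2 * K * \<delta> \<le> L * \<delta>" by (rule mult_right_mono[OF L(1) \<delta>0])
    then have "2 * K * \<delta> \<le> K" using \<delta>L by simp
    then have \<delta>h: "\<delta> \<le> 1/2" using K by simp
    have "2 * R * K / t * \<delta> \<le> L * \<delta>" by (rule mult_right_mono[OF L(2) \<delta>0])
    then have "2 * R * K / t * \<delta> \<le> K" using \<delta>L by simp
    then have \<delta>R: "2 * R * \<delta> \<le> t" using K t by (simp add: field_simps)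
    \<comment> \<open>The walk along \<open>d\<close> adds depth \<open>\<delta> * (2 * R)\<close>,
      so it starts that much closer to the tangent hyperplane and ends at depth exactly
      \<open>t\<close>.\<close>
    define y where "y = p - (t - \<delta> * (2 * R)) *\<^sub>R u + (2 * R) *\<^sub>R d"
    have "p - (t - \<delta> * (2 * R)) *\<^sub>R u \<in> cball q \<rho>"
    proof -
      have "q - (p - (t - \<delta> * (2 * R)) *\<^sub>R u) = - ((\<rho> - (t - \<delta> * (2 * R))) *\<^sub>R u)" by (simp add: pq algebra_simps)
      then have "dist q (p - (t - \<delta> * (2 * R)) *\<^sub>R u) = \<bar>\<rho> - (t - \<delta> * (2 * R))\<bar>" using nu by (simp only: dist_norm norm_minus_cancel norm_scaleR) simp
      moreover have "0 \<le> t - \<delta> * (2 * R)" using \<delta>R by (simp add: mult.commute)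
      moreover have "0 \<le> \<delta> * (2 * R)" using \<delta>0 R by simp
      ultimately show ?thesis using \<rho>0 by simp
    qed
    then have "y \<in> C" unfolding y_def using \<rho>(2) R by (intro d(2)) auto
    moreover have "(p - y) \<bullet> u = t" using uu by (simp add: y_def \<delta>_def algebra_simps)
    moreover have "R \<le> norm (y - z)"
    proof -
      have "y - z = (2 * R) *\<^sub>R (d + \<delta> *\<^sub>R u)" by (simp add: y_def z_def algebra_simps)
      then have "norm (y - z) = 2 * R * norm (d + \<delta> *\<^sub>R u)" using R by simp
      moreover have "1 - \<delta> \<le> norm (d + \<delta> *\<^sub>R u)"
        using norm_triangle_ineq2[of d "- (\<delta> *\<^sub>R u)"] d(1) nu \<delta>0 by simp
      then have "2 * R * (1/2) \<le> 2 * R * norm (d + \<delta> *\<^sub>R u)" using R \<delta>h by (intro mult_left_mono) auto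
      ultimately show ?thesis by simp
    qed
    ultimately show ?thesis by blast
  qed
  then obtain y where y: "y \<in> C" "(p - y) \<bullet> u = t" "R \<le> norm (y - z)" by blast
  have disc': "z + v \<in> C" if "v \<bullet> u = 0" "norm v ^ 2 \<le> r * t" for v
    using disc[OF that(1)] order_trans[OF that(2) mult_right_mono[OF \<rho>(1), of t]] t by simp
  show ?thesis
    by (rule that[OF u _ bz[unfolded z_def] y(1,2) y(3)[unfolded z_def]]) (use disc' in \<open>auto simp: z_def\<close>)
qed

text \<open>\<open>N\<close> translates of \<open>D\<close> are placed along the first half of the
  segment from \<open>z\<close> to \<open>y\<close>; consecutive centres are at least
  \<open>2 * \<rho>\<close> apart. By convexity \<open>X\<close> contains the shrunk copies of
  \<open>z + 2 D\<close> that arise on moving towards \<open>y\<close>, and these still contain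
  full-size translates of \<open>D\<close>. The measure is left abstract because both discs under
  Hausdorff measure and balls under Lebesgue measure are packed.\<close>

lemma packing_translates:
  fixes \<nu> :: "'a::euclidean_space measure"
  assumes \<nu>: "sets \<nu> = sets borel" "\<And>a. emeasure \<nu> ((\<lambda>x. x + a) ` D) = emeasure \<nu> D"
    and D: "D \<in> sets borel" "D \<subseteq> ball 0 \<rho>" and X: "X \<in> sets borel" "convex X"
    and z: "\<And>v c. v \<in> D \<Longrightarrow> 0 \<le> c \<Longrightarrow> c \<le> 2 \<Longrightarrow> z + c *\<^sub>R v \<in> X"
    and y: "y \<in> X" "4 * real N * \<rho> \<le> norm (y - z)" and N: "0 < N"
  shows "of_nat N * emeasure \<nu> D \<le> emeasure \<nu> X"
proof -
  define \<tau> where "\<tau> j = real j / (2 * real N)" for j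
  define T where "T j = (\<lambda>x. x + (z + \<tau> j *\<^sub>R (y - z))) ` D" for j
  have Tb: "T j \<in> sets borel" for j
  proof -
    have "T j = (\<lambda>x. x - (z + \<tau> j *\<^sub>R (y - z))) -` D"
      unfolding T_def by (auto simp: image_iff intro!: bexI[of _ "_ - (z + \<tau> j *\<^sub>R (y - z))"])
    then show ?thesis using measurable_sets[OF _ D(1), of "\<lambda>x. x - (z + \<tau> j *\<^sub>R (y - z))" borel] by simp
  qed
  have sub: "T j \<subseteq> X" if "j < N" for j
  proof
    fix x assume "x \<in> T j"
    then obtain v where v: "v \<in> D" "x = v + (z + \<tau> j *\<^sub>R (y - z))" by (auto simp: T_def)
    have \<tau>: "0 \<le> \<tau> j" "\<tau> j \<le> 1/2" using that by (auto simp: \<tau>_def divide_simps)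
    \<comment> \<open>Pre-scaling \<open>v\<close> by \<open>c\<close> compensates the contraction
      by \<open>1 - \<tau> j\<close>; the bound \<open>\<tau> j \<le> 1/2\<close> keeps
      \<open>c\<close> within 2.\<close>
    define c where "c = 1 / (1 - \<tau> j)"
    have c: "0 \<le> c" "c \<le> 2" "(1 - \<tau> j) * c = 1" using \<tau> by (auto simp: c_def divide_simps)
    have "(1 - \<tau> j) *\<^sub>R (z + c *\<^sub>R v) + \<tau> j *\<^sub>R y \<in> X"
      using X(2) z[OF v(1) c(1,2)] y(1) \<tau> by (intro convexD) auto
    also have "(1 - \<tau> j) *\<^sub>R (z + c *\<^sub>R v) + \<tau> j *\<^sub>R y = x"
    proof -
      have *: "(1 - \<tau> j) *\<^sub>R (z + c *\<^sub>R v) = (1 - \<tau> j) *\<^sub>R z + v"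
        by (simp only: scaleR_add_right scaleR_scaleR c(3) scaleR_one)
      show ?thesis unfolding * v by (simp add: algebra_simps)
    qed
    finally show "x \<in> X" .
  qed
  have disj: "T i \<inter> T j = {}" if "i \<noteq> j" for i j
  proof (rule ccontr)
    assume "T i \<inter> T j \<noteq> {}"
    then obtain v w where vw: "v \<in> D" "w \<in> D"
      "v + (z + \<tau> i *\<^sub>R (y - z)) = w + (z + \<tau> j *\<^sub>R (y - z))" by (auto simp: T_def)
    then have "(\<tau> i - \<tau> j) *\<^sub>R (y - z) = w - v" by (simp add: algebra_simps)
    then have "\<bar>\<tau> i - \<tau> j\<bar> * norm (y - z) = norm (w - v)" by (metis norm_scaleR)
    moreover have "norm (w - v) < 2 * \<rho>"
    proof -
      have "norm w < \<rho>" "norm v < \<rho>" using vw(1,2) D(2) by (auto simp: subset_eq)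
      then show ?thesis using norm_triangle_ineq4[of w v] by linarith
    qed
    moreover have "1 / (2 * real N) \<le> \<bar>\<tau> i - \<tau> j\<bar>"
    proof -
      have "1 \<le> \<bar>real i - real j\<bar>" using that by linarith
      then show ?thesis using N by (simp add: \<tau>_def diff_divide_distrib[symmetric] abs_divide divide_right_mono)
    qed
    then have "1 / (2 * real N) * (4 * real N * \<rho>) \<le> \<bar>\<tau> i - \<tau> j\<bar> * norm (y - z)"
    proof (intro mult_mono y(2))
      have "norm v < \<rho>" using vw(1) D(2) by (auto simp: subset_eq)
      then have "0 \<le> \<rho>" using norm_ge_zero[of v] by linarith
      then show "0 \<le> 4 * real N * \<rho>" by simp
    qed auto
    ultimately show False using N by simp
  qed
  have "of_nat N * emeasure \<nu> D = (\<Sum>j<N. emeasure \<nu> (T j))"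
    by (simp add: T_def \<nu>(2))
  also have "\<dots> = emeasure \<nu> (\<Union>j<N. T j)"
    by (rule sum_emeasure) (use Tb \<nu>(1) disj in \<open>auto simp: disjoint_family_on_def\<close>)
  also have "\<dots> \<le> emeasure \<nu> X" by (rule emeasure_mono) (use sub X \<nu>(1) in auto)
  finally show ?thesis .
qed

section \<open>First moments of caps\<close>

text \<open>Caps are written as half spaces, and \<open>C\<close> is imposed only through
  \<open>AE_C\<close>. Volume and surface measure thus share one notation, and integrands are
  continuous functions on the whole space.\<close>

locale equal_caps = finite_measure \<mu> for \<mu> :: "'a::euclidean_space measure" +
  fixes C :: "'a set" and f :: "real \<Rightarrow> real" and \<epsilon> :: real
  assumes C: "compact C" "convex C" "interior C \<noteq> {}"
    and sets_\<mu> [measurable_cong]: "sets \<mu> = sets borel"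
    and AE_C: "AE x in \<mu>. x \<in> C"
    and \<epsilon>: "0 < \<epsilon>"
    and cap: "outer_normal C p u \<Longrightarrow> 0 < t \<Longrightarrow> t < \<epsilon> \<Longrightarrow> measure \<mu> {x. (p - x) \<bullet> u \<le> t} = f t"
begin

lemma C_nonempty: "C \<noteq> {}"
  using C interior_subset by auto

lemma space_\<mu> [simp]: "space \<mu> = UNIV"
  using sets_eq_imp_space_eq[OF sets_\<mu>] by simp

lemma integrable_continuous [intro]:
  fixes g :: "'a \<Rightarrow> real"
  assumes g: "continuous_on UNIV g" shows "integrable \<mu> g"
proof -
  have "bounded (g ` C)"
    by (intro compact_imp_bounded compact_continuous_image continuous_on_subset[OF g] C) auto
  then obtain B where B: "\<And>x. x \<in> C \<Longrightarrow> norm (g x) \<le> B" unfolding bounded_iff by auto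
  have [measurable]: "g \<in> borel_measurable borel" using g by (rule borel_measurable_continuous_onI)
  show ?thesis
    by (rule integrable_const_bound[where B=B]) (use AE_C B in \<open>auto elim!: eventually_mono\<close>)
qed

text \<open>Layer cake formula: at a point of depth \<open>g\<close>, the positive part of
  \<open>t - g\<close> is the length of the set of levels \<open>s\<close> below \<open>t\<close>
  with \<open>g \<le> s\<close>. Exchanging integrals leaves the cap masses, which are known for
  positive \<open>s\<close> only; hence the open interval.\<close>

lemma nn_integral_potential:
  assumes u: "outer_normal C p u" and t: "t < \<epsilon>"
  shows "(\<integral>\<^sup>+x. ennreal (t - (p - x) \<bullet> u) \<partial>\<mu>) = (\<integral>\<^sup>+s. ennreal (f s) * indicator {0<..<t} s \<partial>lborel)"
proof -
  interpret P: pair_sigma_finite \<mu> lborel ..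
  define K where "K s = {x. (p - x) \<bullet> u \<le> s}" for s
  have "(\<integral>\<^sup>+x. ennreal (t - (p - x) \<bullet> u) \<partial>\<mu>)
      = (\<integral>\<^sup>+x. \<integral>\<^sup>+s. indicator {s. (p - x) \<bullet> u \<le> s} s * indicator {0<..<t} s \<partial>lborel \<partial>\<mu>)"
  proof (rule nn_integral_cong_AE)
    show "AE x in \<mu>. ennreal (t - (p - x) \<bullet> u)
        = (\<integral>\<^sup>+s. indicator {s. (p - x) \<bullet> u \<le> s} s * indicator {0<..<t} s \<partial>lborel)"
      using AE_C
    proof eventually_elim
      fix x assume x: "x \<in> C"
      define g where "g = (p - x) \<bullet> u"
      have g0: "0 \<le> g" using outer_normalD(4)[OF u x] by (simp add: g_def inner_diff_left)
      have "(\<integral>\<^sup>+s. indicator {s. g \<le> s} s * indicator {0<..<t} s \<partial>lborel)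
          = (\<integral>\<^sup>+s. indicator (if g = 0 then {0<..<t} else {g..<t}) s \<partial>lborel)"
        by (rule nn_integral_cong) (use g0 in \<open>auto simp: indicator_def\<close>)
      also have "\<dots> = ennreal (t - g)"
        using g0 by (cases "g \<le> t") (auto simp: ennreal_neg)
      finally show "ennreal (t - (p - x) \<bullet> u)
        = (\<integral>\<^sup>+s. indicator {s. (p - x) \<bullet> u \<le> s} s * indicator {0<..<t} s \<partial>lborel)" by (simp add: g_def)
    qed
  qed
  also have "\<dots> = (\<integral>\<^sup>+s. \<integral>\<^sup>+x. indicator {s. (p - x) \<bullet> u \<le> s} s * indicator {0<..<t} s \<partial>\<mu> \<partial>lborel)"
    by (rule P.Fubini'[symmetric]) measurable
  also have "\<dots> = (\<integral>\<^sup>+s. emeasure \<mu> (K s) * indicator {0<..<t} s \<partial>lborel)"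
  proof (rule nn_integral_cong)
    fix s :: real
    have [measurable]: "K s \<in> sets \<mu>" unfolding K_def by measurable
    have "(\<integral>\<^sup>+x. indicator {s. (p - x) \<bullet> u \<le> s} s * indicator {0<..<t} s \<partial>\<mu>)
       = (\<integral>\<^sup>+x. indicator (K s) x * indicator {0<..<t} s \<partial>\<mu>)"
      by (rule nn_integral_cong) (auto simp: K_def indicator_def)
    then show "(\<integral>\<^sup>+x. indicator {s. (p - x) \<bullet> u \<le> s} s * indicator {0<..<t} s \<partial>\<mu>)
       = emeasure \<mu> (K s) * indicator {0<..<t} s" by (simp add: nn_integral_multc)
  qed
  also have "\<dots> = (\<integral>\<^sup>+s. ennreal (f s) * indicator {0<..<t} s \<partial>lborel)"
    by (rule nn_integral_cong) (use t cap[OF u] in \<open>auto simp: indicator_def emeasure_eq_measure K_def\<close>)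
  finally show ?thesis .
qed

definition potential :: "real \<Rightarrow> real" where
  "potential t = enn2real (\<integral>\<^sup>+s. ennreal (f s) * indicator {0<..<t} s \<partial>lborel)"

lemma integral_potential:
  assumes u: "outer_normal C p u" and t: "t < \<epsilon>"
  shows "(\<integral>x. max 0 (t - (p - x) \<bullet> u) \<partial>\<mu>) = potential t"
  by (subst integral_eq_nn_integral)
     (auto simp: potential_def nn_integral_potential[OF assms, symmetric] ennreal_max_0)

text \<open>The hyperplane through \<open>p\<close> with normal \<open>v\<close> lies no farther out
  than the supporting one with that normal, which can only enlarge the integrand. Scaling by
  \<open>norm v\<close> avoids normalizing \<open>v\<close>; at a unit outer normal of
  \<open>p\<close> equality holds, so that normal minimizes the difference of the two sides.\<close>

lemma potential_le:
  assumes p: "p \<in> C" and t: "t < \<epsilon>"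
  shows "norm v * potential t \<le> (\<integral>x. max 0 (t * norm v + (x - p) \<bullet> v) \<partial>\<mu>)"
proof (cases "v = 0")
  case False
  let ?u = "v /\<^sub>R norm v"
  have "norm ?u = 1" using False by simp
  then obtain q where q: "outer_normal C q ?u"
    using exists_outer_normal_direction[OF C(1) C_nonempty] by blast
  have v: "y \<bullet> v = norm v * (y \<bullet> ?u)" for y
    unfolding inner_scaleR_right using False by simp
  have qp: "0 \<le> (q - p) \<bullet> ?u" using outer_normalD(4)[OF q p] by (simp only: inner_diff_left)
  have "norm v * potential t = (\<integral>x. norm v * max 0 (t - (q - x) \<bullet> ?u) \<partial>\<mu>)"
    by (simp only: integral_potential[OF q t, symmetric] integral_mult_right_zero)
  also have "\<dots> \<le> (\<integral>x. max 0 (t * norm v + (x - p) \<bullet> v) \<partial>\<mu>)"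
  proof (rule integral_mono)
    fix x
    have "t - (q - x) \<bullet> ?u \<le> t + (x - p) \<bullet> ?u" using qp by (simp only: inner_diff_left)
    then have "norm v * (t - (q - x) \<bullet> ?u) \<le> norm v * (t + (x - p) \<bullet> ?u)" by (intro mult_left_mono) auto
    also have "\<dots> = t * norm v + (x - p) \<bullet> v" by (simp only: v[of "x - p"] distrib_left mult.commute)
    finally show "norm v * max 0 (t - (q - x) \<bullet> ?u) \<le> max 0 (t * norm v + (x - p) \<bullet> v)"
      by (simp add: max_def)
  qed (auto intro!: integrable_continuous continuous_intros)
  finally show ?thesis .
qed simp

text \<open>The potential of the cap at depth \<open>t\<close>, taken with the hyperplane through \<open>p\<close> orthogonal to
  \<open>u + h e\<close> in place of the supporting one, is minimal at \<open>h = 0\<close> after division by \<open>norm (u + h e)\<close>;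
  the first moment is its derivative.\<close>

lemma cap_moment:
  assumes u: "outer_normal C p u" and t: "0 < t" "t < \<epsilon>"
    and null: "measure \<mu> {x. (p - x) \<bullet> u = t} = 0"
  shows "(\<integral>x. indicator {x. (p - x) \<bullet> u \<le> t} x * (t * (u \<bullet> e) + (x - p) \<bullet> e) \<partial>\<mu>) = potential t * (u \<bullet> e)"
proof -
  define a where "a x = t - (p - x) \<bullet> u" for x
  define \<beta> where "\<beta> x = t * (u \<bullet> e) + (x - p) \<bullet> e" for x
  define K where "K = {x. (p - x) \<bullet> u \<le> t}"
  \<comment> \<open>The quadratic error in \<open>norm (u + h *\<^sub>R e) \<le> 1 + h * (u
    \<bullet> e) + h^2 * E\<close>, obtained from
    \<open>2 * norm v \<le> 1 + norm v ^ 2\<close>.\<close>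
  define E where "E = norm e ^ 2 / 2"
  define I where "I = (\<integral>x. indicator K x * \<beta> x \<partial>\<mu>)"
  note uu = outer_normalD(3)[OF u] and pC = outer_normalD(1)[OF u]
  have ca: "continuous_on UNIV a" and c\<beta>: "continuous_on UNIV \<beta>"
    unfolding a_def \<beta>_def by (intro continuous_intros)+
  have [measurable]: "a \<in> borel_measurable borel" "\<beta> \<in> borel_measurable borel"
    using ca c\<beta> by (auto intro: borel_measurable_continuous_onI)
  have Km[measurable]: "K \<in> sets borel" unfolding K_def by measurable
  have "bounded (\<beta> ` C)"
    by (intro compact_imp_bounded compact_continuous_image continuous_on_subset[OF c\<beta>] C) auto
  then obtain B0 where B0: "\<And>x. x \<in> C \<Longrightarrow> \<bar>\<beta> x\<bar> \<le> B0" unfolding bounded_iff by auto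
  define B where "B = max B0 1"
  have B: "\<And>x. x \<in> C \<Longrightarrow> \<bar>\<beta> x\<bar> \<le> B" "B > 0" using B0 by (auto simp: B_def le_max_iff_disj)
  define m where "m s = measure \<mu> {x. \<bar>a x\<bar> \<le> s * B}" for s
  have iK: "integrable \<mu> (\<lambda>x. indicator K x * \<beta> x)"
    using integrable_continuous[OF c\<beta>] Km by (simp add: integrable_mult_indicator sets_\<mu> flip: real_scaleR_def)
  \<comment> \<open>First-order expansion of the potential at \<open>h = 0\<close>, used for both
    signs of \<open>h\<close>. Replacing the positive part of \<open>a x + h * \<beta> x\<close> by
    its linearization errs only in the layer \<open>\<bar>a x\<bar> \<le> \<bar>h\<bar> * B\<close>,
    where the sign may change; its mass \<open>m \<bar>h\<bar>\<close> tends to the mass of the null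
    slice.\<close>
  have key: "h * (potential t * (u \<bullet> e) - I) \<le> \<bar>h\<bar> * (B * m \<bar>h\<bar> + \<bar>h\<bar> * (t * E * measure \<mu> UNIV))" for h
  proof -
    define v where "v = u + h *\<^sub>R e"
    have v1: "1 + h * (u \<bullet> e) \<le> norm v"
      using norm_cauchy_schwarz[of v u] uu outer_normalD(2)[OF u] by (simp add: v_def inner_add_left inner_add_right inner_commute)
    have v2: "norm v \<le> 1 + h * (u \<bullet> e) + h^2 * E"
    proof -
      have "norm v ^ 2 = 1 + 2 * (h * (u \<bullet> e) + h^2 * E)"
        unfolding power2_norm_eq_inner E_def v_def using uu
        by (simp add: algebra_simps inner_commute power2_eq_square)
      moreover have "2 * norm v \<le> 1 + norm v ^ 2"
        using zero_le_power2[of "norm v - 1"] by (simp add: power2_eq_square algebra_simps)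
      ultimately show ?thesis by simp
    qed
    have p0: "0 \<le> potential t" by (simp add: potential_def)
    have "potential t * (1 + h * (u \<bullet> e)) \<le> norm v * potential t"
      using mult_right_mono[OF v1 p0] by (simp add: mult.commute)
    also have "\<dots> \<le> (\<integral>x. max 0 (t * norm v + (x - p) \<bullet> v) \<partial>\<mu>)"
      by (rule potential_le[OF pC t(2)])
    also have "\<dots> \<le> (\<integral>x. max 0 (a x) + h * (indicator K x * \<beta> x)
        + \<bar>h\<bar> * B * indicator {x. \<bar>a x\<bar> \<le> \<bar>h\<bar> * B} x + h^2 * t * E \<partial>\<mu>)"
    proof (rule integral_mono_AE)
      show "integrable \<mu> (\<lambda>x. max 0 (t * norm v + (x - p) \<bullet> v))" by (auto intro!: continuous_intros)
      show "integrable \<mu> (\<lambda>x. max 0 (a x) + h * (indicator K x * \<beta> x)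
        + \<bar>h\<bar> * B * indicator {x. \<bar>a x\<bar> \<le> \<bar>h\<bar> * B} x + h^2 * t * E)"
        by (intro Bochner_Integration.integrable_add integrable_mult_right iK integrable_continuous
            continuous_intros ca integrable_const integrable_real_indicator)
           (auto simp: sets_\<mu> emeasure_eq_measure)
      show "AE x in \<mu>. max 0 (t * norm v + (x - p) \<bullet> v) \<le> max 0 (a x) + h * (indicator K x * \<beta> x)
        + \<bar>h\<bar> * B * indicator {x. \<bar>a x\<bar> \<le> \<bar>h\<bar> * B} x + h^2 * t * E"
        using AE_C
      proof eventually_elim
        fix x assume x: "x \<in> C"
        have hb: "\<bar>h * \<beta> x\<bar> \<le> \<bar>h\<bar> * B" using B(1)[OF x] by (simp add: abs_mult mult_left_mono)
        have tE: "0 \<le> h^2 * t * E" using t by (simp add: E_def)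
        have "t * norm v + (x - p) \<bullet> v \<le> t * (1 + h * (u \<bullet> e) + h^2 * E) + (x - p) \<bullet> v"
          using v2 t by (intro add_right_mono mult_left_mono) auto
        also have "\<dots> = a x + h * \<beta> x + h^2 * t * E"
          by (simp add: a_def \<beta>_def v_def algebra_simps)
        finally have 1: "max 0 (t * norm v + (x - p) \<bullet> v) \<le> max 0 (a x + h * \<beta> x) + h^2 * t * E"
          using tE by linarith
        have K: "x \<in> K \<longleftrightarrow> 0 \<le> a x" by (simp add: K_def a_def)
        have hB: "0 \<le> \<bar>h\<bar> * B" using B(2) by simp
        have 2: "max 0 (a x + h * \<beta> x) \<le> max 0 (a x) + h * (indicator K x * \<beta> x)
          + \<bar>h\<bar> * B * indicator {x. \<bar>a x\<bar> \<le> \<bar>h\<bar> * B} x"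
        proof (cases "\<bar>a x\<bar> \<le> \<bar>h\<bar> * B")
          case True
          then show ?thesis using hb hB K by (cases "x \<in> K") (auto simp: max_def abs_le_iff)
        next
          case False
          then show ?thesis using hb hB K by (cases "x \<in> K") (auto simp: max_def abs_le_iff not_le)
        qed
        show "max 0 (t * norm v + (x - p) \<bullet> v) \<le> max 0 (a x) + h * (indicator K x * \<beta> x)
        + \<bar>h\<bar> * B * indicator {x. \<bar>a x\<bar> \<le> \<bar>h\<bar> * B} x + h^2 * t * E" using 1 2 by linarith
      qed
    qed
    also have "\<dots> = potential t + h * I + \<bar>h\<bar> * B * m \<bar>h\<bar> + h^2 * t * E * measure \<mu> UNIV"
    proof -
      have i1: "integrable \<mu> (\<lambda>x. max 0 (a x))" by (intro integrable_continuous continuous_intros ca)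
      have i2: "integrable \<mu> (\<lambda>x. h * (indicator K x * \<beta> x))" by (intro integrable_mult_right iK)
      have i3: "integrable \<mu> (\<lambda>x. \<bar>h\<bar> * B * indicator {x. \<bar>a x\<bar> \<le> \<bar>h\<bar> * B} x)"
        by (intro integrable_mult_right integrable_real_indicator) (auto simp: sets_\<mu> emeasure_eq_measure)
      have pot: "(\<integral>x. max 0 (a x) \<partial>\<mu>) = potential t"
        unfolding a_def by (rule integral_potential[OF u t(2)])
      show ?thesis
        using i1 i2 i3 pot by (simp add: I_def m_def)
    qed
    finally have "h * (potential t * (u \<bullet> e) - I) \<le> \<bar>h\<bar> * B * m \<bar>h\<bar> + h^2 * t * E * measure \<mu> UNIV"
      by (simp add: algebra_simps)
    also have "h^2 = \<bar>h\<bar> * \<bar>h\<bar>" by (simp add: power2_eq_square)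
    finally show ?thesis by (simp add: algebra_simps del: abs_mult_self_eq)
  qed
  define G where "G s = B * m s + s * (t * E * measure \<mu> UNIV)" for s
  have bound: "\<bar>potential t * (u \<bullet> e) - I\<bar> \<le> G s" if "s > 0" for s
  proof -
    define X where "X = potential t * (u \<bullet> e) - I"
    have "s * X \<le> s * G s" "s * - X \<le> s * G s"
      using key[of s] key[of "- s"] that unfolding G_def X_def[symmetric] by simp_all
    then show ?thesis using that unfolding abs_le_iff X_def[symmetric] by (simp only: mult_le_cancel_left_pos)
  qed
  have "(\<lambda>k. m (1 / real (Suc k))) \<longlonglongrightarrow> measure \<mu> (\<Inter>k. {x. \<bar>a x\<bar> \<le> 1 / real (Suc k) * B})"
    unfolding m_def
  proof (rule finite_Lim_measure_decseq)
    show "decseq (\<lambda>k. {x. \<bar>a x\<bar> \<le> 1 / real (Suc k) * B})"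
    proof (rule decseq_SucI, safe)
      fix k x assume "\<bar>a x\<bar> \<le> 1 / real (Suc (Suc k)) * B"
      also have "\<dots> \<le> 1 / real (Suc k) * B" using B(2) by (intro mult_right_mono) (auto simp: divide_simps)
      finally show "\<bar>a x\<bar> \<le> 1 / real (Suc k) * B" .
    qed
  qed (auto simp: sets_\<mu>)
  also have "(\<Inter>k. {x. \<bar>a x\<bar> \<le> 1 / real (Suc k) * B}) = {x. (p - x) \<bullet> u = t}"
  proof safe
    fix x assume x: "x \<in> (\<Inter>k. {x. \<bar>a x\<bar> \<le> 1 / real (Suc k) * B})"
    show "(p - x) \<bullet> u = t"
    proof (rule ccontr)
      assume "(p - x) \<bullet> u \<noteq> t"
      then have "0 < \<bar>a x\<bar> / B" using B by (simp add: a_def)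
      then obtain k where "1 / real (Suc k) < \<bar>a x\<bar> / B" using reals_Archimedean by (auto simp: inverse_eq_divide)
      then have "1 / real (Suc k) * B < \<bar>a x\<bar>" using B by (simp add: pos_less_divide_eq)
      then show False using x by (auto simp: not_less[symmetric])
    qed
  qed (use B in \<open>auto simp: a_def\<close>)
  finally have m0: "(\<lambda>k. m (1 / real (Suc k))) \<longlonglongrightarrow> 0" using null by simp
  have s0: "(\<lambda>k. 1 / real (Suc k)) \<longlonglongrightarrow> 0" by (rule LIMSEQ_Suc[OF lim_1_over_n])
  have "(\<lambda>k. G (1 / real (Suc k))) \<longlonglongrightarrow> B * 0 + 0 * (t * E * measure \<mu> UNIV)"
    unfolding G_def by (intro tendsto_intros m0 s0)
  then have "\<bar>potential t * (u \<bullet> e) - I\<bar> \<le> 0"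
    by (intro LIMSEQ_le_const[of "\<lambda>k. G (1 / real (Suc k))"]) (auto intro!: bound)
  then show ?thesis by (simp add: I_def K_def \<beta>_def)
qed

text \<open>The mass of the slice at depth \<open>t\<close> is the left jump of \<open>f\<close> at
  \<open>t\<close>, and \<open>f\<close> is common to all points.\<close>

lemma cap_boundary_measure_eq:
  assumes u: "outer_normal C p u" and v: "outer_normal C q v" and t: "0 < t" "t < \<epsilon>"
  shows "measure \<mu> {x. (p - x) \<bullet> u = t} = measure \<mu> {x. (q - x) \<bullet> v = t}"
proof -
  \<comment> \<open>The offset 2 in the denominator keeps \<open>s 0\<close> positive, as required
    for applying \<open>cap\<close>.\<close>
  define s where "s k = t - t / real (Suc (Suc k))" for k
  have s: "0 < s k" "s k < t" for k using t by (auto simp: s_def divide_simps)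
  have lim: "(\<lambda>k. f (s k)) \<longlonglongrightarrow> f t - measure \<mu> {x. (p - x) \<bullet> u = t}" if u: "outer_normal C p u" for p u
  proof -
    have "(\<lambda>k. measure \<mu> {x. (p - x) \<bullet> u \<le> s k}) \<longlonglongrightarrow> measure \<mu> (\<Union>k. {x. (p - x) \<bullet> u \<le> s k})"
    proof (rule finite_Lim_measure_incseq)
      show "incseq (\<lambda>k. {x. (p - x) \<bullet> u \<le> s k})"
      proof (rule incseq_SucI, safe)
        fix k x assume "(p - x) \<bullet> u \<le> s k"
        also have "s k \<le> s (Suc k)" unfolding s_def using t by (intro diff_left_mono divide_left_mono) auto
        finally show "(p - x) \<bullet> u \<le> s (Suc k)" .
      qed
    qed (auto simp: sets_\<mu>)
    also have "(\<lambda>k. measure \<mu> {x. (p - x) \<bullet> u \<le> s k}) = (\<lambda>k. f (s k))"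
    proof
      fix k show "measure \<mu> {x. (p - x) \<bullet> u \<le> s k} = f (s k)"
        by (rule cap[OF u s(1)]) (use s(2)[of k] t in linarith)
    qed
    also have "(\<Union>k. {x. (p - x) \<bullet> u \<le> s k}) = {x. (p - x) \<bullet> u < t}"
    proof safe
      fix x k assume "(p - x) \<bullet> u \<le> s k" then show "(p - x) \<bullet> u < t" using s(2) by (rule le_less_trans)
    next
      fix x assume x: "(p - x) \<bullet> u < t"
      have "(\<lambda>k. t / real (Suc (Suc k))) \<longlonglongrightarrow> 0"
        by (rule LIMSEQ_Suc[OF LIMSEQ_Suc[OF lim_const_over_n]])
      from tendsto_diff[OF tendsto_const this, of t] have "s \<longlonglongrightarrow> t" by (simp add: s_def[abs_def])
      then have "eventually (\<lambda>k. (p - x) \<bullet> u < s k) sequentially" using x by (rule order_tendstoD)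
      then obtain k where "(p - x) \<bullet> u < s k" using eventually_happens' by force
      then show "x \<in> (\<Union>k. {x. (p - x) \<bullet> u \<le> s k})" by (auto intro: less_imp_le)
    qed
    also have "measure \<mu> {x. (p - x) \<bullet> u < t} = measure \<mu> ({x. (p - x) \<bullet> u \<le> t} - {x. (p - x) \<bullet> u = t})"
      by (rule arg_cong[where f="measure \<mu>"]) auto
    also have "\<dots> = f t - measure \<mu> {x. (p - x) \<bullet> u = t}"
      by (subst finite_measure_Diff) (auto simp: sets_\<mu> cap[OF u t])
    finally show ?thesis .
  qed
  show ?thesis using LIMSEQ_unique[OF lim[OF u] lim[OF v]] by simp
qed

text \<open>For one direction at most countably many slices carry mass; by equality of the jumps, a
  depth that is null there is null at every contact point.\<close>

lemma exists_null_depth: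
  assumes "0 < \<delta>" "\<delta> \<le> \<epsilon>"
  obtains t where "0 < t" "t < \<delta>" "\<And>p u. outer_normal C p u \<Longrightarrow> measure \<mu> {x. (p - x) \<bullet> u = t} = 0"
proof -
  obtain b :: 'a where b: "b \<in> Basis" using nonempty_Basis by blast
  obtain p where p: "outer_normal C p b"
    using exists_outer_normal_direction[OF C(1) C_nonempty norm_Basis[OF b]] by blast
  let ?N = "distr \<mu> borel (\<lambda>x. (p - x) \<bullet> b)"
  interpret N: finite_measure ?N by (rule finite_measure_distr) simp
  have cs: "countable {x. measure ?N {x} \<noteq> 0}" by (rule N.countable_support)
  have "\<not> {0<..<\<delta>} \<subseteq> {x. measure ?N {x} \<noteq> 0}"
    using countable_subset[OF _ cs] uncountable_open_interval[of 0 \<delta>] assms by metis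
  then obtain t where t: "0 < t" "t < \<delta>" "measure ?N {t} = 0" by auto
  have "measure ?N {t} = measure \<mu> {x. (p - x) \<bullet> b = t}"
    by (subst measure_distr) (auto simp: vimage_def)
  then show ?thesis
    using that[OF t(1,2)] t assms cap_boundary_measure_eq[OF _ p t(1)] by simp
qed

end

section \<open>Moving planes\<close>

definition reach :: "'a::euclidean_space set \<Rightarrow> 'a \<Rightarrow> 'a \<Rightarrow> real" where
  "reach C w x = (SOME d. 0 < d \<and> x + d *\<^sub>R w \<in> frontier C)"

locale convex_body =
  fixes C :: "'a::euclidean_space set"
  assumes compact: "compact C" and convex: "convex C" and interior_nonempty: "interior C \<noteq> {}"
    and unique_normal: "outer_normal C p u \<Longrightarrow> outer_normal C p v \<Longrightarrow> u = v"
begin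

lemma closed: "closed C" and bounded: "bounded C" and nonempty: "C \<noteq> {}"
  using compact interior_nonempty interior_subset by (auto intro: compact_imp_closed compact_imp_bounded)

lemma frontier_subset: "frontier C \<subseteq> C"
  by (rule frontier_subset_closed[OF closed])

lemma closure_interior: "closure (interior C) = C"
  using convex_closure_interior[OF convex interior_nonempty] closed by simp

lemma reach:
  assumes x: "x \<in> interior C" and w: "norm w = 1"
  shows "0 < reach C w x" "x + reach C w x *\<^sub>R w \<in> frontier C"
proof -
  have "w \<noteq> 0" using w by auto
  then obtain d where "0 < d" "x + d *\<^sub>R w \<in> frontier C"
    using ray_to_frontier[OF bounded x] by metis
  then have "\<exists>d. 0 < d \<and> x + d *\<^sub>R w \<in> frontier C" by blast
  from someI_ex[OF this] show "0 < reach C w x" "x + reach C w x *\<^sub>R w \<in> frontier C"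
    by (auto simp: reach_def)
qed

lemma reach_normal:
  assumes x: "x \<in> interior C" and w: "norm w = 1"
  obtains u where "outer_normal C (x + reach C w x *\<^sub>R w) u" "0 < w \<bullet> u"
proof -
  obtain u where u: "outer_normal C (x + reach C w x *\<^sub>R w) u"
    using exists_outer_normal[OF convex closed interior_nonempty reach(2)[OF x w]] by blast
  have "(x - (x + reach C w x *\<^sub>R w)) \<bullet> u < 0" by (rule outer_normal_interior[OF u x])
  then have "0 < reach C w x * (w \<bullet> u)" by simp
  then have "0 < w \<bullet> u" using reach(1)[OF x w] by (simp add: zero_less_mult_iff)
  with u show ?thesis using that by blast
qed

text \<open>Beyond the frontier point the ray has left the supporting half space there, because the
  normal has positive inner product with \<open>w\<close>. In particular the choice in
  \<open>reach\<close> is determined.\<close>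

lemma reach_iff:
  assumes x: "x \<in> interior C" and w: "norm w = 1" and s: "0 \<le> s"
  shows "x + s *\<^sub>R w \<in> C \<longleftrightarrow> s \<le> reach C w x"
proof
  assume *: "x + s *\<^sub>R w \<in> C"
  obtain u where u: "outer_normal C (x + reach C w x *\<^sub>R w) u" "0 < w \<bullet> u"
    using reach_normal[OF x w] by blast
  have "(x + s *\<^sub>R w - (x + reach C w x *\<^sub>R w)) \<bullet> u \<le> 0" by (rule outer_normalD(4)[OF u(1) *])
  then have "(s - reach C w x) * (w \<bullet> u) \<le> 0" by (simp add: algebra_simps)
  then show "s \<le> reach C w x" using u(2) by (simp add: mult_le_0_iff)
next
  assume *: "s \<le> reach C w x"
  define d where "d = reach C w x"
  have d: "0 < d" "x + d *\<^sub>R w \<in> C" using reach[OF x w] frontier_subset by (auto simp: d_def)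
  have "(1 - s / d) *\<^sub>R x + (s / d) *\<^sub>R (x + d *\<^sub>R w) \<in> C"
    using s * d x interior_subset by (intro convexD[OF convex]) (auto simp: d_def)
  also have "(1 - s / d) *\<^sub>R x + (s / d) *\<^sub>R (x + d *\<^sub>R w) = x + s *\<^sub>R w"
    using d(1) by (simp add: algebra_simps)
  finally show "x + s *\<^sub>R w \<in> C" .
qed

text \<open>Convex combinations of chord ends lie in \<open>C\<close>, so \<open>reach\<close> is
  concave, hence continuous on the open interior.\<close>

lemma continuous_on_reach:
  assumes w: "norm w = 1" shows "continuous_on (interior C) (reach C w)"
proof -
  have "convex_on (interior C) (\<lambda>x. - reach C w x)"
  proof (rule convex_onI)
    fix t :: real and x y assume t: "0 < t" "t < 1" and x: "x \<in> interior C" and y: "y \<in> interior C"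
    define a b where "a = reach C w x" and "b = reach C w y"
    have a: "0 < a" "x + a *\<^sub>R w \<in> C" and b: "0 < b" "y + b *\<^sub>R w \<in> C"
      using reach[OF x w] reach[OF y w] frontier_subset by (auto simp: a_def b_def)
    have z: "(1 - t) *\<^sub>R x + t *\<^sub>R y \<in> interior C"
      using t x y by (intro convexD[OF convex_interior[OF convex]]) auto
    have "(1 - t) *\<^sub>R (x + a *\<^sub>R w) + t *\<^sub>R (y + b *\<^sub>R w) \<in> C"
      using t a b by (intro convexD[OF convex]) auto
    then have "((1 - t) *\<^sub>R x + t *\<^sub>R y) + ((1 - t) * a + t * b) *\<^sub>R w \<in> C"
      by (simp add: algebra_simps)
    then have "(1 - t) * a + t * b \<le> reach C w ((1 - t) *\<^sub>R x + t *\<^sub>R y)"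
      using reach_iff[OF z w, of "(1 - t) * a + t * b"] t a b by simp
    then show "- reach C w ((1 - t) *\<^sub>R x + t *\<^sub>R y) \<le> (1 - t) * - reach C w x + t * - reach C w y"
      by (simp add: a_def b_def)
  qed (rule convex_interior[OF convex])
  then have "continuous_on (interior C) (\<lambda>x. - (- reach C w x))"
    by (intro continuous_on_minus convex_on_continuous open_interior)
  then show ?thesis by simp
qed

text \<open>The height along \<open>w\<close> of the midpoint of the chord through \<open>x\<close>
  in direction \<open>w\<close>; the body is symmetric about level \<open>l\<close> exactly when
  this is constantly \<open>l\<close>.\<close>

definition mid :: "'a \<Rightarrow> 'a \<Rightarrow> real" where
  "mid w x = x \<bullet> w + (reach C w x - reach C (- w) x) / 2"

lemma refl_hyp_chord:
  assumes x: "x \<in> interior C" and w: "norm w = 1" and m: "mid w x \<le> l" and l: "l \<le> x \<bullet> w"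
  shows "refl_hyp w l x \<in> C"
proof -
  have "2 * (x \<bullet> w - l) \<le> reach C (- w) x"
    using m l reach(1)[OF x w] unfolding mid_def by argo
  then have "x + (2 * (x \<bullet> w - l)) *\<^sub>R - w \<in> C" using reach_iff[OF x, of "- w"] w l by simp
  then show ?thesis by (simp add: refl_hyp_def)
qed

text \<open>Interior points strictly beyond the hyperplane are mirrored within their chord; the
  other points follow by closure, and those on the hyperplane are fixed.\<close>

lemma refl_hyp_half:
  assumes w: "norm w = 1" and m: "\<And>x. x \<in> interior C \<Longrightarrow> mid w x \<le> l" and x: "x \<in> C" "l \<le> x \<bullet> w"
  shows "refl_hyp w l x \<in> C"
proof (cases "x \<bullet> w = l")
  case True then show ?thesis using x by (simp add: refl_hyp_def)
next
  case False
  let ?S = "{y. l < y \<bullet> w}"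
  have "open ?S" by (intro open_Collect_less continuous_intros)
  then have "?S \<inter> closure (interior C) \<subseteq> closure (?S \<inter> interior C)" by (rule open_Int_closure_subset)
  then have "x \<in> closure (?S \<inter> interior C)" using x False by (auto simp: closure_interior)
  then have "refl_hyp w l x \<in> refl_hyp w l ` closure (?S \<inter> interior C)" by blast
  moreover have "refl_hyp w l ` closure (?S \<inter> interior C) \<subseteq> C"
  proof (rule image_closure_subset[OF continuous_on_refl_hyp closed])
    show "refl_hyp w l ` (?S \<inter> interior C) \<subseteq> C" using refl_hyp_chord[OF _ w m] by auto
  qed
  ultimately show ?thesis by blast
qed

text \<open>Near the mirror image of \<open>A\<close>, which lies strictly beyond the hyperplane,
  \<open>C\<close> is mirrored into \<open>C\<close> and hence supported by the mirrored normal.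
  Convexity turns this local support into a global one.\<close>

lemma outer_normal_refl_hyp:
  assumes w: "norm w = 1" and half: "\<And>x. x \<in> C \<Longrightarrow> l \<le> x \<bullet> w \<Longrightarrow> refl_hyp w l x \<in> C"
    and A: "outer_normal C A \<nu>" and B: "refl_hyp w l A \<in> C" and Aw: "A \<bullet> w < l"
  shows "outer_normal C (refl_hyp w l A) (refl_hyp w 0 \<nu>)"
  unfolding outer_normal_def
proof (intro conjI ballI B)
  show "norm (refl_hyp w 0 \<nu>) = 1" using norm_refl_hyp[OF w] outer_normalD(2)[OF A] by simp
  fix z assume z: "z \<in> C"
  let ?B = "refl_hyp w l A"
  have Bw: "l < ?B \<bullet> w" using Aw by (simp add: refl_hyp_inner[OF w])
  \<comment> \<open>A point \<open>z\<close> on the wrong side is replaced by the point where the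
    segment from \<open>?B\<close> to \<open>z\<close> crosses the hyperplane.\<close>
  define \<tau> where "\<tau> = (if l \<le> z \<bullet> w then 1 else (?B \<bullet> w - l) / (?B \<bullet> w - z \<bullet> w))"
  have \<tau>: "0 < \<tau>" "\<tau> \<le> 1" using Bw by (auto simp: \<tau>_def)
  define y where "y = (1 - \<tau>) *\<^sub>R ?B + \<tau> *\<^sub>R z"
  have yC: "y \<in> C" unfolding y_def using \<tau> B z by (intro convexD[OF convex]) auto
  have "l \<le> y \<bullet> w"
  proof (cases "l \<le> z \<bullet> w")
    case False
    then have "\<tau> * (?B \<bullet> w - z \<bullet> w) = ?B \<bullet> w - l" using Bw by (simp add: \<tau>_def)
    then show ?thesis by (simp add: y_def algebra_simps)
  qed (simp add: \<tau>_def y_def)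
  then have "(refl_hyp w l y - A) \<bullet> \<nu> \<le> 0" using half yC outer_normalD(4)[OF A] by blast
  moreover have "refl_hyp w l y - A = refl_hyp w 0 (y - ?B)"
    using refl_hyp_diff[of w l y ?B] refl_hyp_refl_hyp[OF w, of l A] by simp
  moreover have "refl_hyp w 0 (y - ?B) \<bullet> \<nu> = (y - ?B) \<bullet> refl_hyp w 0 \<nu>"
    using refl_hyp_inner_refl_hyp[OF w, of "y - ?B" "refl_hyp w 0 \<nu>"] refl_hyp_refl_hyp[OF w, of 0 \<nu>] by simp
  moreover have "y - ?B = \<tau> *\<^sub>R (z - ?B)" by (simp add: y_def algebra_simps)
  ultimately have "\<tau> * ((z - ?B) \<bullet> refl_hyp w 0 \<nu>) \<le> 0" by simp
  then show "(z - ?B) \<bullet> refl_hyp w 0 \<nu> \<le> 0" using \<tau>(1) by (simp add: mult_le_0_iff)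
qed

text \<open>The critical hyperplane is found by maximizing over chords together with normals at their
  end points. This compact set also contains degenerate chords, which account for the case where
  the reflected cap touches \<open>C\<close> at a point with a normal parallel to the hyperplane.\<close>

lemma critical_hyperplane:
  assumes w: "norm w = 1"
  obtains l A \<nu> where "\<And>x. x \<in> interior C \<Longrightarrow> mid w x \<le> l" "outer_normal C A \<nu>" "\<nu> \<bullet> w \<le> 0"
    "outer_normal C (refl_hyp w l A) (refl_hyp w 0 \<nu>)"
proof -
  have ww: "w \<bullet> w = 1" using w by (simp add: dot_square_norm)
  define T where "T = {(A, B, \<nu>, u). outer_normal C A \<nu> \<and> outer_normal C B u \<and> \<nu> \<bullet> w \<le> 0 \<and> 0 \<le> u \<bullet> w
    \<and> B - A = ((B - A) \<bullet> w) *\<^sub>R w \<and> 0 \<le> (B - A) \<bullet> w}"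
  have "T = {z. outer_normal C (fst z) (fst (snd (snd z)))} \<inter> {z. outer_normal C (fst (snd z)) (snd (snd (snd z)))}
     \<inter> {z. fst (snd (snd z)) \<bullet> w \<le> 0} \<inter> {z. 0 \<le> snd (snd (snd z)) \<bullet> w}
     \<inter> {z. fst (snd z) - fst z = ((fst (snd z) - fst z) \<bullet> w) *\<^sub>R w} \<inter> {z. 0 \<le> (fst (snd z) - fst z) \<bullet> w}"
    by (auto simp: T_def)
  then have "closed T"
    by (simp only:) (intro closed_Int closed_outer_normal closed closed_Collect_le closed_Collect_eq continuous_intros)
  moreover have "bounded T"
  proof (rule bounded_subset)
    show "bounded (C \<times> C \<times> sphere (0::'a) 1 \<times> sphere (0::'a) 1)"
      by (intro bounded_Times bounded bounded_sphere)
    show "T \<subseteq> C \<times> C \<times> sphere 0 1 \<times> sphere 0 1" by (auto simp: T_def outer_normal_def)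
  qed
  ultimately have "compact T" by (simp add: compact_eq_bounded_closed)
  have chordT: "\<exists>\<nu> u. (x + reach C (- w) x *\<^sub>R - w, x + reach C w x *\<^sub>R w, \<nu>, u) \<in> T" if x: "x \<in> interior C" for x
  proof -
    have nw: "norm (- w) = 1" using w by simp
    obtain u where u: "outer_normal C (x + reach C w x *\<^sub>R w) u" "0 < w \<bullet> u" using reach_normal[OF x w] by blast
    obtain \<nu> where \<nu>: "outer_normal C (x + reach C (- w) x *\<^sub>R - w) \<nu>" "0 < - w \<bullet> \<nu>" using reach_normal[OF x nw] by blast
    have "(x + reach C w x *\<^sub>R w) - (x + reach C (- w) x *\<^sub>R - w) = (reach C w x + reach C (- w) x) *\<^sub>R w"
      by (simp add: algebra_simps)
    then show ?thesis using u \<nu> reach(1)[OF x w] reach(1)[OF x nw] ww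
      by (intro exI[of _ \<nu>] exI[of _ u]) (simp add: T_def inner_commute)
  qed
  obtain x0 where x0: "x0 \<in> interior C" using interior_nonempty by blast
  have "T \<noteq> {}" using chordT[OF x0] by blast
  moreover have "continuous_on T (\<lambda>z. (fst z \<bullet> w + fst (snd z) \<bullet> w) / 2)" by (intro continuous_intros) auto
  ultimately obtain z where z: "z \<in> T" "\<And>y. y \<in> T \<Longrightarrow> (fst y \<bullet> w + fst (snd y) \<bullet> w) / 2 \<le> (fst z \<bullet> w + fst (snd z) \<bullet> w) / 2"
    using continuous_attains_sup[OF \<open>compact T\<close>] by blast
  obtain A B \<nu> u where zz: "z = (A, B, \<nu>, u)" by (cases z) auto
  define l where "l = (A \<bullet> w + B \<bullet> w) / 2"
  have T: "outer_normal C A \<nu>" "outer_normal C B u" "\<nu> \<bullet> w \<le> 0" "0 \<le> u \<bullet> w"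
    "B - A = ((B - A) \<bullet> w) *\<^sub>R w" "0 \<le> (B - A) \<bullet> w" using z(1) by (auto simp: T_def zz)
  have mid: "mid w x \<le> l" if x: "x \<in> interior C" for x
  proof -
    obtain \<nu>' u' where "(x + reach C (- w) x *\<^sub>R - w, x + reach C w x *\<^sub>R w, \<nu>', u') \<in> T" using chordT[OF x] by blast
    from z(2)[OF this] show ?thesis using ww by (simp add: mid_def l_def zz inner_add_left inner_diff_left field_simps)
  qed
  have BA: "refl_hyp w l A = B"
  proof -
    have "2 * (A \<bullet> w - l) = - ((B - A) \<bullet> w)" by (simp add: l_def inner_diff_left field_simps)
    then have "refl_hyp w l A = A + ((B - A) \<bullet> w) *\<^sub>R w" by (simp add: refl_hyp_def)
    also have "\<dots> = A + (B - A)" using T(5) by simp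
    finally show ?thesis by simp
  qed
  have "outer_normal C (refl_hyp w l A) (refl_hyp w 0 \<nu>)"
  proof (cases "(B - A) \<bullet> w = 0")
    \<comment> \<open>A degenerate chord: both ends coincide, so uniqueness gives equal normals, and
      the two sign conditions force \<open>\<nu> \<bullet> w = 0\<close>. The reflection then fixes
      the normal.\<close>
    case True
    then have "B = A" using T(5) by simp
    moreover from this have "u = \<nu>" using unique_normal T by blast
    ultimately have "refl_hyp w 0 \<nu> = \<nu>" using T(3,4) by (simp add: refl_hyp_def)
    then show ?thesis unfolding BA using T(1) \<open>B = A\<close> by simp
  next
    case False
    have "A \<bullet> w < l" using False T(6) by (simp add: l_def inner_diff_left)
    then show ?thesis
      using outer_normal_refl_hyp[OF w refl_hyp_half[OF w mid] T(1)] T(2) BA by (simp add: outer_normal_def)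
  qed
  with mid T show ?thesis using that by blast
qed

end

text \<open>The interface between measure and geometry: the half cap beyond the hyperplane, weighted
  by distance to it, is at most its counterpart in front, and in the equality case the frontier in
  front of it, strictly within the cap, is mirrored into \<open>C\<close>. Volume and surface area
  satisfy both for different reasons.\<close>

locale equal_caps_body = equal_caps \<mu> C f \<epsilon> + convex_body C
  for \<mu> :: "'a::euclidean_space measure" and C f \<epsilon> +
  assumes half_cap_le: "norm w = 1 \<Longrightarrow> (\<And>x. x \<in> C \<Longrightarrow> l \<le> x \<bullet> w \<Longrightarrow> refl_hyp w l x \<in> C) \<Longrightarrow>
      outer_normal C A \<nu> \<Longrightarrow> outer_normal C (refl_hyp w l A) (refl_hyp w 0 \<nu>) \<Longrightarrow> 0 < t \<Longrightarrow> t < \<epsilon> \<Longrightarrow>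
      (\<integral>\<^sup>+x. indicator {x. (refl_hyp w l A - x) \<bullet> refl_hyp w 0 \<nu> \<le> t} x * ennreal (x \<bullet> w - l) \<partial>\<mu>)
        \<le> (\<integral>\<^sup>+x. indicator {x. (A - x) \<bullet> \<nu> \<le> t} x * ennreal (l - x \<bullet> w) \<partial>\<mu>)"
    and half_cap_eq: "norm w = 1 \<Longrightarrow> (\<And>x. x \<in> C \<Longrightarrow> l \<le> x \<bullet> w \<Longrightarrow> refl_hyp w l x \<in> C) \<Longrightarrow>
      outer_normal C A \<nu> \<Longrightarrow> outer_normal C (refl_hyp w l A) (refl_hyp w 0 \<nu>) \<Longrightarrow> 0 < t \<Longrightarrow> t < \<epsilon> \<Longrightarrow>
      (\<integral>\<^sup>+x. indicator {x. (refl_hyp w l A - x) \<bullet> refl_hyp w 0 \<nu> \<le> t} x * ennreal (x \<bullet> w - l) \<partial>\<mu>)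
        = (\<integral>\<^sup>+x. indicator {x. (A - x) \<bullet> \<nu> \<le> t} x * ennreal (l - x \<bullet> w) \<partial>\<mu>) \<Longrightarrow>
      q \<in> frontier C \<Longrightarrow> q \<bullet> w < l \<Longrightarrow> (A - q) \<bullet> \<nu> < t \<Longrightarrow> refl_hyp w l q \<in> C"
begin

text \<open>By \<open>cap_moment\<close>, the moment of a cap about the hyperplane depends on its
  contact data only through \<open>u \<bullet> w\<close> and \<open>p \<bullet> w - l\<close>, and
  is odd in them. Both change sign under the reflection, so the moments at \<open>A\<close> and at
  its mirror image add up to zero. Each far half is at most the mirrored near half; a zero total
  leaves only equality.\<close>

lemma reflected_cap:
  assumes w: "norm w = 1" and half: "\<And>x. x \<in> C \<Longrightarrow> l \<le> x \<bullet> w \<Longrightarrow> refl_hyp w l x \<in> C"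
    and A: "outer_normal C A \<nu>" and B: "outer_normal C (refl_hyp w l A) (refl_hyp w 0 \<nu>)"
    and t: "0 < t" "t < \<epsilon>" and null: "\<And>p u. outer_normal C p u \<Longrightarrow> measure \<mu> {x. (p - x) \<bullet> u = t} = 0"
    and q: "q \<in> frontier C" "q \<bullet> w < l" "(A - q) \<bullet> \<nu> < t"
  shows "refl_hyp w l q \<in> C"
proof -
  define P where "P = refl_hyp w l A"
  define u where "u = refl_hyp w 0 \<nu>"
  have AP: "refl_hyp w l P = A" "refl_hyp w 0 u = \<nu>" by (simp_all add: P_def u_def refl_hyp_refl_hyp[OF w])
  have uw: "u \<bullet> w = - (\<nu> \<bullet> w)" by (simp add: u_def refl_hyp_inner[OF w])
  have Pw: "P \<bullet> w = 2 * l - A \<bullet> w" by (simp add: P_def refl_hyp_inner[OF w])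
  note Pu = B[folded P_def u_def]
  define K where "K p u = {x. (p - x) \<bullet> u \<le> t}" for p u :: 'a
  have [measurable]: "K p u \<in> sets borel" for p u unfolding K_def by measurable
  define R where "R p u = (\<integral>\<^sup>+x. indicator (K p u) x * ennreal (x \<bullet> w - l) \<partial>\<mu>)" for p u
  define L where "L p u = (\<integral>\<^sup>+x. indicator (K p u) x * ennreal (l - x \<bullet> w) \<partial>\<mu>)" for p u
  have int: "integrable \<mu> (\<lambda>x. indicator (K p u) x * g x)" if "continuous_on UNIV g" for p u and g :: "'a \<Rightarrow> real"
    using integrable_continuous[OF that] by (simp add: integrable_mult_indicator sets_\<mu> flip: real_scaleR_def)
  have ci: "continuous_on UNIV (\<lambda>x. x \<bullet> w - l)" "continuous_on UNIV (\<lambda>x. l - x \<bullet> w)" by (intro continuous_intros)+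
  have fin: "R p u < \<infinity>" "L p u < \<infinity>" for p u
  proof -
    have "(\<integral>\<^sup>+x. ennreal (norm (indicator (K p u) x * (x \<bullet> w - l))) \<partial>\<mu>) < \<infinity>"
      using int[OF ci(1)] by (simp add: integrable_iff_bounded)
    moreover have "R p u \<le> (\<integral>\<^sup>+x. ennreal (norm (indicator (K p u) x * (x \<bullet> w - l))) \<partial>\<mu>)"
      unfolding R_def by (rule nn_integral_mono) (auto simp: indicator_def intro!: ennreal_leI)
    moreover have "L p u \<le> (\<integral>\<^sup>+x. ennreal (norm (indicator (K p u) x * (x \<bullet> w - l))) \<partial>\<mu>)"
      unfolding L_def by (rule nn_integral_mono) (auto simp: indicator_def intro!: ennreal_leI)
    ultimately show "R p u < \<infinity>" "L p u < \<infinity>" by (auto intro: le_less_trans)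
  qed
  have RL: "(\<integral>x. indicator (K p u) x * (x \<bullet> w - l) \<partial>\<mu>) = enn2real (R p u) - enn2real (L p u)" for p u
  proof -
    have "(\<integral>\<^sup>+x. ennreal (indicator (K p u) x * (x \<bullet> w - l)) \<partial>\<mu>) = R p u"
      unfolding R_def by (rule nn_integral_cong) (auto simp: indicator_def)
    moreover have "(\<integral>\<^sup>+x. ennreal (- (indicator (K p u) x * (x \<bullet> w - l))) \<partial>\<mu>) = L p u"
      unfolding L_def by (rule nn_integral_cong) (auto simp: indicator_def)
    ultimately show ?thesis using real_lebesgue_integral_def[OF int[OF ci(1), of p u]] by simp
  qed
  have moment: "(\<integral>x. indicator (K p u) x * (x \<bullet> w - l) \<partial>\<mu>)
      = potential t * (u \<bullet> w) - f t * (t * (u \<bullet> w) + l - p \<bullet> w)" if on: "outer_normal C p u" for p u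
  proof -
    have "potential t * (u \<bullet> w) = (\<integral>x. indicator (K p u) x * (t * (u \<bullet> w) + (x - p) \<bullet> w) \<partial>\<mu>)"
      unfolding K_def by (rule cap_moment[OF on t null[OF on], symmetric])
    also have "\<dots> = (\<integral>x. indicator (K p u) x * (x \<bullet> w - l) + (t * (u \<bullet> w) + l - p \<bullet> w) * indicator (K p u) x \<partial>\<mu>)"
      by (rule Bochner_Integration.integral_cong) (auto simp: indicator_def inner_diff_left)
    also have "\<dots> = (\<integral>x. indicator (K p u) x * (x \<bullet> w - l) \<partial>\<mu>) + (t * (u \<bullet> w) + l - p \<bullet> w) * measure \<mu> (K p u)"
    proof -
      have "integrable \<mu> (\<lambda>x. (t * (u \<bullet> w) + l - p \<bullet> w) * indicator (K p u) x)"
        by (intro integrable_mult_right integrable_real_indicator) (auto simp: sets_\<mu> emeasure_eq_measure)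
      then show ?thesis using int[OF ci(1), of p u] by simp
    qed
    finally show ?thesis using cap[OF on t] by (simp add: K_def)
  qed
  have "(\<integral>x. indicator (K P u) x * (x \<bullet> w - l) \<partial>\<mu>) + (\<integral>x. indicator (K A \<nu>) x * (x \<bullet> w - l) \<partial>\<mu>) = 0"
    unfolding moment[OF Pu] moment[OF A] uw Pw by (simp add: algebra_simps)
  then have sum: "enn2real (R P u) + enn2real (R A \<nu>) = enn2real (L P u) + enn2real (L A \<nu>)" unfolding RL by simp
  have le1: "R P u \<le> L A \<nu>"
    using half_cap_le[OF w half A B t] by (simp add: R_def L_def K_def P_def u_def)
  \<comment> \<open>The same comparison with the two contact points exchanged; a point mirrored
    twice returns to itself.\<close>
  have le2: "R A \<nu> \<le> L P u"
    using half_cap_le[OF w half Pu _ t] A by (simp add: R_def L_def K_def AP)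
  have "enn2real (R P u) \<le> enn2real (L A \<nu>)" "enn2real (R A \<nu>) \<le> enn2real (L P u)"
    using le1 le2 fin by (auto intro!: enn2real_mono)
  with sum have "enn2real (R P u) = enn2real (L A \<nu>)" by linarith
  then have "R P u = L A \<nu>" using fin(1)[of P u] fin(2)[of A \<nu>]
    by (metis ennreal_enn2real infinity_ennreal_def)
  then show ?thesis
    using half_cap_eq[OF w half A B t _ q] by (simp add: R_def L_def K_def P_def u_def)
qed

text \<open>\<open>Z\<close> consists of the interior points whose chord is bisected by the critical
  hyperplane. Each contact pair places in \<open>Z\<close> all points whose lower chord end lies in
  its cap, and each point of \<open>Z\<close> supplies a new contact pair. Hence \<open>Z\<close> is
  open, closed and nonempty in the connected interior.\<close>

theorem symmetric_in_direction:
  assumes w: "norm w = 1"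
  shows "\<exists>l. \<forall>x\<in>C. refl_hyp w l x \<in> C"
proof -
  have nw: "norm (- w) = 1" and ww: "w \<bullet> w = 1" using w by (simp_all add: dot_square_norm)
  obtain l A \<nu> where mid: "\<And>x. x \<in> interior C \<Longrightarrow> mid w x \<le> l" and A: "outer_normal C A \<nu>" "\<nu> \<bullet> w \<le> 0"
    "outer_normal C (refl_hyp w l A) (refl_hyp w 0 \<nu>)" using critical_hyperplane[OF w] by metis
  obtain t where t: "0 < t" "t < \<epsilon>" and null: "\<And>p u. outer_normal C p u \<Longrightarrow> measure \<mu> {x. (p - x) \<bullet> u = t} = 0"
    using exists_null_depth[OF \<epsilon>] by auto
  note half = refl_hyp_half[OF w mid]
  define a where "a x = x + reach C (- w) x *\<^sub>R - w" for x
  have a_frontier: "a x \<in> frontier C" if "x \<in> interior C" for x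
    unfolding a_def by (rule reach(2)[OF that nw])
  have aw: "a x \<bullet> w = x \<bullet> w - reach C (- w) x" for x using ww by (simp add: a_def inner_diff_left)
  have refl_a: "refl_hyp w l (a x) = x + (reach C (- w) x + 2 * (l - x \<bullet> w)) *\<^sub>R w" for x
  proof -
    have e: "reach C (- w) x + 2 * (l - x \<bullet> w) = - reach C (- w) x - 2 * (x \<bullet> w - reach C (- w) x - l)" by simp
    show ?thesis unfolding refl_hyp_def aw unfolding e a_def
      by (simp only: scaleR_left_diff_distrib scaleR_minus_left scaleR_minus_right add_diff_eq)
  qed
  \<comment> \<open>The mirror image of the lower end \<open>a x\<close> lies on the same chord and
    in \<open>C\<close>, so the midpoint is at least at level \<open>l\<close>; extremality of
    \<open>l\<close> gives the opposite inequality.\<close>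
  have touch: "mid w x = l"
    if on: "outer_normal C A \<nu>" "outer_normal C (refl_hyp w l A) (refl_hyp w 0 \<nu>)"
      and x: "x \<in> interior C" "(A - a x) \<bullet> \<nu> < t" for A \<nu> x
  proof -
    have lt: "a x \<bullet> w < l"
      using mid[OF x(1)] reach(1)[OF x(1) w] reach(1)[OF x(1) nw] unfolding aw mid_def by argo
    have "refl_hyp w l (a x) \<in> C"
      by (rule reflected_cap[OF w half on t null a_frontier[OF x(1)] lt x(2)])
    moreover note refl_a[of x]
    moreover have "0 \<le> reach C (- w) x + 2 * (l - x \<bullet> w)"
      using mid[OF x(1)] reach(1)[OF x(1) w] unfolding mid_def by argo
    ultimately have "reach C (- w) x + 2 * (l - x \<bullet> w) \<le> reach C w x"
      using reach_iff[OF x(1) w] by simp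
    then show ?thesis using mid[OF x(1)] unfolding mid_def by argo
  qed
  define Z where "Z = {x\<in>interior C. mid w x = l}"
  have cont: "continuous_on (interior C) (mid w)" "continuous_on (interior C) a"
    unfolding mid_def[abs_def] a_def[abs_def]
    by (intro continuous_intros continuous_on_reach[OF w] continuous_on_reach[OF nw]; simp)+
  have "Z \<noteq> {}"
  proof -
    have "A \<in> closure (interior C)" using closure_interior outer_normalD(1)[OF A(1)] by simp
    then obtain x where x: "x \<in> interior C" "dist x A < t" using t closure_approachable by metis
    \<comment> \<open>Moving down along \<open>w\<close> cannot increase the depth below
      \<open>A\<close>, since \<open>\<nu> \<bullet> w \<le> 0\<close>. Points close to
      \<open>A\<close> therefore have their lower chord end in the cap.\<close>
    have "(A - a x) \<bullet> \<nu> = (A - x) \<bullet> \<nu> + reach C (- w) x * (\<nu> \<bullet> w)"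
      by (simp add: a_def algebra_simps inner_commute)
    also have "\<dots> \<le> (A - x) \<bullet> \<nu>"
      using reach(1)[OF x(1) nw] A(2) by (simp add: mult_nonneg_nonpos)
    also have "\<dots> \<le> norm (A - x) * norm \<nu>" by (rule norm_cauchy_schwarz)
    also have "\<dots> < t" using x(2) outer_normalD(2)[OF A(1)] by (simp add: dist_norm norm_minus_commute)
    finally have "mid w x = l" by (rule touch[OF A(1,3) x(1)])
    then show ?thesis using x(1) by (auto simp: Z_def)
  qed
  moreover have "openin (top_of_set (interior C)) Z"
  proof (subst openin_subopen, intro ballI)
    fix x0 assume "x0 \<in> Z"
    then have x0: "x0 \<in> interior C" "mid w x0 = l" by (auto simp: Z_def)
    have A0: "a x0 \<bullet> w < l"
      using x0 reach(1)[OF x0(1) w] reach(1)[OF x0(1) nw] unfolding aw mid_def by argo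
    \<comment> \<open>At a bisected chord the lower end and its mirror image both lie in
      \<open>C\<close>, so they form a contact pair, to which the same depth \<open>t\<close>
      applies.\<close>
    obtain n where n: "outer_normal C (a x0) n"
      using exists_outer_normal[OF convex closed interior_nonempty a_frontier[OF x0(1)]] by blast
    note refl_a[of x0]
    also have "reach C (- w) x0 + 2 * (l - x0 \<bullet> w) = reach C w x0" using x0(2) unfolding mid_def by argo
    finally have "refl_hyp w l (a x0) \<in> C" using reach(2)[OF x0(1) w] frontier_subset by auto
    from outer_normal_refl_hyp[OF w half n this A0]
    have n': "outer_normal C (refl_hyp w l (a x0)) (refl_hyp w 0 n)" .
    let ?U = "interior C \<inter> (\<lambda>x. (a x0 - a x) \<bullet> n) -` {..<t}"
    have "openin (top_of_set (interior C)) ?U"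
      by (rule continuous_openin_preimage_gen) (auto intro!: continuous_intros cont)
    moreover have "x0 \<in> ?U" using x0 t by simp
    moreover have "?U \<subseteq> Z" using touch[OF n n'] by (auto simp: Z_def)
    ultimately show "\<exists>T. openin (top_of_set (interior C)) T \<and> x0 \<in> T \<and> T \<subseteq> Z" by blast
  qed
  moreover have "closedin (top_of_set (interior C)) Z"
    unfolding Z_def by (rule continuous_closedin_preimage_constant[OF cont(1), unfolded vimage_def Int_def, simplified])
  moreover have "connected (interior C)" by (intro convex_connected convex_interior convex)
  ultimately have Z: "Z = interior C" unfolding connected_clopen by blast
  have "refl_hyp w l ` closure (interior C) \<subseteq> C"
  proof (rule image_closure_subset[OF continuous_on_refl_hyp closed], safe)
    fix x assume x: "x \<in> interior C"
    then have m: "mid w x = l" using Z by (auto simp: Z_def)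
    show "refl_hyp w l x \<in> C"
    proof (cases "l \<le> x \<bullet> w")
      case True then show ?thesis using half x interior_subset by blast
    next
      case False
      have "2 * (l - x \<bullet> w) \<le> reach C w x" using m reach(1)[OF x nw] unfolding mid_def by argo
      then have "x + (2 * (l - x \<bullet> w)) *\<^sub>R w \<in> C" using reach_iff[OF x w] False by simp
      then show ?thesis by (simp add: refl_hyp_def algebra_simps)
    qed
  qed
  then show ?thesis unfolding closure_interior by blast
qed

end

text \<open>The coordinate reflections compose to a central symmetry about \<open>c\<close>, which
  forces every mirror through \<open>c\<close>. Reflections then spread a farthest point over a
  whole sphere, and convexity fills the ball.\<close>

lemma symmetric_imp_ball:
  fixes C :: "'a::euclidean_space set"
  assumes C: "compact C" "convex C" "interior C \<noteq> {}"
    and sym: "\<And>w. norm w = 1 \<Longrightarrow> \<exists>l. \<forall>x\<in>C. refl_hyp w l x \<in> C"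
  shows "\<exists>c a. a > 0 \<and> C = cball c a"
proof -
  have ne: "C \<noteq> {}" using C(3) interior_subset by auto
  have "\<exists>l. \<forall>b\<in>Basis. \<forall>x\<in>C. refl_hyp b (l b) x \<in> C"
    by (rule bchoice) (use sym norm_Basis in blast)
  then obtain l where l: "\<And>b x. b \<in> Basis \<Longrightarrow> x \<in> C \<Longrightarrow> refl_hyp b (l b) x \<in> C" by blast
  define c where "c = (\<Sum>b\<in>Basis. l b *\<^sub>R b)"
  have part: "x - (\<Sum>b\<in>S. (2 * (x \<bullet> b - l b)) *\<^sub>R b) \<in> C" if "S \<subseteq> Basis" "x \<in> C" for S x
  proof -
    have "finite S" using that(1) finite_Basis finite_subset by blast
    then show ?thesis using that(1)
    proof (induction S)
      case (insert b S)
      let ?y = "x - (\<Sum>b\<in>S. (2 * (x \<bullet> b - l b)) *\<^sub>R b)"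
      have b: "b \<in> Basis" using insert by auto
      have "(\<Sum>b\<in>S. (2 * (x \<bullet> b - l b)) *\<^sub>R b) \<bullet> b = 0"
        unfolding inner_sum_left
      proof (rule sum.neutral, intro ballI)
        fix i assume "i \<in> S"
        then have "i \<in> Basis" "i \<noteq> b" using insert by auto
        then show "(2 * (x \<bullet> i - l i)) *\<^sub>R i \<bullet> b = 0" using b by (simp add: inner_not_same_Basis)
      qed
      then have "?y \<bullet> b = x \<bullet> b" by (simp add: inner_diff_left)
      then have "refl_hyp b (l b) ?y = x - (\<Sum>b\<in>insert b S. (2 * (x \<bullet> b - l b)) *\<^sub>R b)"
        using insert by (simp add: refl_hyp_def algebra_simps)
      then show ?case using l[OF b, of ?y] insert by auto
    qed (use that in simp)
  qed
  have central: "2 *\<^sub>R c - x \<in> C" if "x \<in> C" for x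
  proof -
    have "(\<Sum>b\<in>Basis. (2 * (x \<bullet> b - l b)) *\<^sub>R b) = 2 *\<^sub>R ((\<Sum>b\<in>Basis. (x \<bullet> b) *\<^sub>R b) - c)"
      by (simp add: c_def scaleR_diff_right scaleR_right.sum sum_subtractf left_diff_distrib scaleR_left_diff_distrib right_diff_distrib)
    then have "x - (\<Sum>b\<in>Basis. (2 * (x \<bullet> b - l b)) *\<^sub>R b) = 2 *\<^sub>R c - x"
      by (simp add: euclidean_representation scaleR_diff_right scaleR_2)
    then show ?thesis using part[OF order_refl that] by simp
  qed
  have refl: "refl_hyp w (c \<bullet> w) x \<in> C" if w: "norm w = 1" and x: "x \<in> C" for w x
  proof -
    obtain m where m: "\<And>x. x \<in> C \<Longrightarrow> refl_hyp w m x \<in> C" using sym[OF w] by blast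
    have cw: "continuous_on C (\<lambda>x. x \<bullet> w)" by (intro continuous_intros)
    obtain y where y: "y \<in> C" "\<And>z. z \<in> C \<Longrightarrow> z \<bullet> w \<le> y \<bullet> w"
      using continuous_attains_sup[OF C(1) ne cw] by blast
    obtain y' where y': "y' \<in> C" "\<And>z. z \<in> C \<Longrightarrow> y' \<bullet> w \<le> z \<bullet> w"
      using continuous_attains_inf[OF C(1) ne cw] by blast
    \<comment> \<open>Reflection at level \<open>m\<close> followed by the central symmetry shifts
      heights by \<open>2 * (c \<bullet> w - m)\<close>; a nonzero shift would exceed the maximum or
      the minimum.\<close>
    have "(2 *\<^sub>R c - refl_hyp w m y) \<bullet> w \<le> y \<bullet> w" "y' \<bullet> w \<le> (2 *\<^sub>R c - refl_hyp w m y') \<bullet> w"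
      using y y' m central by blast+
    then have "m = c \<bullet> w" by (simp add: inner_diff_left refl_hyp_inner[OF w])
    then show ?thesis using m x by simp
  qed
  have "continuous_on C (\<lambda>x. dist c x)" by (intro continuous_intros)
  then obtain x0 where x0: "x0 \<in> C" "\<And>x. x \<in> C \<Longrightarrow> dist c x \<le> dist c x0"
    using continuous_attains_sup[OF C(1) ne] by blast
  define a where "a = dist c x0"
  have sph: "sphere c a \<subseteq> C"
  proof
    fix y assume y: "y \<in> sphere c a"
    show "y \<in> C"
    proof (cases "y = x0")
      case False
      have "norm (x0 - c) = norm (y - c)" "x0 - c \<noteq> y - c"
        using y False by (auto simp: a_def dist_norm norm_minus_commute)
      then obtain w where w: "norm w = 1" "refl_hyp w 0 (x0 - c) = y - c" using refl_hyp_swap by metis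
      have "refl_hyp w (c \<bullet> w) x0 = c + refl_hyp w 0 (x0 - c)" by (simp add: refl_hyp_def inner_diff_left algebra_simps)
      then show ?thesis using refl[OF w(1) x0(1)] w(2) by simp
    qed (use x0 in simp)
  qed
  have Csub: "C \<subseteq> cball c a" using x0(2) by (auto simp: a_def)
  have a: "0 < a"
  proof (rule ccontr)
    assume "\<not> 0 < a"
    then have "a = 0" by (simp add: a_def)
    then have "C \<subseteq> {c}" using Csub by simp
    then have "interior C \<subseteq> interior {c}" by (rule interior_mono)
    then show False using C(3) by simp
  qed
  have "cball c a \<subseteq> C"
  proof
    fix x assume x: "x \<in> cball c a"
    obtain b :: 'a where b: "b \<in> Basis" using nonempty_Basis by blast
    define e where "e = (if x = c then b else (x - c) /\<^sub>R dist x c)"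
    have e: "norm e = 1" "x = c + dist x c *\<^sub>R e" using b by (auto simp: e_def dist_norm)
    have P: "c + a *\<^sub>R e \<in> C" "c - a *\<^sub>R e \<in> C" using e a by (auto intro!: subsetD[OF sph] simp: dist_norm)
    define s where "s = (a + dist x c) / (2 * a)"
    have s: "0 \<le> s" "s \<le> 1" using x a by (auto simp: s_def dist_commute add_nonneg_nonneg)
    have "s *\<^sub>R (c + a *\<^sub>R e) + (1 - s) *\<^sub>R (c - a *\<^sub>R e) \<in> C" using P s by (intro convexD[OF C(2)]) auto
    also have "s *\<^sub>R (c + a *\<^sub>R e) + (1 - s) *\<^sub>R (c - a *\<^sub>R e) = c + (s - (1 - s)) *\<^sub>R (a *\<^sub>R e)"
      unfolding scaleR_left_diff_distrib[of s "1 - s"] scaleR_right_distrib scaleR_right_diff_distrib scaleR_left_diff_distrib[of 1 s c] by simp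
    also have "(s - (1 - s)) *\<^sub>R (a *\<^sub>R e) = dist x c *\<^sub>R e" using a by (simp add: s_def field_simps)
    finally show "x \<in> C" using e(2) by simp
  qed
  with Csub a show ?thesis by blast
qed

section \<open>Caps of equal volume\<close>

lemma nn_integral_eq_imp_AE_le:
  assumes [measurable]: "f \<in> borel_measurable M" "g \<in> borel_measurable M"
    and le: "\<And>x. f x \<le> g x" and eq: "(\<integral>\<^sup>+x. f x \<partial>M) = (\<integral>\<^sup>+x. g x \<partial>M)" and fin: "(\<integral>\<^sup>+x. g x \<partial>M) < \<infinity>"
  shows "AE x in M. g x \<le> f x"
proof -
  have "(\<integral>\<^sup>+x. g x - f x \<partial>M) = (\<integral>\<^sup>+x. g x \<partial>M) - (\<integral>\<^sup>+x. f x \<partial>M)"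
    by (rule nn_integral_diff) (use le eq fin in auto)
  also have "\<dots> = 0" using eq fin by simp
  finally have "AE x in M. g x - f x = 0" by (simp add: nn_integral_0_iff_AE)
  then show ?thesis by eventually_elim (simp add: diff_eq_0_iff_ennreal)
qed

lemma emeasure_ball_neq_0:
  fixes q :: "'a::euclidean_space"
  assumes "0 < r" shows "emeasure lborel (ball q r) \<noteq> 0"
proof -
  have "0 < unit_ball_vol (real DIM('a))" by (rule unit_ball_vol_pos) simp
  then have "0 < unit_ball_vol (real DIM('a)) * r ^ DIM('a)" using assms by simp
  then show ?thesis using assms by (simp only: emeasure_ball ennreal_eq_0_iff less_imp_le not_le)
qed

text \<open>The image measure is translation invariant and agrees with Lebesgue measure on the unit
  ball, which the linear reflection preserves.\<close>

lemma distr_lborel_refl_hyp: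
  fixes w :: "'a::euclidean_space"
  assumes w: "norm w = 1" shows "distr lborel borel (refl_hyp w l) = lborel"
proof -
  let ?M = "distr lborel borel (refl_hyp w 0)"
  have em: "emeasure ?M B = emeasure lborel (refl_hyp w 0 -` B)" if "B \<in> sets borel" for B
    using that by (subst emeasure_distr) auto
  have vball: "refl_hyp w 0 -` ball 0 r = ball 0 r" for r by (auto simp: norm_refl_hyp[OF w])
  have shift: "emeasure lborel ((\<lambda>x. x + a) -` B) = emeasure lborel B" if [measurable]: "B \<in> sets borel" for a B
    by (subst (2) lborel_distr_plus[of a, symmetric], subst emeasure_distr) (auto simp: vimage_def add.commute)
  have vq: "refl_hyp w 0 -` ball q r \<subseteq> ball (refl_hyp w 0 q) r" for q r
    using dist_refl_hyp[OF w, of 0 "refl_hyp w 0 q"] by (auto simp: refl_hyp_refl_hyp[OF w])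
  have eq: "emeasure ?M B = emeasure lborel B" if B: "B \<in> sets borel" for B
  proof -
    have "emeasure ?M B * emeasure lborel (ball (0::'a) 1) = emeasure lborel B * emeasure ?M (ball 0 1)"
    proof (rule translation_invariant_measure_unique[OF _ _ _ B])
      show "sigma_finite_measure ?M"
      proof (rule sigma_finite_measure_balls[of _ 1])
        fix q
        have "emeasure ?M (ball q 1) \<le> emeasure lborel (ball (refl_hyp w 0 q) 1)"
          using emeasure_mono[OF vq[of q 1], of lborel] by (simp add: em)
        also have "\<dots> < \<infinity>" by (simp add: emeasure_ball)
        finally show "emeasure ?M (ball q 1) < \<infinity>" .
      qed auto
      fix a and B :: "'a set" assume B: "B \<in> sets borel"
      have B': "refl_hyp w 0 -` B \<in> sets borel" using measurable_sets[OF refl_hyp_borel B, of w 0] by simp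
      have "(\<lambda>x. x + a) -` B \<in> sets borel" using measurable_sets[OF _ B, of "\<lambda>x. x + a" borel] by simp
      then have "emeasure ?M ((\<lambda>x. x + a) -` B) = emeasure lborel ((\<lambda>x. x + refl_hyp w 0 a) -` (refl_hyp w 0 -` B))"
        using refl_hyp_refl_hyp[OF w, of 0 a]
        by (simp add: em vimage_def refl_hyp_def algebra_simps)
      then show "emeasure ?M ((\<lambda>x. x + a) -` B) = emeasure ?M B" using B by (simp add: shift[OF B'] em)
    qed simp
    then have "emeasure lborel (ball (0::'a) 1) * emeasure ?M B = emeasure lborel (ball (0::'a) 1) * emeasure lborel B"
      by (simp add: em vball mult.commute)
    then show ?thesis by (subst (asm) ennreal_mult_cancel_left) (use emeasure_ball_neq_0[of 1 "0::'a"] in \<open>auto simp: emeasure_ball\<close>)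
  qed
  have M: "?M = lborel" by (rule measure_eqI) (auto simp: eq)
  have "distr lborel borel (refl_hyp w l) = distr (distr lborel borel (refl_hyp w 0)) borel (\<lambda>x. (2 * l) *\<^sub>R w + x)"
    by (subst distr_distr) (auto simp: o_def refl_hyp_def algebra_simps intro!: arg_cong[where f="distr lborel borel"])
  also have "\<dots> = lborel" unfolding M by (rule lborel_distr_plus)
  finally show ?thesis .
qed

lemma refl_hyp_cap:
  assumes w: "norm w = 1"
  shows "(refl_hyp w l A - refl_hyp w l y) \<bullet> refl_hyp w 0 \<nu> = (A - y) \<bullet> \<nu>"
  by (simp add: refl_hyp_diff refl_hyp_inner_refl_hyp[OF w])

text \<open>After the change of variables by the reflection, the comparison of half caps becomes the
  pointwise statement that a point in front whose mirror image lies in \<open>C\<close> is itself in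
  \<open>C\<close>.\<close>

lemma equal_volume_caps_imp_ball:
  fixes C :: "'a::euclidean_space set"
  assumes body: "convex_body C" and \<epsilon>: "0 < \<epsilon>"
    and V: "\<And>p u t. outer_normal C p u \<Longrightarrow> 0 < t \<Longrightarrow> t < \<epsilon> \<Longrightarrow> emeasure lborel {x\<in>C. (p - x) \<bullet> u \<le> t} = ennreal (f t)"
  shows "\<exists>c a. a > 0 \<and> C = cball c a"
proof -
  interpret convex_body C by fact
  have Cm[measurable]: "C \<in> sets borel" using closed by simp
  define \<mu> where "\<mu> = density lborel (indicator C :: 'a \<Rightarrow> ennreal)"
  have sets\<mu> [measurable_cong, simp]: "sets \<mu> = sets borel" by (simp add: \<mu>_def)
  have em: "emeasure \<mu> B = emeasure lborel (C \<inter> B)" if [measurable]: "B \<in> sets borel" for B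
    unfolding \<mu>_def by (subst emeasure_density) (auto simp flip: indicator_inter_arith)
  have nn: "(\<integral>\<^sup>+x. g x \<partial>\<mu>) = (\<integral>\<^sup>+x. indicator C x * g x \<partial>lborel)" if [measurable]: "g \<in> borel_measurable borel" for g
    unfolding \<mu>_def by (subst nn_integral_density) auto
  have fC: "emeasure lborel C < \<infinity>" using emeasure_bounded_finite[OF bounded] .
  have fm: "finite_measure \<mu>"
  proof
    show "emeasure \<mu> (space \<mu>) \<noteq> \<infinity>" using fC em[of UNIV] by (simp add: \<mu>_def)
  qed
  interpret finite_measure \<mu> by (rule fm)
  define KI where "KI A \<nu> t = (indicator {x. (A - x) \<bullet> \<nu> \<le> t} :: 'a \<Rightarrow> ennreal)" for A \<nu> t
  have KIm [measurable]: "KI A \<nu> t \<in> borel_measurable borel" for A \<nu> t unfolding KI_def by measurable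
  have lhs: "(\<integral>\<^sup>+x. KI (refl_hyp w l A) (refl_hyp w 0 \<nu>) t x * ennreal (x \<bullet> w - l) \<partial>\<mu>)
     = (\<integral>\<^sup>+y. indicator C (refl_hyp w l y) * (KI A \<nu> t y * ennreal (l - y \<bullet> w)) \<partial>lborel)"
    if w: "norm w = 1" for w l A \<nu> t
  proof -
    have "(\<integral>\<^sup>+x. KI (refl_hyp w l A) (refl_hyp w 0 \<nu>) t x * ennreal (x \<bullet> w - l) \<partial>\<mu>)
       = (\<integral>\<^sup>+x. indicator C x * (KI (refl_hyp w l A) (refl_hyp w 0 \<nu>) t x * ennreal (x \<bullet> w - l)) \<partial>distr lborel borel (refl_hyp w l))"
      unfolding distr_lborel_refl_hyp[OF w] by (rule nn) measurable
    also have "\<dots> = (\<integral>\<^sup>+y. indicator C (refl_hyp w l y) * (KI (refl_hyp w l A) (refl_hyp w 0 \<nu>) t (refl_hyp w l y) * ennreal (refl_hyp w l y \<bullet> w - l)) \<partial>lborel)"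
      by (rule nn_integral_distr) measurable
    also have "\<dots> = (\<integral>\<^sup>+y. indicator C (refl_hyp w l y) * (KI A \<nu> t y * ennreal (l - y \<bullet> w)) \<partial>lborel)"
      by (rule nn_integral_cong) (simp add: KI_def indicator_def refl_hyp_cap[OF w] refl_hyp_inner[OF w])
    finally show ?thesis .
  qed
  have rhs: "(\<integral>\<^sup>+x. KI A \<nu> t x * ennreal (l - x \<bullet> w) \<partial>\<mu>) = (\<integral>\<^sup>+y. indicator C y * (KI A \<nu> t y * ennreal (l - y \<bullet> w)) \<partial>lborel)"
    for w l A \<nu> t by (rule nn) measurable
  have le: "indicator C (refl_hyp w l y) * (KI A \<nu> t y * ennreal (l - y \<bullet> w)) \<le> indicator C y * (KI A \<nu> t y * ennreal (l - y \<bullet> w))"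
    if w: "norm w = 1" and half: "\<And>x. x \<in> C \<Longrightarrow> l \<le> x \<bullet> w \<Longrightarrow> refl_hyp w l x \<in> C" for w l A \<nu> t y
  proof (cases "refl_hyp w l y \<in> C \<and> y \<bullet> w < l")
    case True
    then have "refl_hyp w l (refl_hyp w l y) \<in> C" by (rule_tac half) (auto simp: refl_hyp_inner[OF w])
    then show ?thesis using True by (simp add: refl_hyp_refl_hyp[OF w])
  qed (auto simp: indicator_def ennreal_neg)
  \<comment> \<open>\<open>f\<close> may be negative, where \<open>ennreal\<close> truncates to
    zero; the real-valued mass of a cap is the truncated function.\<close>
  have ebody: "equal_caps_body \<mu> C f' \<epsilon>" if f': "f' = (\<lambda>t. enn2real (ennreal (f t)))" for f'
  proof unfold_locales
    show "AE x in \<mu>. x \<in> C" unfolding \<mu>_def by (subst AE_density) (auto simp: indicator_def)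
    show "measure \<mu> {x. (p - x) \<bullet> u \<le> t} = f' t" if "outer_normal C p u" "0 < t" "t < \<epsilon>" for p u t
    proof -
      have "emeasure \<mu> {x. (p - x) \<bullet> u \<le> t} = ennreal (f t)"
        using V[OF that] by (subst em) (auto simp: Int_def)
      then show ?thesis by (simp add: measure_def f')
    qed
    fix w A \<nu> :: 'a and l t :: real
    assume w: "norm w = 1" and half: "\<And>x. x \<in> C \<Longrightarrow> l \<le> x \<bullet> w \<Longrightarrow> refl_hyp w l x \<in> C"
    note le' = le[OF w half, where A=A and \<nu>=\<nu> and t=t]
    show "(\<integral>\<^sup>+x. indicator {x. (refl_hyp w l A - x) \<bullet> refl_hyp w 0 \<nu> \<le> t} x * ennreal (x \<bullet> w - l) \<partial>\<mu>)
        \<le> (\<integral>\<^sup>+x. indicator {x. (A - x) \<bullet> \<nu> \<le> t} x * ennreal (l - x \<bullet> w) \<partial>\<mu>)"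
      unfolding KI_def[symmetric] lhs[OF w] rhs by (intro nn_integral_mono le')
    fix q
    assume "(\<integral>\<^sup>+x. indicator {x. (refl_hyp w l A - x) \<bullet> refl_hyp w 0 \<nu> \<le> t} x * ennreal (x \<bullet> w - l) \<partial>\<mu>)
        = (\<integral>\<^sup>+x. indicator {x. (A - x) \<bullet> \<nu> \<le> t} x * ennreal (l - x \<bullet> w) \<partial>\<mu>)"
      and q: "q \<in> frontier C" "q \<bullet> w < l" "(A - q) \<bullet> \<nu> < t"
    then have eq: "(\<integral>\<^sup>+y. indicator C (refl_hyp w l y) * (KI A \<nu> t y * ennreal (l - y \<bullet> w)) \<partial>lborel)
       = (\<integral>\<^sup>+y. indicator C y * (KI A \<nu> t y * ennreal (l - y \<bullet> w)) \<partial>lborel)"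
      unfolding KI_def[symmetric] lhs[OF w] rhs by blast
    have cw: "continuous_on C (\<lambda>y. l - y \<bullet> w)" by (intro continuous_intros)
    have "bounded ((\<lambda>y. l - y \<bullet> w) ` C)" by (intro compact_imp_bounded compact_continuous_image cw compact)
    then obtain B where B: "\<And>y. y \<in> C \<Longrightarrow> \<bar>l - y \<bullet> w\<bar> \<le> B" unfolding bounded_iff by auto
    have "(\<integral>\<^sup>+y. indicator C y * (KI A \<nu> t y * ennreal (l - y \<bullet> w)) \<partial>lborel) \<le> (\<integral>\<^sup>+y. ennreal B * indicator C y \<partial>lborel)"
      by (rule nn_integral_mono) (use B in \<open>auto simp: indicator_def KI_def abs_le_iff intro!: ennreal_leI\<close>)
    also have "\<dots> = ennreal B * emeasure lborel C" by (rule nn_integral_cmult_indicator) simp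
    also have "\<dots> < \<infinity>" using fC by (simp add: ennreal_mult_less_top)
    finally have fin: "(\<integral>\<^sup>+y. indicator C y * (KI A \<nu> t y * ennreal (l - y \<bullet> w)) \<partial>lborel) < \<infinity>" .
    have AE: "AE y in lborel. indicator C y * (KI A \<nu> t y * ennreal (l - y \<bullet> w)) \<le> indicator C (refl_hyp w l y) * (KI A \<nu> t y * ennreal (l - y \<bullet> w))"
      by (rule nn_integral_eq_imp_AE_le[OF _ _ le' eq fin]) measurable
    show "refl_hyp w l q \<in> C"
    proof (rule ccontr)
      assume q': "refl_hyp w l q \<notin> C"
      \<comment> \<open>\<open>q\<close> is only a frontier point, but the failure at
        \<open>q\<close> is an open condition and persists at nearby interior points, that is, on a
        set of positive volume.\<close>
      define U where "U = {y. y \<bullet> w < l} \<inter> {y. (A - y) \<bullet> \<nu> < t} \<inter> refl_hyp w l -` (- C) \<inter> interior C"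
      have oR: "open (refl_hyp w l -` (- C))"
        by (intro open_vimage continuous_on_refl_hyp open_Compl closed)
      have oV: "open ({y. y \<bullet> w < l} \<inter> {y. (A - y) \<bullet> \<nu> < t} \<inter> refl_hyp w l -` (- C))"
        by (intro open_Int oR open_Collect_less continuous_intros)
      then have oU: "open U" unfolding U_def by blast
      have "q \<in> closure (interior C)" using q(1) frontier_subset closure_interior by auto
      then have "U \<noteq> {}" unfolding U_def
        using open_Int_closure_eq_empty[OF oV, of "interior C"] q q' by auto
      then obtain x where "x \<in> U" by blast
      then obtain e where e: "0 < e" "ball x e \<subseteq> U" using oU openE by blast
      have "AE y in lborel. y \<notin> U"
        using AE
      proof eventually_elim
        fix y assume *: "indicator C y * (KI A \<nu> t y * ennreal (l - y \<bullet> w)) \<le> indicator C (refl_hyp w l y) * (KI A \<nu> t y * ennreal (l - y \<bullet> w))"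
        show "y \<notin> U"
        proof
          assume "y \<in> U"
          then have "y \<in> C" "refl_hyp w l y \<notin> C" "y \<bullet> w < l" "(A - y) \<bullet> \<nu> \<le> t"
            using interior_subset by (auto simp: U_def)
          then show False using * by (simp add: KI_def ennreal_eq_0_iff)
        qed
      qed
      then have "emeasure lborel U = 0" using oU by (subst (asm) AE_iff_measurable[of U]) auto
      moreover have "emeasure lborel (ball x e) \<le> emeasure lborel U" using e oU by (intro emeasure_mono) auto
      ultimately show False using emeasure_ball_neq_0[OF e(1), of x] by simp
    qed
  qed (use compact convex interior_nonempty \<epsilon> in auto)
  have "\<exists>l. \<forall>x\<in>C. refl_hyp w l x \<in> C" if "norm w = 1" for w
    using equal_caps_body.symmetric_in_direction[OF ebody[OF refl] that] .
  then show ?thesis by (rule symmetric_imp_ball[OF compact convex interior_nonempty])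
qed

section \<open>Surface area of caps\<close>

text \<open>Pairs of contact points with \<open>m \<bullet> u \<le> 0\<close> form a compact set, on
  which the depth attains its minimum. The minimum is positive: at depth zero \<open>u\<close> would
  be a normal at \<open>x\<close> too, hence equal to \<open>m\<close>. The bound keeps points in a
  cap when they are pushed along mirrored normals.\<close>

lemma (in convex_body) normals_in_small_caps:
  obtains \<delta> where "0 < \<delta>"
    "\<And>p u x m. outer_normal C p u \<Longrightarrow> outer_normal C x m \<Longrightarrow> (p - x) \<bullet> u < \<delta> \<Longrightarrow> 0 \<le> m \<bullet> u"
proof -
  define T where "T = {(p, u, x, m). outer_normal C p u \<and> outer_normal C x m \<and> m \<bullet> u \<le> 0}"
  have "T = {z. outer_normal C (fst z) (fst (snd z))} \<inter> {z. outer_normal C (fst (snd (snd z))) (snd (snd (snd z)))}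
      \<inter> {z. snd (snd (snd z)) \<bullet> fst (snd z) \<le> 0}"
    by (auto simp: T_def)
  then have "closed T"
    by (simp only:) (intro closed_Int closed_outer_normal closed closed_Collect_le continuous_intros)
  moreover have "bounded T"
  proof (rule bounded_subset)
    show "bounded (C \<times> sphere (0::'a) 1 \<times> C \<times> sphere (0::'a) 1)"
      by (intro bounded_Times bounded bounded_sphere)
    show "T \<subseteq> C \<times> sphere 0 1 \<times> C \<times> sphere 0 1" by (auto simp: T_def outer_normal_def)
  qed
  ultimately have T: "compact T" by (simp add: compact_eq_bounded_closed)
  show ?thesis
  proof (cases "T = {}")
    case True
    have "0 \<le> m \<bullet> u" if "outer_normal C p u" "outer_normal C x m" for p u x m
    proof (rule ccontr)
      assume "\<not> ?thesis" then have "(p, u, x, m) \<in> T" using that by (auto simp: T_def)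
      then show False using True by simp
    qed
    then show ?thesis using that[of 1] by simp
  next
    case False
    have "continuous_on T (\<lambda>z. (fst z - fst (snd (snd z))) \<bullet> fst (snd z))" by (intro continuous_intros)
    then obtain z where z: "z \<in> T"
      "\<And>y. y \<in> T \<Longrightarrow> (fst z - fst (snd (snd z))) \<bullet> fst (snd z) \<le> (fst y - fst (snd (snd y))) \<bullet> fst (snd y)"
      using continuous_attains_inf[OF T False] by blast
    obtain p u x m where zz: "z = (p, u, x, m)" by (cases z) auto
    define \<delta> where "\<delta> = (p - x) \<bullet> u"
    have on: "outer_normal C p u" "outer_normal C x m" "m \<bullet> u \<le> 0" using z(1) by (auto simp: zz T_def)
    have "0 < \<delta>"
    proof (rule ccontr)
      assume "\<not> 0 < \<delta>"
      then have xp: "(p - x) \<bullet> u \<le> 0" by (simp add: \<delta>_def)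
      have "(y - x) \<bullet> u \<le> 0" if "y \<in> C" for y
        using outer_normalD(4)[OF on(1) that] xp by (simp add: inner_diff_left)
      then have "outer_normal C x u" using on by (auto simp: outer_normal_def)
      then have "u = m" using unique_normal on(2) by blast
      then show False using on(3) outer_normalD(3)[OF on(1)] by simp
    qed
    moreover have "0 \<le> m' \<bullet> u'" if "outer_normal C p' u'" "outer_normal C x' m'" "(p' - x') \<bullet> u' < \<delta>" for p' u' x' m'
    proof (rule ccontr)
      assume "\<not> ?thesis"
      then have "(p', u', x', m') \<in> T" using that by (auto simp: T_def)
      from z(2)[OF this] show False using that(3) by (simp add: zz \<delta>_def)
    qed
    ultimately show ?thesis using that by blast
  qed
qed

lemma hausdorff_measure_projection:
  fixes u :: "'a::euclidean_space"
  assumes u: "norm u = 1" and B: "B \<subseteq> (\<lambda>x. x - (x \<bullet> u) *\<^sub>R u + a) ` A"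
  shows "hausdorff_measure d B \<le> hausdorff_measure d A"
proof (rule hausdorff_measure_lipschitz_image[OF _ B])
  fix x y
  have uu: "u \<bullet> u = 1" using u by (simp add: dot_square_norm)
  have "norm ((x - y) - ((x - y) \<bullet> u) *\<^sub>R u) ^ 2 = norm (x - y) ^ 2 - ((x - y) \<bullet> u)^2"
    unfolding power2_norm_eq_inner using uu
    by (simp only: inner_diff_left[of "x - y" "((x - y) \<bullet> u) *\<^sub>R u"] inner_diff_right[of _ "x - y" "((x - y) \<bullet> u) *\<^sub>R u"]
        inner_scaleR_left inner_scaleR_right inner_commute[of u "x - y"]) (simp add: power2_eq_square)
  then have "norm ((x - y) - ((x - y) \<bullet> u) *\<^sub>R u) \<le> norm (x - y)"
    by (rule_tac power2_le_imp_le) auto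
  moreover have "(x - (x \<bullet> u) *\<^sub>R u + a) - (y - (y \<bullet> u) *\<^sub>R u + a) = (x - y) - ((x - y) \<bullet> u) *\<^sub>R u"
    by (simp add: inner_diff_left scaleR_left_diff_distrib)
  ultimately show "dist (x - (x \<bullet> u) *\<^sub>R u + a) (y - (y \<bullet> u) *\<^sub>R u + a) \<le> dist x y"
    by (simp only: dist_norm)
qed

text \<open>Along the ray from an interior point through \<open>q\<close>, a point just before
  \<open>q\<close> is interior and one just after it is outside. Parallel segments near
  \<open>q\<close> therefore cross the frontier within \<open>U\<close>, and this piece projects
  onto a disc.\<close>

lemma hausdorff_measure_frontier_pos:
  fixes C :: "'a::euclidean_space set"
  assumes n: "DIM('a) = Suc n" "0 < n" and C: "convex C" "closed C" "interior C \<noteq> {}"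
    and q: "q \<in> frontier C" and U: "open U" "q \<in> U"
  shows "0 < hausdorff_measure n (frontier C \<inter> U)"
proof -
  obtain z where z: "z \<in> interior C" using C(3) by blast
  have qz: "q \<noteq> z" using q z by (auto simp: frontier_def)
  have qC: "q \<in> C" using q frontier_subset_closed[OF C(2)] by blast
  define D where "D = norm (q - z)"
  have D: "0 < D" using qz by (simp add: D_def)
  define e where "e = (q - z) /\<^sub>R D"
  have e: "norm e = 1" "q = z + D *\<^sub>R e" using D by (auto simp: e_def D_def)
  have ee: "e \<bullet> e = 1" using e by (simp add: dot_square_norm)
  obtain \<eta> where \<eta>: "0 < \<eta>" "ball q \<eta> \<subseteq> U" using U openE by blast
  define s where "s = min (\<eta>/2) (D/2)"
  have s: "0 < s" "s \<le> \<eta>/2" "s < D" using \<eta> D by (auto simp: s_def)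
  have "q - s *\<^sub>R e \<in> interior C"
  proof -
    have "q - s *\<^sub>R e = (s/D) *\<^sub>R z + (1 - s/D) *\<^sub>R q"
      using D by (simp add: e_def algebra_simps divide_inverse)
    moreover have "q - (s/D) *\<^sub>R (q - z) \<in> interior C"
      by (rule mem_interior_convex_shrink[OF C(1) z qC]) (use s D in auto)
    ultimately show ?thesis by (simp add: algebra_simps)
  qed
  then obtain r1 where r1: "0 < r1" "ball (q - s *\<^sub>R e) r1 \<subseteq> C"
    by (meson mem_interior)
  have "q + s *\<^sub>R e \<notin> C"
  proof
    assume *: "q + s *\<^sub>R e \<in> C"
    have "(q + s *\<^sub>R e) - (s/(D+s)) *\<^sub>R ((q + s *\<^sub>R e) - z) \<in> interior C"
      by (rule mem_interior_convex_shrink[OF C(1) z *]) (use s D in auto)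
    moreover have "(q + s *\<^sub>R e) - z = (D + s) *\<^sub>R e" using e(2) by (simp add: algebra_simps)
    ultimately have "q \<in> interior C" using s D by simp
    then show False using q by (simp add: frontier_def)
  qed
  then obtain r2 where r2: "0 < r2" "ball (q + s *\<^sub>R e) r2 \<subseteq> - C"
    using openE[of "- C" "q + s *\<^sub>R e"] C(2) by auto
  define r where "r = min (min r1 r2) (\<eta>/2)"
  have r: "0 < r" "r \<le> r1" "r \<le> r2" "r \<le> \<eta>/2" using r1 r2 \<eta> by (auto simp: r_def)
  have "disc e r \<subseteq> (\<lambda>x. x - (x \<bullet> e) *\<^sub>R e + ((q \<bullet> e) *\<^sub>R e - q)) ` (frontier C \<inter> U)"
  proof
    fix y assume y: "y \<in> disc e r"
    then have ye: "y \<bullet> e = 0" "norm y < r" by (auto simp: disc_def)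
    have a: "q - s *\<^sub>R e + y \<in> C" using ye r by (intro subsetD[OF r1(2)]) (simp add: dist_norm)
    have b: "q + s *\<^sub>R e + y \<in> - C" using ye r by (intro subsetD[OF r2(2)]) (simp add: dist_norm)
    have "closed_segment (q - s *\<^sub>R e + y) (q + s *\<^sub>R e + y) \<inter> frontier C \<noteq> {}"
      by (rule connected_Int_frontier[OF connected_segment]) (use a b in auto)
    then obtain x where x: "x \<in> closed_segment (q - s *\<^sub>R e + y) (q + s *\<^sub>R e + y)" "x \<in> frontier C" by blast
    then obtain t where t: "0 \<le> t" "t \<le> 1" "x = (1 - t) *\<^sub>R (q - s *\<^sub>R e + y) + t *\<^sub>R (q + s *\<^sub>R e + y)"
      by (auto simp: in_segment)
    define c where "c = t * s - (1 - t) * s"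
    have "x = ((1 - t) + t) *\<^sub>R (q + y) + c *\<^sub>R e"
      unfolding t(3) c_def scaleR_left_distrib[of "1 - t" t] scaleR_left_diff_distrib[of "t * s"]
        scaleR_right_distrib scaleR_right_diff_distrib scaleR_scaleR by (simp add: scaleR_left_diff_distrib)
    then have xe: "x = q + y + c *\<^sub>R e" by simp
    have "0 \<le> t * s" "t * s \<le> 1 * s" using t s by (auto intro: mult_right_mono)
    then have "\<bar>c\<bar> \<le> s" unfolding c_def left_diff_distrib abs_le_iff by linarith
    then have "norm (y + c *\<^sub>R e) < \<eta>"
      using norm_triangle_ineq[of y "c *\<^sub>R e"] ye(2) r(4) s(2) e(1) by simp
    then have "dist x q < \<eta>" by (simp add: xe dist_norm add.assoc)
    then have "x \<in> U" by (intro subsetD[OF \<eta>(2)]) (simp add: dist_commute)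
    moreover have "y = x - (x \<bullet> e) *\<^sub>R e + ((q \<bullet> e) *\<^sub>R e - q)"
      using ye ee by (simp add: xe inner_add_left algebra_simps)
    ultimately show "y \<in> (\<lambda>x. x - (x \<bullet> e) *\<^sub>R e + ((q \<bullet> e) *\<^sub>R e - q)) ` (frontier C \<inter> U)"
      using x(2) by blast
  qed
  then have "hausdorff_measure n (disc e r) \<le> hausdorff_measure n (frontier C \<inter> U)"
    by (rule hausdorff_measure_projection[OF e(1)])
  moreover have "0 < hausdorff_measure n (disc e r)"
    by (rule hausdorff_measure_disc_pos[OF n e(1) r(1)])
  ultimately show ?thesis by (rule less_le_trans[rotated])
qed

lemma closest_point_outer_normal:
  fixes C :: "'a::euclidean_space set"
  assumes C: "convex C" "closed C" and m: "outer_normal C x m" and s: "0 \<le> s"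
  shows "closest_point C (x + s *\<^sub>R m) = x"
proof (rule closest_point_unique[symmetric, OF C])
  show "x \<in> C" using outer_normalD(1)[OF m] .
  show "\<forall>z\<in>C. dist (x + s *\<^sub>R m) x \<le> dist (x + s *\<^sub>R m) z"
  proof
    fix z assume z: "z \<in> C"
    have "s ^ 2 \<le> norm (s *\<^sub>R m - (z - x)) ^ 2"
    proof -
      have le: "s *\<^sub>R m \<bullet> (z - x) \<le> 0"
        using outer_normalD(4)[OF m z] s by (simp add: mult_nonneg_nonpos inner_commute)
      have nm: "norm (s *\<^sub>R m) = s" using outer_normalD(2)[OF m] s by simp
      have "norm (s *\<^sub>R m - (z - x)) ^ 2 = s^2 + norm (z - x) ^ 2 - 2 * (s *\<^sub>R m \<bullet> (z - x))"
        using dot_norm_neg[of "s *\<^sub>R m" "z - x", unfolded nm] by argo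
      then show ?thesis using le zero_le_power2[of "norm (z - x)"] by linarith
    qed
    then have "s \<le> norm (s *\<^sub>R m - (z - x))" by (rule power2_le_imp_le) simp
    moreover have "dist (x + s *\<^sub>R m) z = norm (s *\<^sub>R m - (z - x))" by (simp add: dist_norm algebra_simps)
    moreover have "dist (x + s *\<^sub>R m) x = s" using outer_normalD(2)[OF m] s by (simp add: dist_norm)
    ultimately show "dist (x + s *\<^sub>R m) x \<le> dist (x + s *\<^sub>R m) z" by simp
  qed
qed

text \<open>The nearest point projection of the reflected surface onto \<open>C\<close> does not increase area,
  and it moves points towards the hyperplane.\<close>

lemma (in convex_body) closest_point_refl_hyp_inner:
  assumes w: "norm w = 1" and half: "\<And>x. x \<in> C \<Longrightarrow> l \<le> x \<bullet> w \<Longrightarrow> refl_hyp w l x \<in> C"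
    and q: "q \<in> C" "q \<bullet> w < l"
  defines "x \<equiv> closest_point C (refl_hyp w l q)"
  shows "x \<bullet> w - l \<le> l - q \<bullet> w" "refl_hyp w l q \<notin> C \<Longrightarrow> x \<bullet> w - l < l - q \<bullet> w"
proof -
  define z where "z = refl_hyp w l q"
  have zw: "z \<bullet> w = 2 * l - q \<bullet> w" by (simp add: z_def refl_hyp_inner[OF w])
  have qz: "q = z - (2 * (z \<bullet> w - l)) *\<^sub>R w"
    using refl_hyp_refl_hyp[OF w, of l q] by (simp add: z_def refl_hyp_def[of w l "refl_hyp w l q"])
  have xC: "x \<in> C" unfolding x_def by (rule closest_point_in_set[OF closed nonempty])
  have dot: "(z - x) \<bullet> (y - x) \<le> 0" if "y \<in> C" for y
    unfolding x_def z_def by (rule closest_point_dot[OF convex closed that])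
  have strict: "x \<bullet> w - l < l - q \<bullet> w" if "z \<notin> C"
  proof (cases "x \<bullet> w \<le> l")
    case False
    \<comment> \<open>The mirror image of \<open>x\<close> serves as competitor in the variational
      inequality of the nearest point; the equality case is excluded further down by the competitor
      \<open>q\<close>.\<close>
    have "(z - x) \<bullet> (refl_hyp w l x - x) \<le> 0" by (rule dot[OF half]) (use xC False in auto)
    then have "0 \<le> (2 * (x \<bullet> w - l)) * ((z - x) \<bullet> w)" by (simp add: refl_hyp_def)
    then have ge: "0 \<le> (z - x) \<bullet> w" using False by (simp add: zero_le_mult_iff)
    moreover have "(z - x) \<bullet> w \<noteq> 0"
    proof
      assume 0: "(z - x) \<bullet> w = 0"
      have "q - x = (z - x) - (2 * (z \<bullet> w - l)) *\<^sub>R w" by (subst qz) simp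
      then have "(z - x) \<bullet> (q - x) = (z - x) \<bullet> (z - x)" using 0 by (simp only: inner_diff_right[of _ "z - x"] inner_scaleR_right mult_zero_right diff_zero)
      then have "(z - x) \<bullet> (z - x) \<le> 0" using dot[OF q(1)] by simp
      then have "z = x" using inner_ge_zero[of "z - x"] by (metis antisym inner_eq_zero_iff right_minus_eq)
      then show False using xC that by simp
    qed
    ultimately show ?thesis using zw by (simp add: inner_diff_left)
  qed (use q in simp)
  then show "refl_hyp w l q \<notin> C \<Longrightarrow> x \<bullet> w - l < l - q \<bullet> w" by (simp add: z_def)
  show "x \<bullet> w - l \<le> l - q \<bullet> w"
  proof (cases "z \<in> C")
    case True
    then have "x = z" by (simp add: x_def z_def closest_point_self)
    then show ?thesis using zw by simp
  qed (use strict in simp)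
qed

text \<open>A frontier point \<open>x\<close> of the far half cap with normal \<open>m\<close> is
  mirrored into \<open>C\<close>, and from there the mirrored normal leads to a frontier point
  \<open>q\<close>. The mirror image of \<open>q\<close> is \<open>x + s *\<^sub>R m\<close>, whose
  nearest point is \<open>x\<close>. So the 1-Lipschitz map covers the far half cap from the near
  one. The arbitrary set \<open>B\<close> makes this an inequality of measures, which can be
  integrated against weights.\<close>

lemma (in convex_body) hausdorff_measure_reflected_cap:
  assumes w: "norm w = 1" and half: "\<And>x. x \<in> C \<Longrightarrow> l \<le> x \<bullet> w \<Longrightarrow> refl_hyp w l x \<in> C"
    and A: "outer_normal C A \<nu>" and P: "outer_normal C (refl_hyp w l A) (refl_hyp w 0 \<nu>)"
    and t: "t < \<delta>" and \<delta>: "\<And>p u x m. outer_normal C p u \<Longrightarrow> outer_normal C x m \<Longrightarrow> (p - x) \<bullet> u < \<delta> \<Longrightarrow> 0 \<le> m \<bullet> u"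
  shows "hausdorff_measure d ({x\<in>frontier C. (refl_hyp w l A - x) \<bullet> refl_hyp w 0 \<nu> \<le> t \<and> l < x \<bullet> w} \<inter> B)
    \<le> hausdorff_measure d ({q\<in>frontier C. (A - q) \<bullet> \<nu> \<le> t \<and> q \<bullet> w < l} \<inter> (\<lambda>q. closest_point C (refl_hyp w l q)) -` B)"
    (is "hausdorff_measure d ?X \<le> hausdorff_measure d ?X'")
proof (rule hausdorff_measure_lipschitz_image[where f="\<lambda>q. closest_point C (refl_hyp w l q)"])
  show "dist (closest_point C (refl_hyp w l x)) (closest_point C (refl_hyp w l y)) \<le> dist x y" for x y
    using closest_point_lipschitz[OF convex closed nonempty, of "refl_hyp w l x" "refl_hyp w l y"]
    by (simp add: dist_refl_hyp[OF w])
  show "?X \<subseteq> (\<lambda>q. closest_point C (refl_hyp w l q)) ` ?X'"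
  proof
    fix x assume "x \<in> ?X"
    then have x: "x \<in> frontier C" "(refl_hyp w l A - x) \<bullet> refl_hyp w 0 \<nu> \<le> t" "l < x \<bullet> w" "x \<in> B" by auto
    obtain m where m: "outer_normal C x m" using exists_outer_normal[OF convex closed interior_nonempty x(1)] by blast
    \<comment> \<open>This sign keeps \<open>q\<close> within the depth \<open>t\<close>; the sign
      of \<open>w \<bullet> m\<close> below keeps it in front of the hyperplane.\<close>
    have mu: "0 \<le> m \<bullet> refl_hyp w 0 \<nu>" by (rule \<delta>[OF P m]) (use x(2) t in simp)
    have rx: "refl_hyp w l x \<in> C" using half x frontier_subset by auto
    have "(refl_hyp w l x - x) \<bullet> m \<le> 0" by (rule outer_normalD(4)[OF m rx])
    then have "0 \<le> (2 * (x \<bullet> w - l)) * (w \<bullet> m)" by (simp add: refl_hyp_def)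
    then have mw: "0 \<le> w \<bullet> m" using x(3) by (simp add: zero_le_mult_iff)
    have "\<exists>s\<ge>0. refl_hyp w l x + s *\<^sub>R refl_hyp w 0 m \<in> frontier C"
    proof (cases "refl_hyp w l x \<in> interior C")
      case True
      have "norm (refl_hyp w 0 m) = 1" using norm_refl_hyp[OF w] outer_normalD(2)[OF m] by simp
      then show ?thesis using reach[OF True, of "refl_hyp w 0 m"] by (meson less_imp_le)
    next
      case False
      then have "refl_hyp w l x \<in> frontier C" using rx closure_subset by (auto simp: frontier_def)
      then show ?thesis by (intro exI[of _ 0]) simp
    qed
    then obtain s where s: "0 \<le> s" "refl_hyp w l x + s *\<^sub>R refl_hyp w 0 m \<in> frontier C" by blast
    define q where "q = refl_hyp w l x + s *\<^sub>R refl_hyp w 0 m"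
    have "q = refl_hyp w l (x + s *\<^sub>R m)"
      by (simp add: q_def refl_hyp_def inner_add_left algebra_simps)
    then have rq: "refl_hyp w l q = x + s *\<^sub>R m" by (simp add: refl_hyp_refl_hyp[OF w])
    have "q \<bullet> w = 2 * l - refl_hyp w l q \<bullet> w" using refl_hyp_inner[OF w, of l q] by simp
    also have "\<dots> = 2 * l - x \<bullet> w - s * (w \<bullet> m)" by (simp add: rq inner_add_left inner_commute[of w m])
    also have "\<dots> < l" using x(3) mult_nonneg_nonneg[OF s(1) mw] by simp
    finally have qw: "q \<bullet> w < l" .
    have "(A - q) \<bullet> \<nu> = (refl_hyp w l A - (x + s *\<^sub>R m)) \<bullet> refl_hyp w 0 \<nu>"
      using refl_hyp_cap[OF w, of l A q \<nu>] by (simp add: rq)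
    also have "\<dots> = (refl_hyp w l A - x) \<bullet> refl_hyp w 0 \<nu> - s * (m \<bullet> refl_hyp w 0 \<nu>)"
      by (simp only: inner_diff_left inner_add_left inner_scaleR_left)
    also have "\<dots> \<le> t" using x(2) mult_nonneg_nonneg[OF s(1) mu] by simp
    finally have "(A - q) \<bullet> \<nu> \<le> t" .
    moreover have cp: "closest_point C (refl_hyp w l q) = x"
      unfolding rq by (rule closest_point_outer_normal[OF convex closed m s(1)])
    ultimately have "q \<in> ?X'" using s(2) qw x(4) by (simp add: q_def[symmetric])
    then show "x \<in> (\<lambda>q. closest_point C (refl_hyp w l q)) ` ?X'" using cp by (rule_tac image_eqI) auto
  qed
qed

text \<open>The comparison is a chain of two inequalities: the far half cap is dominated by the
  image of the near one under \<open>\<tau>\<close>, and \<open>\<tau>\<close> does not increase the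
  distance to the hyperplane. The second is strict wherever the mirror image leaves
  \<open>C\<close>, and relatively open pieces of the frontier have positive area.\<close>

lemma equal_surface_caps_imp_ball:
  fixes C :: "'a::euclidean_space set"
  assumes n: "DIM('a) = Suc n" "0 < n" and body: "convex_body C" and \<epsilon>: "0 < \<epsilon>"
    and S: "\<And>p u t. outer_normal C p u \<Longrightarrow> 0 < t \<Longrightarrow> t < \<epsilon> \<Longrightarrow>
      hausdorff_measure n {x\<in>frontier C. (p - x) \<bullet> u \<le> t} = ennreal (f t)"
  shows "\<exists>c a. a > 0 \<and> C = cball c a"
proof -
  interpret convex_body C by fact
  obtain \<delta> where \<delta>: "0 < \<delta>"
    "\<And>p u x m. outer_normal C p u \<Longrightarrow> outer_normal C x m \<Longrightarrow> (p - x) \<bullet> u < \<delta> \<Longrightarrow> 0 \<le> m \<bullet> u"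
    using normals_in_small_caps by blast
  define \<epsilon>' where "\<epsilon>' = min \<epsilon> \<delta>"
  have \<epsilon>': "0 < \<epsilon>'" "\<epsilon>' \<le> \<epsilon>" "\<epsilon>' \<le> \<delta>" using \<epsilon> \<delta>(1) by (auto simp: \<epsilon>'_def)
  let ?H = "hausdorff_measure n :: 'a set \<Rightarrow> ennreal"
  define h where "h = (hausdorff_borel n :: 'a measure)"
  have setsh [measurable_cong, simp]: "sets h = sets borel" and spaceh [simp]: "space h = UNIV" by (simp_all add: h_def)
  have emh: "emeasure h B = ?H B" if "B \<in> sets borel" for B
    unfolding h_def by (rule emeasure_hausdorff_borel[OF n(2) that])
  have Mm[measurable]: "frontier C \<in> sets borel" by simp
  define \<mu> where "\<mu> = density h (indicator (frontier C))"
  have sets\<mu> [measurable_cong, simp]: "sets \<mu> = sets borel" by (simp add: \<mu>_def)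
  have em: "emeasure \<mu> B = ?H (frontier C \<inter> B)" if [measurable]: "B \<in> sets borel" for B
  proof -
    have "emeasure \<mu> B = emeasure h (frontier C \<inter> B)"
      unfolding \<mu>_def by (subst emeasure_density) (auto simp flip: indicator_inter_arith)
    then show ?thesis by (subst emh[symmetric]) auto
  qed
  have nn: "(\<integral>\<^sup>+x. g x \<partial>\<mu>) = (\<integral>\<^sup>+x. indicator (frontier C) x * g x \<partial>h)" if [measurable]: "g \<in> borel_measurable borel" for g
    unfolding \<mu>_def by (subst nn_integral_density) auto
  \<comment> \<open>Finitely many caps of depth below \<open>\<epsilon>\<close> cover the compact
    frontier, each of finite area by hypothesis.\<close>
  have finM: "?H (frontier C) < \<infinity>"
  proof -
    define t where "t = \<epsilon>/2"
    have t: "0 < t" "t < \<epsilon>" using \<epsilon> by (auto simp: t_def)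
    have "\<exists>u. outer_normal C p u" if "p \<in> frontier C" for p
      by (rule exists_outer_normal[OF convex closed interior_nonempty that])
    then obtain u where u: "\<And>p. p \<in> frontier C \<Longrightarrow> outer_normal C p (u p)" by metis
    have cover: "frontier C \<subseteq> (\<Union>p\<in>frontier C. {x. (p - x) \<bullet> u p < t})" using t by force
    have op: "open {x. (p - x) \<bullet> u p < t}" for p by (intro open_Collect_less continuous_intros)
    obtain F where F: "F \<subseteq> frontier C" "finite F" "frontier C \<subseteq> (\<Union>p\<in>F. {x. (p - x) \<bullet> u p < t})"
      by (rule compactE_image[OF compact_frontier[OF compact] op cover])
    have "?H (frontier C) = emeasure h (\<Union>p\<in>F. {x\<in>frontier C. (p - x) \<bullet> u p \<le> t})"
    proof -
      have eq: "frontier C = (\<Union>p\<in>F. {x\<in>frontier C. (p - x) \<bullet> u p \<le> t})" using F(3) by force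
      show ?thesis by (subst eq[symmetric]) (simp add: emh)
    qed
    also have "\<dots> \<le> (\<Sum>p\<in>F. emeasure h {x\<in>frontier C. (p - x) \<bullet> u p \<le> t})"
      by (rule emeasure_subadditive_finite) (use F in auto)
    also have "\<dots> = (\<Sum>p\<in>F. ennreal (f t))"
      by (rule sum.cong) (use F u S[OF _ t] in \<open>auto simp: emh subset_eq\<close>)
    also have "\<dots> < \<infinity>" by (simp add: ennreal_mult_less_top of_nat_less_top)
    finally show ?thesis .
  qed
  have fm: "finite_measure \<mu>"
  proof
    show "emeasure \<mu> (space \<mu>) \<noteq> \<infinity>" using finM em[of UNIV] by (simp add: \<mu>_def)
  qed
  interpret finite_measure \<mu> by (rule fm)
  define \<tau> where "\<tau> w l q = closest_point C (refl_hyp w l q)" for w l q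
  have "continuous_on UNIV (\<tau> w l)" for w l
    unfolding \<tau>_def by (intro continuous_on_compose2[OF continuous_on_closest_point[OF convex closed nonempty] continuous_on_refl_hyp]) auto
  then have \<tau>m [measurable]: "\<tau> w l \<in> borel_measurable borel" for w l by (rule borel_measurable_continuous_onI)
  define X where "X w l A \<nu> t = {q\<in>frontier C. (A - q) \<bullet> \<nu> \<le> t \<and> q \<bullet> w < l}" for w l A \<nu> t
  have Xm [measurable]: "X w l A \<nu> t \<in> sets borel" for w l A \<nu> t unfolding X_def by measurable
  have rhs: "(\<integral>\<^sup>+x. indicator {x. (A - x) \<bullet> \<nu> \<le> t} x * ennreal (l - x \<bullet> w) \<partial>\<mu>)
     = (\<integral>\<^sup>+q. indicator (X w l A \<nu> t) q * ennreal (l - q \<bullet> w) \<partial>h)" for w l A \<nu> t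
    by (subst nn, measurable, rule nn_integral_cong) (auto simp: X_def indicator_def ennreal_neg)
  have step1: "(\<integral>\<^sup>+x. indicator {x. (refl_hyp w l A - x) \<bullet> refl_hyp w 0 \<nu> \<le> t} x * ennreal (x \<bullet> w - l) \<partial>\<mu>)
      \<le> (\<integral>\<^sup>+q. indicator (X w l A \<nu> t) q * ennreal (\<tau> w l q \<bullet> w - l) \<partial>h)"
    if w: "norm w = 1" and half: "\<And>x. x \<in> C \<Longrightarrow> l \<le> x \<bullet> w \<Longrightarrow> refl_hyp w l x \<in> C"
      and on: "outer_normal C A \<nu>" "outer_normal C (refl_hyp w l A) (refl_hyp w 0 \<nu>)" and t: "t < \<epsilon>'" for w l A \<nu> t
  proof -
    define Y where "Y = {x\<in>frontier C. (refl_hyp w l A - x) \<bullet> refl_hyp w 0 \<nu> \<le> t \<and> l < x \<bullet> w}"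
    have [measurable]: "Y \<in> sets borel" unfolding Y_def by measurable
    define N1 where "N1 = density h (indicator Y :: 'a \<Rightarrow> ennreal)"
    define N2 where "N2 = distr (density h (indicator (X w l A \<nu> t) :: 'a \<Rightarrow> ennreal)) borel (\<tau> w l)"
    have "N1 \<le> N2"
    proof (subst le_measure)
      show "\<forall>B\<in>sets N1. emeasure N1 B \<le> emeasure N2 B"
      proof
        fix B assume "B \<in> sets N1"
        then have B[measurable]: "B \<in> sets borel" by (simp add: N1_def)
        have \<tau>B[measurable]: "\<tau> w l -` B \<in> sets borel" using measurable_sets[OF \<tau>m B] by simp
        have "emeasure N1 B = ?H (Y \<inter> B)"
          unfolding N1_def by (subst emeasure_density) (auto simp: emh simp flip: indicator_inter_arith)
        also have "\<dots> \<le> ?H (X w l A \<nu> t \<inter> \<tau> w l -` B)"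
          unfolding Y_def X_def \<tau>_def
          by (rule hausdorff_measure_reflected_cap[OF w half on _ \<delta>(2)]) (use t \<epsilon>' in auto)
        also have "\<dots> = emeasure (density h (indicator (X w l A \<nu> t) :: 'a \<Rightarrow> ennreal)) (\<tau> w l -` B)"
          by (subst emeasure_density) (auto simp: emh simp flip: indicator_inter_arith)
        also have "\<dots> = emeasure N2 B" unfolding N2_def by (subst emeasure_distr) auto
        finally show "emeasure N1 B \<le> emeasure N2 B" .
      qed
    qed (simp add: N1_def N2_def)
    then have "(\<integral>\<^sup>+x. ennreal (x \<bullet> w - l) \<partial>N1) \<le> (\<integral>\<^sup>+x. ennreal (x \<bullet> w - l) \<partial>N2)"
      by (rule nn_integral_mono_measure[rotated]) (simp add: N1_def N2_def)
    also have "\<dots> = (\<integral>\<^sup>+q. indicator (X w l A \<nu> t) q * ennreal (\<tau> w l q \<bullet> w - l) \<partial>h)"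
      unfolding N2_def by (subst nn_integral_distr, measurable, subst nn_integral_density) auto
    also have "(\<integral>\<^sup>+x. ennreal (x \<bullet> w - l) \<partial>N1) = (\<integral>\<^sup>+x. indicator Y x * ennreal (x \<bullet> w - l) \<partial>h)"
      unfolding N1_def by (subst nn_integral_density) auto
    also have "\<dots> = (\<integral>\<^sup>+x. indicator {x. (refl_hyp w l A - x) \<bullet> refl_hyp w 0 \<nu> \<le> t} x * ennreal (x \<bullet> w - l) \<partial>\<mu>)"
      by (subst nn, measurable, rule nn_integral_cong) (auto simp: Y_def indicator_def ennreal_neg)
    finally show ?thesis .
  qed
  have pw: "indicator (X w l A \<nu> t) q * ennreal (\<tau> w l q \<bullet> w - l) \<le> indicator (X w l A \<nu> t) q * ennreal (l - q \<bullet> w)"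
    if w: "norm w = 1" and half: "\<And>x. x \<in> C \<Longrightarrow> l \<le> x \<bullet> w \<Longrightarrow> refl_hyp w l x \<in> C" for w l A \<nu> t q
  proof (cases "q \<in> X w l A \<nu> t")
    case True
    then have "q \<in> C" "q \<bullet> w < l" using frontier_subset by (auto simp: X_def)
    then show ?thesis using True closest_point_refl_hyp_inner(1)[OF w half] by (simp add: \<tau>_def ennreal_leI)
  qed simp
  have ebody: "equal_caps_body \<mu> C f' \<epsilon>'" if f': "f' = (\<lambda>t. enn2real (ennreal (f t)))" for f'
  proof unfold_locales
    show "AE x in \<mu>. x \<in> C"
      unfolding \<mu>_def by (subst AE_density) (use frontier_subset in \<open>auto simp: indicator_def\<close>)
    show "measure \<mu> {x. (p - x) \<bullet> u \<le> t} = f' t" if "outer_normal C p u" "0 < t" "t < \<epsilon>'" for p u t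
    proof -
      have "emeasure \<mu> {x. (p - x) \<bullet> u \<le> t} = ennreal (f t)"
        using S[OF that(1,2)] that(3) \<epsilon>' by (subst em) (auto simp: Int_def)
      then show ?thesis by (simp add: measure_def f')
    qed
    fix w A \<nu> :: 'a and l t :: real
    assume w: "norm w = 1" and half: "\<And>x. x \<in> C \<Longrightarrow> l \<le> x \<bullet> w \<Longrightarrow> refl_hyp w l x \<in> C"
      and on: "outer_normal C A \<nu>" "outer_normal C (refl_hyp w l A) (refl_hyp w 0 \<nu>)" and t: "0 < t" "t < \<epsilon>'"
    note pw' = pw[OF w half, where A=A and \<nu>=\<nu> and t=t]
    note st = step1[OF w half on t(2)]
    have mid: "(\<integral>\<^sup>+q. indicator (X w l A \<nu> t) q * ennreal (\<tau> w l q \<bullet> w - l) \<partial>h)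
       \<le> (\<integral>\<^sup>+q. indicator (X w l A \<nu> t) q * ennreal (l - q \<bullet> w) \<partial>h)"
      by (intro nn_integral_mono pw')
    show "(\<integral>\<^sup>+x. indicator {x. (refl_hyp w l A - x) \<bullet> refl_hyp w 0 \<nu> \<le> t} x * ennreal (x \<bullet> w - l) \<partial>\<mu>)
        \<le> (\<integral>\<^sup>+x. indicator {x. (A - x) \<bullet> \<nu> \<le> t} x * ennreal (l - x \<bullet> w) \<partial>\<mu>)"
      unfolding rhs using st mid by (rule order_trans)
    fix q
    assume E: "(\<integral>\<^sup>+x. indicator {x. (refl_hyp w l A - x) \<bullet> refl_hyp w 0 \<nu> \<le> t} x * ennreal (x \<bullet> w - l) \<partial>\<mu>)
        = (\<integral>\<^sup>+x. indicator {x. (A - x) \<bullet> \<nu> \<le> t} x * ennreal (l - x \<bullet> w) \<partial>\<mu>)"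
      and q: "q \<in> frontier C" "q \<bullet> w < l" "(A - q) \<bullet> \<nu> < t"
    have eq: "(\<integral>\<^sup>+q. indicator (X w l A \<nu> t) q * ennreal (\<tau> w l q \<bullet> w - l) \<partial>h)
       = (\<integral>\<^sup>+q. indicator (X w l A \<nu> t) q * ennreal (l - q \<bullet> w) \<partial>h)"
      using mid st[unfolded E rhs] by (rule antisym)
    have cw: "continuous_on C (\<lambda>y. l - y \<bullet> w)" by (intro continuous_intros)
    have "bounded ((\<lambda>y. l - y \<bullet> w) ` C)" by (intro compact_imp_bounded compact_continuous_image cw compact)
    then obtain B where B: "\<And>y. y \<in> C \<Longrightarrow> \<bar>l - y \<bullet> w\<bar> \<le> B" unfolding bounded_iff by auto
    have "(\<integral>\<^sup>+q. indicator (X w l A \<nu> t) q * ennreal (l - q \<bullet> w) \<partial>h) \<le> (\<integral>\<^sup>+y. ennreal B * indicator (frontier C) y \<partial>h)"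
      by (rule nn_integral_mono)
         (use B frontier_subset in \<open>auto simp: indicator_def X_def abs_le_iff subset_eq intro!: ennreal_leI\<close>)
    also have "\<dots> = ennreal B * ?H (frontier C)" by (subst nn_integral_cmult_indicator) (auto simp: emh)
    also have "\<dots> < \<infinity>" using finM by (simp add: ennreal_mult_less_top)
    finally have fin: "(\<integral>\<^sup>+q. indicator (X w l A \<nu> t) q * ennreal (l - q \<bullet> w) \<partial>h) < \<infinity>" .
    have AE: "AE q in h. indicator (X w l A \<nu> t) q * ennreal (l - q \<bullet> w) \<le> indicator (X w l A \<nu> t) q * ennreal (\<tau> w l q \<bullet> w - l)"
      by (rule nn_integral_eq_imp_AE_le[OF _ _ pw' eq fin]) measurable
    show "refl_hyp w l q \<in> C"
    proof (rule ccontr)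
      assume q': "refl_hyp w l q \<notin> C"
      define U where "U = {y. y \<bullet> w < l} \<inter> {y. (A - y) \<bullet> \<nu> < t} \<inter> refl_hyp w l -` (- C)"
      have oR: "open (refl_hyp w l -` (- C))"
        by (intro open_vimage continuous_on_refl_hyp open_Compl closed)
      have oU: "open U" unfolding U_def
        by (intro open_Int oR open_Collect_less continuous_intros)
      have "q \<in> U" using q q' by (simp add: U_def)
      then have pos: "0 < ?H (frontier C \<inter> U)"
        by (rule hausdorff_measure_frontier_pos[OF n convex closed interior_nonempty q(1) oU])
      have "AE y in h. y \<notin> frontier C \<inter> U"
        using AE
      proof eventually_elim
        fix y assume *: "indicator (X w l A \<nu> t) y * ennreal (l - y \<bullet> w) \<le> indicator (X w l A \<nu> t) y * ennreal (\<tau> w l y \<bullet> w - l)"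
        show "y \<notin> frontier C \<inter> U"
        proof
          assume y: "y \<in> frontier C \<inter> U"
          then have yX: "y \<in> X w l A \<nu> t" and yC: "y \<in> C" "y \<bullet> w < l" "refl_hyp w l y \<notin> C"
            using frontier_subset by (auto simp: U_def X_def)
          have "\<tau> w l y \<bullet> w - l < l - y \<bullet> w"
            unfolding \<tau>_def by (rule closest_point_refl_hyp_inner(2)[OF w half yC])
          then show False using * yX yC(2) by (simp add: ennreal_le_iff2)
        qed
      qed
      then have "emeasure h (frontier C \<inter> U) = 0" using oU by (subst (asm) AE_iff_measurable[of "frontier C \<inter> U"]) auto
      then show False using pos oU by (simp add: emh)
    qed
  qed (use compact convex interior_nonempty \<epsilon>' in auto)
  have "\<exists>l. \<forall>x\<in>C. refl_hyp w l x \<in> C" if "norm w = 1" for w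
    using equal_caps_body.symmetric_in_direction[OF ebody[OF refl] that] .
  then show ?thesis by (rule symmetric_imp_ball[OF compact convex interior_nonempty])
qed

text \<open>Each point of the slice is the projection along \<open>u\<close> of a frontier point
  above it. Bounded surface caps thus give bounded slices.\<close>

lemma hausdorff_measure_slice_le_surface:
  fixes C :: "'a::euclidean_space set"
  assumes C: "closed C" and u: "outer_normal C p u" and t: "0 \<le> t"
  shows "hausdorff_measure d {x\<in>C. (p - x) \<bullet> u = t} \<le> hausdorff_measure d {x\<in>frontier C. (p - x) \<bullet> u \<le> t}"
proof (rule hausdorff_measure_projection[OF outer_normalD(2)[OF u]])
  note uu = outer_normalD(3)[OF u]
  show "{x\<in>C. (p - x) \<bullet> u = t} \<subseteq> (\<lambda>x. x - (x \<bullet> u) *\<^sub>R u + (p \<bullet> u - t) *\<^sub>R u) ` {x\<in>frontier C. (p - x) \<bullet> u \<le> t}"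
  proof
    fix x assume "x \<in> {x\<in>C. (p - x) \<bullet> u = t}"
    then have x: "x \<in> C" "x \<bullet> u = p \<bullet> u - t" by (auto simp: inner_diff_left)
    have far: "x + (t + 1) *\<^sub>R u \<notin> C"
      using outer_normalD(4)[OF u, of "x + (t + 1) *\<^sub>R u"] uu x(2) by (auto simp: inner_diff_left inner_add_left)
    have "closed_segment x (x + (t + 1) *\<^sub>R u) \<inter> frontier C \<noteq> {}"
      by (rule connected_Int_frontier[OF connected_segment]) (use x far in auto)
    then obtain y where y: "y \<in> closed_segment x (x + (t + 1) *\<^sub>R u)" "y \<in> frontier C" by blast
    then obtain c where c: "0 \<le> c" "y = (1 - c) *\<^sub>R x + c *\<^sub>R (x + (t + 1) *\<^sub>R u)" by (auto simp: in_segment)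
    define s where "s = c * (t + 1)"
    have s: "0 \<le> s" "y = x + s *\<^sub>R u" using c t by (simp_all add: s_def algebra_simps)
    have yu: "y \<bullet> u = p \<bullet> u - t + s" using uu x(2) by (simp add: s(2) inner_add_left)
    have "y - (y \<bullet> u) *\<^sub>R u + (p \<bullet> u - t) *\<^sub>R u = x"
      unfolding yu by (simp add: s(2) algebra_simps)
    moreover have "(p - y) \<bullet> u \<le> t" using yu s(1) by (simp add: inner_diff_left)
    ultimately show "x \<in> (\<lambda>x. x - (x \<bullet> u) *\<^sub>R u + (p \<bullet> u - t) *\<^sub>R u) ` {x\<in>frontier C. (p - x) \<bullet> u \<le> t}"
      using y(2) by (auto intro!: image_eqI[of _ _ y])
  qed
qed

section \<open>Uniformly bounded caps force boundedness; slices determine volumes\<close>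

lemma of_nat_mult_bounded_imp_zero:
  fixes h :: ennreal
  assumes "\<And>N::nat. 0 < N \<Longrightarrow> of_nat N * h \<le> ennreal F" shows "h = 0"
proof (rule ccontr)
  assume h: "h \<noteq> 0"
  have "h \<le> ennreal F" using assms[of 1] by simp
  then obtain x where x: "h = ennreal x" "0 \<le> x" by (cases h rule: ennreal_cases) (auto simp: top_unique)
  then have x0: "0 < x" using h by (cases "x = 0") auto
  obtain N :: nat where N: "max 0 F / x < real N" using reals_Archimedean2 by blast
  then have N0: "0 < N" using x0 by (cases N) (auto simp: divide_less_0_iff not_less[symmetric])
  have "ennreal (real N * x) \<le> ennreal F" using assms[OF N0] x by (simp add: ennreal_mult ennreal_of_nat_eq_real_of_nat)
  then have "real N * x \<le> max 0 F" using x0 by (cases "F \<ge> 0") (auto simp: ennreal_neg N0)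
  then show False using N x0 by (simp only: pos_divide_less_eq)
qed

lemma unbounded_convex_slices:
  fixes C :: "'a::euclidean_space set"
  assumes n: "DIM('a) = Suc n" "0 < n" and C: "convex C" "closed C" "frontier C \<noteq> {}" "\<not> bounded C"
    and r: "cball z r \<subseteq> C" and t: "0 < t" "t \<le> r"
  shows "\<not> (\<forall>p u. outer_normal C p u \<longrightarrow> hausdorff_measure n {x\<in>C. (p - x) \<bullet> u = t} \<le> ennreal F)"
proof
  assume F: "\<forall>p u. outer_normal C p u \<longrightarrow> hausdorff_measure n {x\<in>C. (p - x) \<bullet> u = t} \<le> ennreal F"
  obtain b :: 'a where b: "b \<in> Basis" using nonempty_Basis by blast
  \<comment> \<open>Half of the radius \<open>sqrt (r * t)\<close> that fits into the slice, since
    the packing requires room for twice the disc.\<close>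
  define \<rho> where "\<rho> = sqrt (r * t) / 2"
  have \<rho>: "0 < \<rho>" using t by (simp add: \<rho>_def)
  have "of_nat N * hausdorff_measure n (disc b \<rho>) \<le> ennreal F" if N: "0 < N" for N :: nat
  proof -
    have dim: "2 \<le> DIM('a)" using n by simp
    have R: "0 < 4 * real N * \<rho>" using N \<rho> by simp
    obtain p u y where u: "outer_normal C p u"
      and disc: "\<And>v. v \<bullet> u = 0 \<Longrightarrow> norm v ^ 2 \<le> r * t \<Longrightarrow> p - t *\<^sub>R u + v \<in> C"
      and y: "y \<in> C" "(p - y) \<bullet> u = t" "4 * real N * \<rho> \<le> norm (y - (p - t *\<^sub>R u))"
      using unbounded_convex_long_cap[OF dim C r t R] by metis
    note uu = outer_normalD(3)[OF u]
    let ?X = "{x\<in>C. (p - x) \<bullet> u = t}"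
    have tr: "(\<lambda>x. x + a) ` disc u \<rho> \<in> sets borel" for a
    proof -
      have "(\<lambda>x. x + a) ` disc u \<rho> = (\<lambda>x. x - a) -` disc u \<rho>"
        by (auto simp: image_iff intro!: bexI[of _ "_ - a"])
      then show ?thesis using measurable_sets[OF _ disc_borel, of "\<lambda>x. x - a" borel] by simp
    qed
    have clX: "closed ?X"
      using C(2) by (intro closed_Collect_conj closed_Collect_eq continuous_intros) simp
    have "of_nat N * emeasure (hausdorff_borel n) (disc u \<rho>) \<le> emeasure (hausdorff_borel n) ?X"
    proof (rule packing_translates[where z="p - t *\<^sub>R u" and y=y and \<rho>=\<rho>])
      show "emeasure (hausdorff_borel n) ((\<lambda>x. x + a) ` disc u \<rho>) = emeasure (hausdorff_borel n) (disc u \<rho>)" for a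
        using tr n(2) by (simp add: emeasure_hausdorff_borel hausdorff_measure_translation)
      show "convex ?X"
      proof -
        have "?X = C \<inter> {x. u \<bullet> x = p \<bullet> u - t}" by (auto simp: inner_diff_left inner_commute[of u])
        then show ?thesis using C(1) by (simp add: convex_Int convex_hyperplane)
      qed
      show "p - t *\<^sub>R u + c *\<^sub>R v \<in> ?X" if v: "v \<in> disc u \<rho>" and c: "0 \<le> c" "c \<le> 2" for v c
      proof -
        have v': "v \<bullet> u = 0" "norm v < \<rho>" using v by (auto simp: disc_def)
        have "norm (c *\<^sub>R v) \<le> 2 * \<rho>" using c v'(2) by (simp add: mult_mono)
        then have "norm (c *\<^sub>R v) ^ 2 \<le> (2 * \<rho>) ^ 2" by (intro power_mono) auto
        also have "\<dots> = r * t" using t by (simp add: \<rho>_def)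
        finally show ?thesis using disc[of "c *\<^sub>R v"] v'(1) uu by (simp add: inner_diff_left inner_add_left)
      qed
    qed (use clX y N in \<open>auto simp: disc_def\<close>)
    then have "of_nat N * hausdorff_measure n (disc u \<rho>) \<le> hausdorff_measure n ?X"
      using clX n(2) by (simp add: emeasure_hausdorff_borel)
    also have "\<dots> \<le> ennreal F" using F u by blast
    finally show ?thesis using hausdorff_measure_disc_eq[of u b n \<rho>] outer_normalD(2)[OF u] b by simp
  qed
  then have "hausdorff_measure n (disc b \<rho>) = 0" by (rule of_nat_mult_bounded_imp_zero)
  moreover have "0 < hausdorff_measure n (disc b \<rho>)"
    by (rule hausdorff_measure_disc_pos) (use n b \<rho> in auto)
  ultimately show False by simp
qed

text \<open>The long cap contains a ball of radius \<open>t\<close> about a point at depth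
  \<open>t\<close>, whence the depth bound \<open>2 * t\<close>; balls of half that radius are
  packed.\<close>

lemma unbounded_convex_volumes:
  fixes C :: "'a::euclidean_space set"
  assumes n: "2 \<le> DIM('a)" and C: "convex C" "closed C" "frontier C \<noteq> {}" "\<not> bounded C"
    and r: "cball z r \<subseteq> C" and t: "0 < t" "t \<le> r"
  shows "\<not> (\<forall>p u. outer_normal C p u \<longrightarrow> emeasure lborel {x\<in>C. (p - x) \<bullet> u \<le> 2 * t} \<le> ennreal F)"
proof
  assume F: "\<forall>p u. outer_normal C p u \<longrightarrow> emeasure lborel {x\<in>C. (p - x) \<bullet> u \<le> 2 * t} \<le> ennreal F"
  have "of_nat N * emeasure lborel (ball (0::'a) (t/2)) \<le> ennreal F" if N: "0 < N" for N :: nat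
  proof -
    have R: "0 < 4 * real N * (t/2)" using N t by simp
    obtain p u y where u: "outer_normal C p u" and ball: "ball (p - t *\<^sub>R u) t \<subseteq> C"
      and y: "y \<in> C" "(p - y) \<bullet> u = t" "4 * real N * (t/2) \<le> norm (y - (p - t *\<^sub>R u))"
      using unbounded_convex_long_cap[OF n C r t R] by metis
    let ?X = "{x\<in>C. (p - x) \<bullet> u \<le> 2 * t}"
    have clX: "closed ?X"
      using C(2) by (intro closed_Collect_conj closed_Collect_le continuous_intros) simp
    have "of_nat N * emeasure lborel (ball (0::'a) (t/2)) \<le> emeasure lborel ?X"
    proof (rule packing_translates[where z="p - t *\<^sub>R u" and y=y and \<rho>="t/2"])
      show "emeasure lborel ((\<lambda>x. x + a) ` ball 0 (t/2)) = emeasure lborel (ball (0::'a) (t/2))" for a :: 'a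
      proof -
        have "(\<lambda>x. x + a) ` ball 0 (t/2) = ball a (t/2)"
          by (auto simp: image_iff dist_norm norm_minus_commute intro!: bexI[of _ "_ - a"])
        then show ?thesis using t by (simp add: emeasure_ball)
      qed
      show "convex ?X"
      proof -
        have "?X = C \<inter> {x. u \<bullet> x \<ge> p \<bullet> u - 2 * t}" by (auto simp: inner_diff_left inner_commute[of u])
        then show ?thesis using C(1) by (simp add: convex_Int convex_halfspace_ge)
      qed
      show "p - t *\<^sub>R u + c *\<^sub>R v \<in> ?X" if v: "v \<in> ball 0 (t/2)" and c: "0 \<le> c" "c \<le> 2" for v c
      proof -
        have "c * norm v \<le> 2 * norm v" using c by (intro mult_right_mono) auto
        then have cv: "norm (c *\<^sub>R v) < t" using v c by simp
        then have "p - t *\<^sub>R u + c *\<^sub>R v \<in> C" by (intro subsetD[OF ball]) (simp add: dist_norm)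
        moreover have "\<bar>(c *\<^sub>R v) \<bullet> u\<bar> \<le> t"
          using Cauchy_Schwarz_ineq2[of "c *\<^sub>R v" u] outer_normalD(2)[OF u] cv by simp
        ultimately show ?thesis using outer_normalD(3)[OF u] by (simp add: inner_diff_left inner_add_left)
      qed
    qed (use clX y N t in auto)
    also have "\<dots> \<le> ennreal F" using F u by blast
    finally show ?thesis .
  qed
  then have "emeasure lborel (ball (0::'a) (t/2)) = 0" by (rule of_nat_mult_bounded_imp_zero)
  then show False using emeasure_ball_neq_0[of "t/2" "0::'a"] t by simp
qed

text \<open>The volume of a cap is, up to \<open>\<kappa>\<close>, the integral of its slice areas
  over the depth. That discs have finite measure follows from the hypothesis: the slice at the
  contact point of an inscribed ball contains one.\<close>

lemma equal_slices_imp_equal_volumes: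
  fixes C :: "'a::euclidean_space set"
  assumes n: "0 < n" "DIM('a) = Suc n" and C: "convex C" "closed C" "interior C \<noteq> {}" "frontier C \<noteq> {}"
    and \<epsilon>: "0 < \<epsilon>"
    and A: "\<And>p u t. outer_normal C p u \<Longrightarrow> 0 < t \<Longrightarrow> t < \<epsilon> \<Longrightarrow>
      hausdorff_measure n {x\<in>C. (p - x) \<bullet> u = t} = ennreal (f t)"
    and on: "outer_normal C p u" "outer_normal C q v" and t: "t < \<epsilon>"
  shows "emeasure lborel {x\<in>C. (p - x) \<bullet> u \<le> t} = emeasure lborel {x\<in>C. (q - x) \<bullet> v \<le> t}"
proof -
  obtain z where "z \<in> interior C" using C(3) by blast
  then obtain r where r: "0 < r" "cball z r \<subseteq> C" using mem_interior_cball by blast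
  obtain p0 \<rho> where on0: "outer_normal C p0 ((p0 - z) /\<^sub>R \<rho>)" and \<rho>: "r \<le> \<rho>" "cball z \<rho> \<subseteq> C"
    using nearest_frontier_ball[OF C r(2,1)] by metis
  define u0 where "u0 = (p0 - z) /\<^sub>R \<rho>"
  note u0 = on0[folded u0_def]
  have \<rho>0: "0 < \<rho>" using r \<rho> by simp
  have p0: "p0 = z + \<rho> *\<^sub>R u0" using \<rho>0 by (simp add: u0_def)
  define s where "s = min \<rho> (\<epsilon>/2)"
  have s: "0 < s" "s \<le> \<rho>" "s < \<epsilon>" using \<rho>0 \<epsilon> by (auto simp: s_def)
  have "(\<lambda>x. x + (p0 - s *\<^sub>R u0)) ` disc u0 s \<subseteq> {x\<in>C. (p0 - x) \<bullet> u0 = s}"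
  proof safe
    fix v assume "v \<in> disc u0 s"
    then have v: "v \<bullet> u0 = 0" "norm v < s" by (auto simp: disc_def)
    have "norm (v + (\<rho> - s) *\<^sub>R u0) \<le> norm v + \<bar>\<rho> - s\<bar>"
      using norm_triangle_ineq[of v "(\<rho> - s) *\<^sub>R u0"] outer_normalD(2)[OF u0] by simp
    moreover define y where "y = v + (\<rho> - s) *\<^sub>R u0"
    ultimately have "norm y \<le> \<rho>" using v(2) s(2) by simp
    then have "z + y \<in> C" by (intro subsetD[OF \<rho>(2)]) (simp add: dist_norm)
    then show "v + (p0 - s *\<^sub>R u0) \<in> C" by (simp add: p0 y_def algebra_simps)
    show "(p0 - (v + (p0 - s *\<^sub>R u0))) \<bullet> u0 = s"
      using v(1) outer_normalD(3)[OF u0] by (simp add: inner_diff_left inner_add_left)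
  qed
  from hausdorff_measure_mono[OF this, of n] A[OF u0 s(1,3)]
  have fin: "hausdorff_measure n (disc u0 s) < \<infinity>"
    by (simp add: hausdorff_measure_translation le_less_trans)
  obtain \<kappa> where \<kappa>: "0 < \<kappa>"
    "\<And>u::'a. norm u = 1 \<Longrightarrow> \<forall>B\<in>sets borel. (\<lambda>s. hausdorff_measure n {x\<in>B. x \<bullet> u = s}) \<in> borel_measurable borel"
    "\<And>(u::'a) B. norm u = 1 \<Longrightarrow> B \<in> sets borel \<Longrightarrow>
       (\<integral>\<^sup>+s. hausdorff_measure n {x\<in>B. x \<bullet> u = s} \<partial>lborel) = ennreal \<kappa> * emeasure lborel B"
    by (rule hausdorff_fubini[OF n s(1) outer_normalD(2)[OF u0] fin]) (rule that)
  define B where "B p u = {x\<in>C. (p - x) \<bullet> u \<le> t}" for p u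
  define m where "m p u s = hausdorff_measure n {x\<in>B p u. x \<bullet> u = p \<bullet> u - s}" for p u s
  have vol: "ennreal \<kappa> * emeasure lborel (B p u) = (\<integral>\<^sup>+s. m p u s \<partial>lborel)" if u: "outer_normal C p u" for p u
  proof -
    have Bm: "B p u \<in> sets borel"
      unfolding B_def using C(2) by (intro borel_closed closed_Collect_conj closed_Collect_le continuous_intros) simp
    have nu: "norm u = 1" using outer_normalD(2)[OF u] .
    have meas: "(\<lambda>s. hausdorff_measure n {x\<in>B p u. x \<bullet> u = s}) \<in> borel_measurable borel"
      using \<kappa>(2)[OF nu] Bm by blast
    show ?thesis
      using \<kappa>(3)[OF nu Bm] nn_integral_real_affine[OF meas, of "-1" "p \<bullet> u"] by (simp add: m_def)
  qed
  \<comment> \<open>Depths \<open>0\<close> and \<open>t\<close> are left out: at depth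
    \<open>0\<close> the hypothesis says nothing, and two levels do not affect the integral.\<close>
  have m: "m p u s = (if 0 < s \<and> s < t then ennreal (f s) else 0)"
    if u: "outer_normal C p u" and s: "s \<noteq> 0" "s \<noteq> t" for p u s
  proof (cases "0 < s \<and> s < t")
    case True
    then have "{x\<in>B p u. x \<bullet> u = p \<bullet> u - s} = {x\<in>C. (p - x) \<bullet> u = s}"
      by (auto simp: B_def inner_diff_left)
    then show ?thesis using A[OF u, of s] True t by (simp add: m_def)
  next
    case False
    then have "{x\<in>B p u. x \<bullet> u = p \<bullet> u - s} = {}"
      using s outer_normalD(4)[OF u] by (force simp: B_def inner_diff_left)
    then show ?thesis using False unfolding m_def by (simp only: hausdorff_measure_empty[OF n(1)]) simp
  qed
  have "ennreal \<kappa> * emeasure lborel (B p u) = ennreal \<kappa> * emeasure lborel (B q v)"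
    unfolding vol[OF on(1)] vol[OF on(2)]
  proof (rule nn_integral_cong_AE)
    show "AE s in lborel. m p u s = m q v s"
      using AE_lborel_singleton[of 0] AE_lborel_singleton[of t]
      by eventually_elim (simp add: m[OF on(1)] m[OF on(2)])
  qed
  then show ?thesis using \<kappa>(1) by (subst (asm) ennreal_mult_cancel_left) (auto simp: B_def)
qed

theorem theorem3:
  fixes M C :: "'a::euclidean_space set"
  assumes "DIM('a) \<ge> 2"
    and "closed C" and "convex C" and "interior C \<noteq> {}"
    and "M = frontier C" and "M \<noteq> {}"
    and "connected M"
    and "smooth_hypersurface M"
    and "independent_of_point M (area_A C) \<or>
         independent_of_point M (volume_V C) \<or>
         independent_of_point M (surface_S M)"
  shows "\<exists>c a. a > 0 \<and> M = sphere c a"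
proof -
  note C = assms(3,2,4) and M = assms(5)
  define n where "n = DIM('a) - 1"
  have n: "DIM('a) = Suc n" "0 < n" using assms(1) by (auto simp: n_def)
  have ne: "frontier C \<noteq> {}" using assms(5,6) by simp
  \<comment> \<open>The quantities in the hypotheses are measured along inner normals, so they are
    invoked with \<open>- u\<close>.\<close>
  have normal: "p \<in> M" "unit_normal_to_side M p (- u)" if "outer_normal C p u" for p u
    using outer_normal_frontier[OF that] outer_normal_imp_unit_normal_to_side[OF assms(2) that] by (simp_all add: M)
  have body: "convex_body C" if "bounded C"
    using that C unique_outer_normal[OF assms(2,4)] assms(8) M
    by unfold_locales (auto simp: compact_eq_bounded_closed)
  obtain z where "z \<in> interior C" using assms(4) by blast
  then obtain r where r: "0 < r" "cball z r \<subseteq> C" using mem_interior_cball by blast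
  have "\<exists>c a. a > 0 \<and> C = cball c a"
    using assms(9)
  proof (elim disjE)
    assume "independent_of_point M (area_A C)"
    then obtain \<epsilon> f where \<epsilon>: "0 < \<epsilon>" and f: "\<And>t p u. t \<in> {0<..<\<epsilon>} \<Longrightarrow> p \<in> M \<Longrightarrow> unit_normal_to_side M p u \<Longrightarrow>
        area_A C p u t = ennreal (f t)" unfolding independent_of_point_def by blast
    have A: "hausdorff_measure n {x\<in>C. (p - x) \<bullet> u = t} = ennreal (f t)"
      if "outer_normal C p u" "0 < t" "t < \<epsilon>" for p u t
    proof -
      have "{x\<in>C. (x - p) \<bullet> - u = t} = {x\<in>C. (p - x) \<bullet> u = t}" by (auto simp: inner_diff_left)
      then show ?thesis using f[of t p "- u"] that normal[OF that(1)] by (simp add: area_A_def n_def)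
    qed
    define t where "t = min r (\<epsilon>/2)"
    have t: "0 < t" "t \<le> r" "t < \<epsilon>" using r \<epsilon> by (auto simp: t_def)
    have bdd: "bounded C"
      using unbounded_convex_slices[OF n C(1,2) ne _ r(2) t(1,2), of "f t"] A[OF _ t(1,3)] by force
    interpret convex_body C by (rule body[OF bdd])
    obtain b :: 'a where b: "b \<in> Basis" using nonempty_Basis by blast
    obtain q where q: "outer_normal C q b"
      using exists_outer_normal_direction[OF compact nonempty norm_Basis[OF b]] by blast
    let ?f = "\<lambda>t. enn2real (emeasure lborel {x\<in>C. (q - x) \<bullet> b \<le> t})"
    show ?thesis
    proof (rule equal_volume_caps_imp_ball[OF body[OF bdd] \<epsilon>, of ?f])
      fix p u t assume u: "outer_normal C p u" and t: "0 < t" "t < \<epsilon>"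
      have "emeasure lborel {x\<in>C. (p - x) \<bullet> u \<le> t} = emeasure lborel {x\<in>C. (q - x) \<bullet> b \<le> t}"
        by (rule equal_slices_imp_equal_volumes[OF n(2,1) C ne \<epsilon> A u q t(2)])
      moreover have "emeasure lborel {x\<in>C. (q - x) \<bullet> b \<le> t} < \<infinity>"
        by (intro emeasure_bounded_finite bounded_subset[OF bdd]) auto
      ultimately show "emeasure lborel {x\<in>C. (p - x) \<bullet> u \<le> t} = ennreal (?f t)" by simp
    qed
  next
    assume "independent_of_point M (volume_V C)"
    then obtain \<epsilon> f where \<epsilon>: "0 < \<epsilon>" and f: "\<And>t p u. t \<in> {0<..<\<epsilon>} \<Longrightarrow> p \<in> M \<Longrightarrow> unit_normal_to_side M p u \<Longrightarrow>
        volume_V C p u t = ennreal (f t)" unfolding independent_of_point_def by blast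
    have V: "emeasure lborel {x\<in>C. (p - x) \<bullet> u \<le> t} = ennreal (f t)"
      if "outer_normal C p u" "0 < t" "t < \<epsilon>" for p u t
    proof -
      have "{x\<in>C. (x - p) \<bullet> - u \<le> t} = {x\<in>C. (p - x) \<bullet> u \<le> t}" by (auto simp: inner_diff_left)
      then show ?thesis using f[of t p "- u"] that normal[OF that(1)] by (simp add: volume_V_def)
    qed
    define t where "t = min r (\<epsilon>/4)"
    \<comment> \<open>The bounded cap has depth \<open>2 * t\<close>, so \<open>\<epsilon>/4\<close>
      keeps it within the range of the hypothesis.\<close>
    have t: "0 < t" "t \<le> r" "0 < 2 * t" "2 * t < \<epsilon>" using r \<epsilon> by (auto simp: t_def)
    have "bounded C"
      using unbounded_convex_volumes[OF assms(1) C(1,2) ne _ r(2) t(1,2), of "f (2 * t)"] V[OF _ t(3,4)] by force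
    then show ?thesis using equal_volume_caps_imp_ball[OF body \<epsilon> V] by blast
  next
    assume "independent_of_point M (surface_S M)"
    then obtain \<epsilon> f where \<epsilon>: "0 < \<epsilon>" and f: "\<And>t p u. t \<in> {0<..<\<epsilon>} \<Longrightarrow> p \<in> M \<Longrightarrow> unit_normal_to_side M p u \<Longrightarrow>
        surface_S M p u t = ennreal (f t)" unfolding independent_of_point_def by blast
    have S: "hausdorff_measure n {x\<in>frontier C. (p - x) \<bullet> u \<le> t} = ennreal (f t)"
      if "outer_normal C p u" "0 < t" "t < \<epsilon>" for p u t
    proof -
      have "(x - p) \<bullet> u \<le> 0" if "x \<in> M" for x
        using outer_normalD(4)[OF \<open>outer_normal C p u\<close>] that frontier_subset_closed[OF assms(2)] M by blast
      then have "{x\<in>M. 0 \<le> (x - p) \<bullet> - u \<and> (x - p) \<bullet> - u \<le> t} = {x\<in>frontier C. (p - x) \<bullet> u \<le> t}"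
        by (auto simp: M inner_diff_left)
      then show ?thesis using f[of t p "- u"] that normal[OF that(1)] by (simp add: surface_S_def n_def)
    qed
    define t where "t = min r (\<epsilon>/2)"
    have t: "0 < t" "t \<le> r" "t < \<epsilon>" using r \<epsilon> by (auto simp: t_def)
    have "hausdorff_measure n {x\<in>C. (p - x) \<bullet> u = t} \<le> ennreal (f t)" if "outer_normal C p u" for p u
      using hausdorff_measure_slice_le_surface[OF assms(2) that, of t n] S[OF that t(1,3)] t(1) by simp
    then have "bounded C"
      using unbounded_convex_slices[OF n C(1,2) ne _ r(2) t(1,2), of "f t"] by blast
    then show ?thesis using equal_surface_caps_imp_ball[OF n body \<epsilon> S] by blast
  qed
  then obtain c a where "0 < a" "C = cball c a" by blast
  then show ?thesis using M by (intro exI[of _ c] exI[of _ a]) (simp add: frontier_cball)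
qed

end
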